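(* Let $k$ be a field, let $x$ and $y$ be indeterminates over $k$, and let $$\sigma:=\sum_{i=1}^\infty a_ix^i\in xk[[x]]\qquad\text{and}\qquad \tau:=\sum_{i=1}^\infty b_iy^i\in yk[[y]]$$ (with $a_i,b_i\in k$) be formal power series that are algebraically independent over the fields $k(x)$ and $k(y)$, respectively. For each $n\in\mathbb N$ let $\sigma_n:=\sum_{i=n+1}^\infty a_ix^{i-n}$ and $\tau_n:=\sum_{i=n+1}^\infty b_iy^{i-n}$ be the $n$th endpieces of $\sigma$ and $\tau$, and define $$U_n:=k[x,y,\sigma_n,\tau_n],\quad U:=\bigcup_{n=1}^\infty U_n,\quad B_n:=k[x,y,\sigma_n,\tau_n]_{(x,y,\sigma_n,\tau_n)},\quad B:=\bigcup_{n=1}^\infty B_n,$$ $$A:=k(x,y,\sigma,\tau)\cap k[[x,y]].$$ Then the ring $A$ is a two-dimensional regular local domain that birationally dominates the ring $B$; $A$ has maximal ideal $(x,y)A$ and completion $\widehat A=k[[x,y]]$. Moreover: (1) The rings $U$ and $B$ are UFDs. (2) $B$ is a local Krull domain with maximal ideal $\mathbf n=(x,y)B$. (3) The dimension of $B$ is either $2$ or $3$, depending on the choice of $\sigma$ and $\tau$. (4) $B$ is Hausdorff in the topology defined by the powers of $\mathbf n$. (5) The $\mathbf n$-adic completion $\widehat B$ of $B$ is canonically isomorphic to $k[[x,y]]$. (6) The following statements are equivalent: (a) $B=A$. (b) $B$ is a two-dimensional regular local domain. (c) $B$ is Noetherian. (d) Every finitely generated ideal of $B$ is closed in the $\mathbf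 n$-adic topology on $B$. (e) Every principal ideal of $B$ is closed in the $\mathbf n$-adic topology on $B$.
   Context: All rings are regarded as subrings of the field of fractions of $k[[x,y]]$. One has $U_n\subseteq U_{n+1}$ and $B_n\subseteq B_{n+1}$ for each $n$. "Local" does not include Noetherian: a local ring is a ring with a unique maximal ideal. A local domain $A$ birationally dominates a local domain $B$ if $B\subseteq A$, the two have the same field of fractions, and the maximal ideal of $A$ contracts to the maximal ideal of $B$. *)

theory Defs
  imports
    "HOL-Algebra.Algebra"
    "HOL-Algebra.Algebraic_Closure_Type"
    "HOL-Computational_Algebra.Computational_Algebra"
    "HOL-Analysis.Analysis"
begin

section \<open>Commutative algebra\<close>

definition max_ideal :: "('a, 'b) ring_scheme \<Rightarrow> 'a set" where
  "max_ideal R = (THE M. maximalideal M R)"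

text \<open>As in the source, "local" does not include Noetherian.\<close>

definition local_ring :: "('a, 'b) ring_scheme \<Rightarrow> bool" where
  "local_ring R \<longleftrightarrow> cring R \<and> (\<exists>!M. maximalideal M R)"

definition krull_dim :: "('a, 'b) ring_scheme \<Rightarrow> enat" where
  "krull_dim R = Sup {enat n | n. \<exists>P :: nat \<Rightarrow> 'a set.
     (\<forall>i\<le>n. primeideal (P i) R) \<and> (\<forall>i<n. P i \<subset> P (Suc i))}"

definition regular_local_ring :: "('a, 'b) ring_scheme \<Rightarrow> bool" where
  "regular_local_ring R \<longleftrightarrow> noetherian_ring R \<and> local_ring R \<and>
     (\<exists>G. G \<subseteq> carrier R \<and> finite G \<and> enat (card G) = krull_dim R \<and>
          genideal R G = max_ideal R)"

definition dvr :: "('a, 'b) ring_scheme \<Rightarrow> bool" where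
  "dvr R \<longleftrightarrow> principal_domain R \<and> local_ring R \<and> \<not> field R"

text \<open>Ideal powers are powers in the library's monoid of ideals, with zeroth power the unit ideal.\<close>

abbreviation ideal_power :: "('a, 'b) ring_scheme \<Rightarrow> 'a set \<Rightarrow> nat \<Rightarrow> 'a set" where
  "ideal_power R I n \<equiv> I [^]\<^bsub>ideals_set R\<^esub> n"

definition adic_topology :: "('a, 'b) ring_scheme \<Rightarrow> 'a set \<Rightarrow> 'a topology" where
  "adic_topology R I =
     topology_generated_by {ideal_power R I n +>\<^bsub>R\<^esub> a | n a. a \<in> carrier R}"

text \<open>The inverse limit of the rings \<open>R / I^n\<close>. Cosets are compatible under the projection
  \<open>R / I^(n+1) \<rightarrow> R / I^n\<close> exactly when the former is contained in the latter.\<close>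

definition adic_completion :: "('a, 'b) ring_scheme \<Rightarrow> 'a set \<Rightarrow> (nat \<Rightarrow> 'a set) ring" where
  "adic_completion R I =
     \<lparr>carrier = {s. \<forall>n. s n \<in> carrier (R Quot ideal_power R I n) \<and> s (Suc n) \<subseteq> s n},
      monoid.mult = (\<lambda>s t n. s n \<otimes>\<^bsub>R Quot ideal_power R I n\<^esub> t n),
      monoid.one = (\<lambda>n. \<one>\<^bsub>R Quot ideal_power R I n\<^esub>),
      ring.zero = (\<lambda>n. \<zero>\<^bsub>R Quot ideal_power R I n\<^esub>),
      ring.add = (\<lambda>s t n. s n \<oplus>\<^bsub>R Quot ideal_power R I n\<^esub> t n)\<rparr>"

text \<open>For a subring \<open>R\<close> of \<open>S\<close>: the map from the \<open>I\<close>-adic completion of \<open>R\<close> to \<open>S\<close> that the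
  inclusion induces is an isomorphism. The containment says that \<open>\<phi> s\<close> is the limit of \<open>s\<close> in the
  \<open>IS\<close>-adic topology of \<open>S\<close>; if that topology is Hausdorff, it determines \<open>\<phi>\<close> and makes \<open>\<phi>\<close>
  the identity on \<open>R\<close>.\<close>

definition canonically_completes_to ::
    "('a, 'b) ring_scheme \<Rightarrow> 'a set \<Rightarrow> ('a, 'c) ring_scheme \<Rightarrow> bool" where
  "canonically_completes_to R I S \<longleftrightarrow>
     (\<exists>\<phi> \<in> ring_iso (adic_completion R I) S.
        \<forall>s \<in> carrier (adic_completion R I). \<forall>n.
          s n \<subseteq> ideal_power S (genideal S I) n +>\<^bsub>S\<^esub> \<phi> s)"

section \<open>Subrings of a field\<close>

abbreviation subring_of :: "'a::field set \<Rightarrow> 'a ring" where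
  "subring_of R \<equiv> ring_of_type_algebra\<lparr>carrier := R\<rparr>"

definition fraction_field :: "'a::field set \<Rightarrow> 'a set" where
  "fraction_field R = {a / b | a b. a \<in> R \<and> b \<in> R \<and> b \<noteq> 0}"

definition localization :: "'a::field set \<Rightarrow> 'a set \<Rightarrow> 'a set" where
  "localization R P = {a / b | a b. a \<in> R \<and> b \<in> R - P}"

definition krull_domain :: "'a::field set \<Rightarrow> bool" where
  "krull_domain R \<longleftrightarrow> domain (subring_of R) \<and>
     (\<exists>\<V>. (\<forall>V\<in>\<V>. dvr (subring_of V) \<and> fraction_field V = fraction_field R) \<and>
          R = {z \<in> fraction_field R. \<forall>V\<in>\<V>. z \<in> V} \<and>
          (\<forall>a \<in> R - {0}. finite {V \<in> \<V>. a \<notin> Units (subring_of V)}))"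

definition local_domain :: "'a::field set \<Rightarrow> bool" where
  "local_domain R \<longleftrightarrow> local_ring (subring_of R) \<and> domain (subring_of R)"

definition birationally_dominates :: "'a::field set \<Rightarrow> 'a set \<Rightarrow> bool" where
  "birationally_dominates R S \<longleftrightarrow> local_domain R \<and> local_domain S \<and> S \<subseteq> R \<and>
     fraction_field R = fraction_field S \<and>
     max_ideal (subring_of R) \<inter> S = max_ideal (subring_of S)"

definition two_dim_regular_local_domain :: "'a::field set \<Rightarrow> bool" where
  "two_dim_regular_local_domain R \<longleftrightarrow>
     domain (subring_of R) \<and> regular_local_ring (subring_of R) \<and> krull_dim (subring_of R) = 2"

section \<open>The rings of the construction\<close>

text \<open>The ring \<open>k[[x,y]]\<close> is taken as \<open>k[[x]][[y]]\<close>, the type \<open>'a fps fps\<close>. All rings below live in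
  its field of fractions \<open>'a fps fps fract\<close>.\<close>

definition power_series_xy :: "'a::field fps fps fract set" where
  "power_series_xy = range to_fract"

definition in_x :: "'a::field fps \<Rightarrow> 'a fps fps fract" where
  "in_x f = to_fract (fps_const f)"

definition in_y :: "'a::field fps \<Rightarrow> 'a fps fps fract" where
  "in_y f = to_fract (Abs_fps (\<lambda>j. fps_const (fps_nth f j)))"

abbreviation x_var :: "'a::field fps fps fract" where
  "x_var \<equiv> in_x fps_X"

abbreviation y_var :: "'a::field fps fps fract" where
  "y_var \<equiv> in_y fps_X"

definition base_field :: "'a::field fps fps fract set" where
  "base_field = range (\<lambda>c. to_fract (fps_const (fps_const c)))"

definition adjoin_ring :: "'a::field fps fps fract set \<Rightarrow> 'a fps fps fract set" where
  "adjoin_ring H = generate_ring ring_of_type_algebra (base_field \<union> H)"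

definition adjoin_field :: "'a::field fps fps fract set \<Rightarrow> 'a fps fps fract set" where
  "adjoin_field H = generate_field ring_of_type_algebra (base_field \<union> H)"

text \<open>The sum of \<open>a_i x^(i-n)\<close> over \<open>i > n\<close>; unlike \<open>fps_shift n\<close> it omits the
  constant term \<open>a_n\<close>.\<close>

definition endpiece :: "nat \<Rightarrow> 'a::field fps \<Rightarrow> 'a fps" where
  "endpiece n f = Abs_fps (\<lambda>j. if j = 0 then 0 else fps_nth f (n + j))"

definition gens :: "'a::field fps \<Rightarrow> 'a fps \<Rightarrow> nat \<Rightarrow> 'a fps fps fract set" where
  "gens \<sigma> \<tau> n = {x_var, y_var, in_x (endpiece n \<sigma>), in_y (endpiece n \<tau>)}"

definition ring_Un :: "'a::field fps \<Rightarrow> 'a fps \<Rightarrow> nat \<Rightarrow> 'a fps fps fract set" where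
  "ring_Un \<sigma> \<tau> n = adjoin_ring (gens \<sigma> \<tau> n)"

definition ring_U :: "'a::field fps \<Rightarrow> 'a fps \<Rightarrow> 'a fps fps fract set" where
  "ring_U \<sigma> \<tau> = (\<Union>n\<in>{1..}. ring_Un \<sigma> \<tau> n)"

definition ring_Bn :: "'a::field fps \<Rightarrow> 'a fps \<Rightarrow> nat \<Rightarrow> 'a fps fps fract set" where
  "ring_Bn \<sigma> \<tau> n =
     localization (ring_Un \<sigma> \<tau> n) (genideal (subring_of (ring_Un \<sigma> \<tau> n)) (gens \<sigma> \<tau> n))"

definition ring_B :: "'a::field fps \<Rightarrow> 'a fps \<Rightarrow> 'a fps fps fract set" where
  "ring_B \<sigma> \<tau> = (\<Union>n\<in>{1..}. ring_Bn \<sigma> \<tau> n)"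

definition ring_A :: "'a::field fps \<Rightarrow> 'a fps \<Rightarrow> 'a fps fps fract set" where
  "ring_A \<sigma> \<tau> = adjoin_field {x_var, y_var, in_x \<sigma>, in_y \<tau>} \<inter> power_series_xy"

definition ideal_n :: "'a::field fps \<Rightarrow> 'a fps \<Rightarrow> 'a fps fps fract set" where
  "ideal_n \<sigma> \<tau> = genideal (subring_of (ring_B \<sigma> \<tau>)) {x_var, y_var}"

end

theory Submission
  imports Defs "Berlekamp_Zassenhaus.Unique_Factorization_Poly"
begin

text \<open>The rings \<open>U\<close>, \<open>B\<close>, \<open>A\<close> are studied through their preimages in \<open>k[[x,y]]\<close>. All of them are closed
  under \<open>f(x,y) \<mapsto> f(x,0)\<close> and under division by \<open>x\<close> and by \<open>y\<close>. For \<open>B\<close> and \<open>A\<close> this alone shows that the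
  maximal ideal is \<open>(x,y)\<close> and that its \<open>n\<close>th power consists of the elements of order at least \<open>n\<close>, whence
  the completion.

  \<open>A\<close> is moreover closed under quotients that exist in \<open>k[[x,y]]\<close>. Given an ideal \<open>I\<close> of \<open>A\<close>, divide its
  elements by one whose value at \<open>y = 0\<close> has minimal order, and pass from \<open>I\<close> to \<open>(I : y)\<close>; the minimal
  order stabilizes along \<open>(I : y^j)\<close>, and from there on the ideal is principal. Hence every ideal of \<open>A\<close> is
  finitely generated and closed, and every prime other than \<open>(x,y)A\<close> is principal.

  Inverting the primes \<open>x\<close> and \<open>y\<close> of \<open>U\<close> gives a localization of the polynomial ring
  \<open>k[x,y,\<sigma>,\<tau>]\<close>, so \<open>U\<close> and its localization \<open>B\<close> are factorial by Nagata's criterion. Every nonzero element of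
  \<open>k[x,\<sigma>]\<close> is a power of \<open>x\<close> times a unit of \<open>B\<close>, so \<open>x\<close> and \<open>\<sigma>\<close> stay algebraically independent modulo
  a prime of \<open>B\<close> that does not contain \<open>x\<close>. A chain of five primes of \<open>B\<close> would therefore produce five
  algebraically independent elements of \<open>k[x,y,\<sigma>,\<tau>]\<close>, which a count of monomials excludes.\<close>

section \<open>Subrings of a domain and their ideals\<close>

text \<open>What \<open>B\<close> keeps is division of slices: a nonzero series in x alone that lies
  in \<open>B\<close> is a power of x times a unit of \<open>B\<close>. Transcendence is given
  separately, for \<sigma> over k(x) and for \<tau> over k(y). Joint independence of x, \<sigma>, y,
  \<tau> comes from comparing the coefficients of each power of x, which turns a relation into
  relations for \<tau> over k[y]. The bound 3 has its origin in 4 = 2 + 2: modulo a prime without x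
  two independent elements survive, each strict step below that prime costs one more, and only four
  exist. So at most two steps lie below such a prime, and one more leads to the maximal ideal. The
  form k[[x]][[y]] treats the variables differently. Facts are proved for y and carried over to x by
  exchanging x with y and \<sigma> with \<tau>.\<close>

definition closed_ring :: "'a::comm_ring_1 set \<Rightarrow> bool" where
  "closed_ring R \<longleftrightarrow> 1 \<in> R \<and> (\<forall>a\<in>R. \<forall>b\<in>R. a - b \<in> R \<and> a * b \<in> R)"

lemma closed_ring_one: "closed_ring R \<Longrightarrow> 1 \<in> R"
  by (simp add: closed_ring_def)

lemma closed_ring_diff: "closed_ring R \<Longrightarrow> a \<in> R \<Longrightarrow> b \<in> R \<Longrightarrow> a - b \<in> R"
  by (simp add: closed_ring_def)

lemma closed_ring_mult: "closed_ring R \<Longrightarrow> a \<in> R \<Longrightarrow> b \<in> R \<Longrightarrow> a * b \<in> R"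
  by (simp add: closed_ring_def)

lemma closed_ring_zero: "closed_ring R \<Longrightarrow> 0 \<in> R"
  using closed_ring_diff[of R 1 1] closed_ring_one by auto

lemma closed_ring_uminus: "closed_ring R \<Longrightarrow> a \<in> R \<Longrightarrow> - a \<in> R"
  using closed_ring_diff[of R 0 a] closed_ring_zero by auto

lemma closed_ring_add: "closed_ring R \<Longrightarrow> a \<in> R \<Longrightarrow> b \<in> R \<Longrightarrow> a + b \<in> R"
  using closed_ring_diff[of R a "- b"] closed_ring_uminus by auto

lemma closed_ring_power: "closed_ring R \<Longrightarrow> a \<in> R \<Longrightarrow> a ^ n \<in> R"
  by (induction n) (auto simp: closed_ring_one closed_ring_mult)

lemma closed_ring_sum: "closed_ring R \<Longrightarrow> (\<And>i. i \<in> I \<Longrightarrow> f i \<in> R) \<Longrightarrow> sum f I \<in> R"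
  by (induction I rule: infinite_finite_induct) (auto simp: closed_ring_zero closed_ring_add)

lemmas closed_ring_intros =
  closed_ring_one closed_ring_diff closed_ring_mult closed_ring_zero closed_ring_uminus
  closed_ring_add closed_ring_power

text \<open>Ideals, and below primes and generated ideals, are plain subsets of a type-class ring,
  so that membership is ordinary arithmetic; the carrier records of the statement are reached
  through \<open>ring_emb\<close>.\<close>

definition ideal_in :: "'a::comm_ring_1 set \<Rightarrow> 'a set \<Rightarrow> bool" where
  "ideal_in I R \<longleftrightarrow> I \<subseteq> R \<and> 0 \<in> I \<and> (\<forall>a\<in>I. \<forall>b\<in>I. a + b \<in> I) \<and> (\<forall>r\<in>R. \<forall>a\<in>I. r * a \<in> I)"

lemma ideal_in_sub: "ideal_in I R \<Longrightarrow> a \<in> I \<Longrightarrow> a \<in> R"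
  by (auto simp: ideal_in_def)

lemma ideal_in_zero: "ideal_in I R \<Longrightarrow> 0 \<in> I"
  by (auto simp: ideal_in_def)

lemma ideal_in_add: "ideal_in I R \<Longrightarrow> a \<in> I \<Longrightarrow> b \<in> I \<Longrightarrow> a + b \<in> I"
  by (auto simp: ideal_in_def)

lemma ideal_in_mult: "ideal_in I R \<Longrightarrow> r \<in> R \<Longrightarrow> a \<in> I \<Longrightarrow> r * a \<in> I"
  by (auto simp: ideal_in_def)

lemma ideal_in_mult2: "ideal_in I R \<Longrightarrow> r \<in> R \<Longrightarrow> a \<in> I \<Longrightarrow> a * r \<in> I"
  by (auto simp: ideal_in_def mult.commute)

lemma ideal_in_uminus: "closed_ring R \<Longrightarrow> ideal_in I R \<Longrightarrow> a \<in> I \<Longrightarrow> - a \<in> I"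
  using ideal_in_mult[of I R "-1" a] closed_ring_uminus[OF _ closed_ring_one] by force

lemma ideal_in_diff: "closed_ring R \<Longrightarrow> ideal_in I R \<Longrightarrow> a \<in> I \<Longrightarrow> b \<in> I \<Longrightarrow> a - b \<in> I"
  using ideal_in_add[of I R a "- b"] ideal_in_uminus by auto

lemma ideal_in_whole: "closed_ring R \<Longrightarrow> ideal_in R R"
  by (auto simp: ideal_in_def closed_ring_intros)

lemma ideal_in_eq_whole: "ideal_in I R \<Longrightarrow> 1 \<in> I \<Longrightarrow> I = R"
  by (metis ideal_in_mult ideal_in_sub mult.right_neutral subsetI subset_antisym)

lemma ideal_in_unit:
  assumes "ideal_in I R" "u \<in> I" "v \<in> R" "u * v = 1"
  shows "I = R"
  using assms ideal_in_eq_whole ideal_in_mult2 by metis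

definition prime_in :: "'a::comm_ring_1 set \<Rightarrow> 'a set \<Rightarrow> bool" where
  "prime_in P R \<longleftrightarrow> ideal_in P R \<and> 1 \<notin> P \<and> (\<forall>a\<in>R. \<forall>b\<in>R. a * b \<in> P \<longrightarrow> a \<in> P \<or> b \<in> P)"

lemma prime_in_ideal: "prime_in P R \<Longrightarrow> ideal_in P R"
  by (simp add: prime_in_def)

lemma prime_in_one: "prime_in P R \<Longrightarrow> 1 \<notin> P"
  by (simp add: prime_in_def)

lemma prime_in_mult: "prime_in P R \<Longrightarrow> a \<in> R \<Longrightarrow> b \<in> R \<Longrightarrow> a * b \<in> P \<Longrightarrow> a \<in> P \<or> b \<in> P"
  by (simp add: prime_in_def)

lemma prime_in_power: "closed_ring R \<Longrightarrow> prime_in P R \<Longrightarrow> a \<in> R \<Longrightarrow> a ^ n \<in> P \<Longrightarrow> a \<in> P"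
proof (induction n)
  case (Suc n)
  then show ?case using prime_in_mult[of P R a "a ^ n"] closed_ring_power[of R a n] by auto
qed (simp add: prime_in_one)

definition gen_in :: "'a::comm_ring_1 set \<Rightarrow> 'a set \<Rightarrow> 'a set" where
  "gen_in R S = \<Inter>{I. ideal_in I R \<and> S \<subseteq> I}"

lemma gen_in_ideal: "closed_ring R \<Longrightarrow> S \<subseteq> R \<Longrightarrow> ideal_in (gen_in R S) R"
  using ideal_in_whole[of R] unfolding gen_in_def ideal_in_def by (auto; blast)

lemma gen_in_incl: "S \<subseteq> gen_in R S"
  by (auto simp: gen_in_def)

lemma gen_in_least: "ideal_in I R \<Longrightarrow> S \<subseteq> I \<Longrightarrow> gen_in R S \<subseteq> I"
  by (auto simp: gen_in_def)

lemma gen_in_eqI: "ideal_in I R \<Longrightarrow> S \<subseteq> I \<Longrightarrow> (\<And>J. ideal_in J R \<Longrightarrow> S \<subseteq> J \<Longrightarrow> I \<subseteq> J) \<Longrightarrow> gen_in R S = I"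
  by (auto simp: gen_in_def)

lemma gen_in_single:
  assumes "closed_ring R" "a \<in> R"
  shows "gen_in R {a} = {a * r | r. r \<in> R}"
proof (rule gen_in_eqI)
  show "ideal_in {a * r | r. r \<in> R} R"
    using assms unfolding ideal_in_def
    by (auto intro: closed_ring_intros)
      (metis mult_zero_right closed_ring_zero, metis distrib_left closed_ring_add,
        metis mult.left_commute closed_ring_mult)
  show "{a} \<subseteq> {a * r | r. r \<in> R}"
    using assms by (auto intro!: exI[of _ 1] closed_ring_intros)
  show "{a * r | r. r \<in> R} \<subseteq> J" if "ideal_in J R" "{a} \<subseteq> J" for J
    using that ideal_in_mult2 by blast
qed

lemma gen_in_insert:
  assumes R: "closed_ring R" "a \<in> R" "S \<subseteq> R"
  shows "gen_in R (insert a S) = {a * r + s | r s. r \<in> R \<and> s \<in> gen_in R S}"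
proof (rule gen_in_eqI)
  have I: "ideal_in (gen_in R S) R" using R by (intro gen_in_ideal)
  have e: "a * 0 + 0 = 0" "a * r + s + (a * r' + s') = a * (r + r') + (s + s')"
    "t * (a * r + s) = a * (t * r) + t * s" for r s r' s' t
    by (auto simp: algebra_simps)
  show "ideal_in {a * r + s | r s. r \<in> R \<and> s \<in> gen_in R S} R"
    unfolding ideal_in_def
  proof (intro conjI ballI)
    show "{a * r + s | r s. r \<in> R \<and> s \<in> gen_in R S} \<subseteq> R"
      using R I by (auto intro!: closed_ring_intros dest: ideal_in_sub)
    show "0 \<in> {a * r + s | r s. r \<in> R \<and> s \<in> gen_in R S}"
      using e(1) closed_ring_zero[OF R(1)] ideal_in_zero[OF I] by force
  next
    fix u v assume "u \<in> {a * r + s | r s. r \<in> R \<and> s \<in> gen_in R S}"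
      "v \<in> {a * r + s | r s. r \<in> R \<and> s \<in> gen_in R S}"
    then show "u + v \<in> {a * r + s | r s. r \<in> R \<and> s \<in> gen_in R S}"
      using e(2) closed_ring_add[OF R(1)] ideal_in_add[OF I] by blast
  next
    fix t v assume "t \<in> R" "v \<in> {a * r + s | r s. r \<in> R \<and> s \<in> gen_in R S}"
    then show "t * v \<in> {a * r + s | r s. r \<in> R \<and> s \<in> gen_in R S}"
      using e(3) closed_ring_mult[OF R(1)] ideal_in_mult[OF I] by blast
  qed
  have "a = a * 1 + 0" by simp
  then have "a \<in> {a * r + s | r s. r \<in> R \<and> s \<in> gen_in R S}"
    using closed_ring_one[OF R(1)] ideal_in_zero[OF I] by blast
  moreover have "S \<subseteq> {a * r + s | r s. r \<in> R \<and> s \<in> gen_in R S}"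
  proof
    fix s assume "s \<in> S"
    then have "s \<in> gen_in R S" "s = a * 0 + s" using gen_in_incl by auto
    then show "s \<in> {a * r + s | r s. r \<in> R \<and> s \<in> gen_in R S}"
      using closed_ring_zero[OF R(1)] by blast
  qed
  ultimately show "insert a S \<subseteq> {a * r + s | r s. r \<in> R \<and> s \<in> gen_in R S}" by blast
  show "{a * r + s | r s. r \<in> R \<and> s \<in> gen_in R S} \<subseteq> J" if J: "ideal_in J R" "insert a S \<subseteq> J" for J
  proof -
    have "gen_in R S \<subseteq> J" using J by (intro gen_in_least) auto
    then show ?thesis using J
      by (auto intro!: ideal_in_add[OF J(1)] ideal_in_mult2[OF J(1)])
  qed
qed

lemma gen_in_pair:
  assumes "closed_ring R" "a \<in> R" "b \<in> R"
  shows "gen_in R {a, b} = {a * r + b * s | r s. r \<in> R \<and> s \<in> R}"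
  using gen_in_insert[of R a "{b}"] assms by (auto simp: gen_in_single)

section \<open>Transport of rings and ideals along embeddings\<close>

locale dom_emb =
  fixes h :: "'t::idom \<Rightarrow> 'f::idom"
  assumes hom_one [simp]: "h 1 = 1"
    and hom_add [simp]: "h (a + b) = h a + h b"
    and hom_mult [simp]: "h (a * b) = h a * h b"
    and hom_inj [simp]: "h a = h b \<longleftrightarrow> a = b"
begin

lemma hom_zero [simp]: "h 0 = 0"
  using hom_add[of 0 0] by (metis add_0 add_cancel_left_left)

lemma hom_eq_0 [simp]: "h a = 0 \<longleftrightarrow> a = 0"
  using hom_inj[of a 0] by simp

lemma hom_uminus [simp]: "h (- a) = - h a"
  using hom_add[of "- a" a] by (metis add.left_inverse add_eq_0_iff2 hom_zero)

lemma hom_diff [simp]: "h (a - b) = h a - h b"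
  using hom_add[of a "- b"] by simp

lemma mem_image [simp]: "h a \<in> h ` S \<longleftrightarrow> a \<in> S"
  by auto

lemma inj_h: "inj h"
  by (auto simp: inj_def)

lemma image_eq [simp]: "h ` S = h ` S' \<longleftrightarrow> S = S'"
  using inj_h by (simp add: inj_image_eq_iff)

lemma image_subset [simp]: "h ` S \<subseteq> h ` S' \<longleftrightarrow> S \<subseteq> S'"
  using inj_h by (simp add: inj_image_subset_iff)

lemma image_psubset [simp]: "h ` S \<subset> h ` S' \<longleftrightarrow> S \<subset> S'"
  unfolding less_le_not_le by simp

end

text \<open>The codomain is a field because \<open>subring_of\<close> is typed over fields. The
  instances are \<open>to_fract\<close> and the identity; \<open>sw\<close> and \<open>ev4\<close>
  only need the weaker \<open>dom_emb\<close>.\<close>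

locale ring_emb = dom_emb h for h :: "'t::idom \<Rightarrow> 'f::field"
begin

abbreviation im :: "'t set \<Rightarrow> 'f ring" where
  "im R \<equiv> subring_of (h ` R)"

lemma im_simps [simp]:
  "carrier (im R) = h ` R" "monoid.mult (im R) = (*)" "monoid.one (im R) = 1" "ring.zero (im R) = 0" "ring.add (im R) = (+)"
  by (auto simp: ring_of_type_algebra_def fun_eq_iff)

lemma im_cring:
  assumes "closed_ring R"
  shows "cring (im R)"
proof -
  have "\<exists>y\<in>R. x + y = 0 \<and> y + x = 0" if "x \<in> R" for x
    using closed_ring_uminus[OF assms that] by (intro bexI[of _ "- x"]) auto
  moreover have "h x + h y = 0 \<longleftrightarrow> x + y = 0" for x y
    using hom_eq_0[of "x + y"] by simp
  ultimately have *: "\<exists>y\<in>R. h x + h y = 0 \<and> h y + h x = 0" if "x \<in> R" for x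
    using that by auto
  show ?thesis
  proof (intro cringI abelian_groupI comm_monoidI)
    fix x assume "x \<in> carrier (im R)"
    then show "\<exists>y\<in>carrier (im R). y \<oplus>\<^bsub>im R\<^esub> x = \<zero>\<^bsub>im R\<^esub>" using * by auto
  qed (use assms in \<open>auto simp: algebra_simps closed_ring_intros
         simp flip: hom_add hom_mult hom_one hom_zero\<close>)
qed

lemma im_ring: "closed_ring R \<Longrightarrow> ring (im R)"
  using im_cring cring.axioms(1) by blast

lemma im_domain: "closed_ring R \<Longrightarrow> domain (im R)"
  using im_cring by (intro domainI) auto

lemma im_a_inv:
  assumes "closed_ring R" "a \<in> R"
  shows "\<ominus>\<^bsub>im R\<^esub> h a = h (- a)"
proof -
  interpret cring "im R" using im_cring assms by simp
  show ?thesis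
    using assms by (intro minus_equality) (auto simp: closed_ring_intros simp flip: hom_add hom_uminus)
qed

lemma im_Units: "Units (im R) = h ` {u \<in> R. \<exists>v\<in>R. u * v = 1}"
  by (auto simp: Units_def mult.commute simp flip: hom_mult hom_one)

lemma im_ideal:
  assumes R: "closed_ring R"
  shows "ideal J (im R) \<longleftrightarrow> (\<exists>I. ideal_in I R \<and> J = h ` I)"
proof
  assume "ideal J (im R)"
  then interpret ideal J "im R" .
  define I where "I = {a. h a \<in> J}"
  have J: "J = h ` I" using a_subset by (auto simp: I_def)
  have zero: "0 \<in> J" and add: "x \<in> J \<Longrightarrow> y \<in> J \<Longrightarrow> x + y \<in> J" for x y
    using additive_subgroup.zero_closed[OF is_additive_subgroup]
      additive_subgroup.a_closed[OF is_additive_subgroup, of x y] by simp_all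
  have mult: "x \<in> J \<Longrightarrow> r \<in> R \<Longrightarrow> h r * x \<in> J" for x r
    using I_l_closed[of x "h r"] by simp
  have "ideal_in I R"
    unfolding ideal_in_def
  proof (intro conjI ballI)
    show "I \<subseteq> R" using a_subset J by simp
  qed (simp_all add: I_def zero add mult)
  with J show "\<exists>I. ideal_in I R \<and> J = h ` I" by blast
next
  assume "\<exists>I. ideal_in I R \<and> J = h ` I"
  then obtain I where I: "ideal_in I R" "J = h ` I" by blast
  interpret cring "im R" using R by (rule im_cring)
  have "subgroup J (add_monoid (im R))"
  proof (rule subgroup.intro)
    show "J \<subseteq> carrier (add_monoid (im R))" using I by (auto dest: ideal_in_sub)
    show "\<one>\<^bsub>add_monoid (im R)\<^esub> \<in> J" using ideal_in_zero[OF I(1)] I(2) by (auto simp flip: hom_zero)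
    fix x assume x: "x \<in> J"
    then obtain a where a: "a \<in> I" "x = h a" using I by auto
    then have "inv\<^bsub>add_monoid (im R)\<^esub> x = h (- a)"
      using im_a_inv[OF R, of a] ideal_in_sub[OF I(1)] unfolding a_inv_def by blast
    then show "inv\<^bsub>add_monoid (im R)\<^esub> x \<in> J" using ideal_in_uminus[OF R I(1) a(1)] I(2) by (metis imageI)
    fix y assume "y \<in> J"
    then obtain b where b: "b \<in> I" "y = h b" using I by auto
    have "h (a + b) \<in> J" unfolding I(2) using ideal_in_add[OF I(1) a(1) b(1)] by (rule imageI)
    then show "x \<otimes>\<^bsub>add_monoid (im R)\<^esub> y \<in> J" using a b by simp
  qed
  moreover have "h r * h a \<in> J" if "a \<in> I" "r \<in> R" for a r
    unfolding I(2) hom_mult[symmetric] using ideal_in_mult[OF I(1) that(2,1)] by (rule imageI)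
  ultimately show "ideal J (im R)"
    using im_ring[OF R] unfolding I(2) by (intro idealI) (auto simp: mult.commute)
qed

lemma im_ideal_image: "closed_ring R \<Longrightarrow> ideal (h ` I) (im R) \<longleftrightarrow> ideal_in I R"
  by (auto simp: im_ideal)

lemma im_primeideal:
  assumes R: "closed_ring R"
  shows "primeideal J (im R) \<longleftrightarrow> (\<exists>I. prime_in I R \<and> J = h ` I)"
proof
  assume "primeideal J (im R)"
  then interpret primeideal J "im R" .
  obtain I where I: "ideal_in I R" "J = h ` I" using im_ideal R is_ideal by blast
  have "1 \<notin> I" using ideal_in_eq_whole[OF I(1)] I_notcarr I(2) by auto
  moreover have "a \<in> I \<or> b \<in> I" if "a \<in> R" "b \<in> R" "a * b \<in> I" for a b
    using I_prime[of "h a" "h b"] that I(2) unfolding im_simps hom_mult[symmetric] by (simp del: hom_mult)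
  ultimately have "prime_in I R" using I by (simp add: prime_in_def)
  then show "\<exists>I. prime_in I R \<and> J = h ` I" using I by blast
next
  assume "\<exists>I. prime_in I R \<and> J = h ` I"
  then obtain I where I: "prime_in I R" "J = h ` I" by blast
  have "I \<noteq> R" using closed_ring_one[OF R] prime_in_one[OF I(1)] by auto
  show "primeideal J (im R)"
  proof (rule primeidealI)
    show "ideal J (im R)" using I im_ideal[OF R] prime_in_ideal by blast
    show "cring (im R)" using R by (rule im_cring)
    show "carrier (im R) \<noteq> J" using I \<open>I \<noteq> R\<close> by simp
    fix x y assume "x \<in> carrier (im R)" "y \<in> carrier (im R)" "x \<otimes>\<^bsub>im R\<^esub> y \<in> J"
    then obtain a b where "x = h a" "y = h b" "a \<in> R" "b \<in> R" "h (a * b) \<in> J" by auto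
    then show "x \<in> J \<or> y \<in> J" using prime_in_mult[OF I(1), of a b] I(2) by (simp del: hom_mult)
  qed
qed

lemma im_genideal:
  assumes R: "closed_ring R"
  shows "genideal (im R) (h ` S) = (\<Inter>{h ` I | I. ideal_in I R \<and> S \<subseteq> I})"
  using im_ideal[OF R] by (auto simp: genideal_def)

lemma im_genideal_gen_in:
  assumes R: "closed_ring R" "S \<subseteq> R"
  shows "genideal (im R) (h ` S) = h ` gen_in R S"
proof -
  have "{h ` I | I. ideal_in I R \<and> S \<subseteq> I} = (`) h ` {I. ideal_in I R \<and> S \<subseteq> I}" by auto
  moreover have "R \<in> {I. ideal_in I R \<and> S \<subseteq> I}" using R by (auto intro: ideal_in_whole)
  ultimately show ?thesis
    unfolding im_genideal[OF R(1)] gen_in_def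
    using image_INT[of h UNIV "{I. ideal_in I R \<and> S \<subseteq> I}" "\<lambda>I. I" R] inj_h by auto
qed

lemma im_principalideal:
  assumes R: "closed_ring R"
  shows "principalideal J (im R) \<longleftrightarrow> (\<exists>a\<in>R. J = h ` gen_in R {a})"
proof
  assume "principalideal J (im R)"
  then interpret principalideal J "im R" .
  show "\<exists>a\<in>R. J = h ` gen_in R {a}" using generate im_genideal_gen_in[OF R, of "{_}"] by auto
next
  assume "\<exists>a\<in>R. J = h ` gen_in R {a}"
  then obtain a where a: "a \<in> R" "J = h ` gen_in R {a}" by blast
  then show "principalideal J (im R)"
    using im_genideal_gen_in[OF R, of "{a}"] gen_in_ideal[OF R, of "{a}"]
    by (intro principalidealI) (auto simp: im_ideal_image[OF R] intro!: bexI[of _ a])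
qed

lemma im_noetherian:
  assumes R: "closed_ring R"
  shows "noetherian_ring (im R) \<longleftrightarrow>
    (\<forall>I. ideal_in I R \<longrightarrow> (\<exists>G\<subseteq>R. finite G \<and> I = gen_in R G))"
proof
  assume "noetherian_ring (im R)"
  then interpret noetherian_ring "im R" .
  show "\<forall>I. ideal_in I R \<longrightarrow> (\<exists>G\<subseteq>R. finite G \<and> I = gen_in R G)"
  proof (intro allI impI)
    fix I assume I: "ideal_in I R"
    then obtain G where G: "G \<subseteq> h ` R" "finite G" "h ` I = genideal (im R) G"
      using finetely_gen[of "h ` I"] im_ideal_image[OF R] by auto
    then obtain G' where "G' \<subseteq> R" "finite G'" "G = h ` G'"
      by (meson finite_subset_image)
    then show "\<exists>G\<subseteq>R. finite G \<and> I = gen_in R G" using G im_genideal_gen_in[OF R, of G'] by auto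
  qed
next
  assume *: "\<forall>I. ideal_in I R \<longrightarrow> (\<exists>G\<subseteq>R. finite G \<and> I = gen_in R G)"
  interpret ring "im R" using R by (rule im_ring)
  show "noetherian_ring (im R)"
  proof (rule noetherian_ringI)
    fix J assume "ideal J (im R)"
    then obtain I where I: "ideal_in I R" "J = h ` I" using im_ideal[OF R] by blast
    with * obtain G where "G \<subseteq> R" "finite G" "I = gen_in R G" by blast
    then show "\<exists>A\<subseteq>carrier (im R). finite A \<and> J = genideal (im R) A"
      using I im_genideal_gen_in[OF R, of G] by (intro exI[of _ "h ` G"]) auto
  qed
qed

text \<open>Every element outside \<open>M\<close> is a unit, so a proper ideal cannot leave
  \<open>M\<close>; thus \<open>M\<close> is the greatest proper ideal.\<close>

lemma im_maximalideal:
  assumes R: "closed_ring R" and M: "ideal_in M R" "1 \<notin> M"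
    and units: "\<And>a. a \<in> R \<Longrightarrow> a \<notin> M \<Longrightarrow> \<exists>b\<in>R. a * b = 1"
  shows "maximalideal J (im R) \<longleftrightarrow> J = h ` M"
proof
  have sub: "I \<subseteq> M" if "ideal_in I R" "I \<noteq> R" for I
    using that units ideal_in_unit[OF that(1)] ideal_in_sub[OF that(1)] by blast
  have ne: "M \<noteq> R" using M closed_ring_one[OF R] by auto
  show "J = h ` M" if "maximalideal J (im R)"
  proof -
    interpret maximalideal J "im R" by fact
    obtain I where I: "ideal_in I R" "J = h ` I" using is_ideal im_ideal[OF R] by blast
    then have "I \<subseteq> M" using sub I_notcarr by auto
    then show ?thesis
      using I_maximal[of "h ` M"] im_ideal_image[OF R] M ne I ideal_in_sub[OF M(1)] by auto
  qed
  show "maximalideal J (im R)" if "J = h ` M"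
  proof (rule maximalidealI)
    show "ideal J (im R)" using that M im_ideal_image[OF R] by simp
    show "carrier (im R) \<noteq> J" using that ne by auto
    fix J' assume J': "ideal J' (im R)" "J \<subseteq> J'" "J' \<subseteq> carrier (im R)"
    then obtain I where "ideal_in I R" "J' = h ` I" using im_ideal[OF R] by blast
    then show "J' = J \<or> J' = carrier (im R)" using sub[of I] J'(2) that by auto
  qed
qed

lemma im_local_ring:
  assumes R: "closed_ring R" and M: "ideal_in M R" "1 \<notin> M"
    and units: "\<And>a. a \<in> R \<Longrightarrow> a \<notin> M \<Longrightarrow> \<exists>b\<in>R. a * b = 1"
  shows "local_ring (im R)" "max_ideal (im R) = h ` M"
  using im_maximalideal[OF assms] im_cring[OF R]
  by (simp_all add: local_ring_def max_ideal_def)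

lemma im_krull_dim:
  assumes R: "closed_ring R"
  shows "krull_dim (im R) = Sup {enat n | n. \<exists>P. (\<forall>i\<le>n. prime_in (P i) R) \<and> (\<forall>i<n. P i \<subset> P (Suc i))}"
proof -
  have "(\<exists>P. (\<forall>i\<le>n. primeideal (P i) (im R)) \<and> (\<forall>i<n. P i \<subset> P (Suc i))) \<longleftrightarrow>
    (\<exists>P. (\<forall>i\<le>n. prime_in (P i) R) \<and> (\<forall>i<n. P i \<subset> P (Suc i)))" (is "?l \<longleftrightarrow> ?r") for n
  proof
    assume ?l
    then obtain P where P: "\<forall>i\<le>n. \<exists>I. prime_in I R \<and> P i = h ` I" "\<forall>i<n. P i \<subset> P (Suc i)"
      unfolding im_primeideal[OF R] by blast
    then obtain Q where Q: "\<And>i. i \<le> n \<Longrightarrow> prime_in (Q i) R" "\<And>i. i \<le> n \<Longrightarrow> P i = h ` Q i" by metis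
    have "Q i \<subset> Q (Suc i)" if "i < n" for i
      using P(2) that Q(2)[of i] Q(2)[of "Suc i"] by (metis Suc_leI image_psubset less_imp_le)
    then show ?r using Q(1) by blast
  next
    assume ?r
    then obtain P where P: "\<forall>i\<le>n. prime_in (P i) R" "\<forall>i<n. P i \<subset> P (Suc i)" by blast
    show ?l unfolding im_primeideal[OF R]
    proof (intro exI[of _ "\<lambda>i. h ` P i"] conjI allI impI)
      fix i assume "i < n"
      then show "h ` P i \<subset> h ` P (Suc i)"
        using P(2) by simp
    qed (use P(1) in blast)
  qed
  then show ?thesis unfolding krull_dim_def by simp
qed

lemma im_coset: "h ` I +>\<^bsub>im R\<^esub> h a = h ` {i + a | i. i \<in> I}"
  by (auto simp: a_r_coset_def r_coset_def image_iff simp flip: hom_add)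

end

text \<open>With the identity as embedding, the transfer lemmas apply to any subring of a field, in
  particular to the valuation rings below.\<close>

lemma ring_emb_id: "ring_emb (\<lambda>x. x)"
  by unfold_locales auto

interpretation emb_fract: ring_emb to_fract
  by unfold_locales (auto simp: to_fract_eq_iff)

section \<open>Unique factorization\<close>

definition unit_in :: "'a::comm_ring_1 set \<Rightarrow> 'a \<Rightarrow> bool" where
  "unit_in R u \<longleftrightarrow> u \<in> R \<and> (\<exists>v\<in>R. u * v = 1)"

definition dvd_in :: "'a::comm_ring_1 set \<Rightarrow> 'a \<Rightarrow> 'a \<Rightarrow> bool" where
  "dvd_in R a b \<longleftrightarrow> (\<exists>c\<in>R. b = a * c)"

definition prime_el :: "'a::comm_ring_1 set \<Rightarrow> 'a \<Rightarrow> bool" where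
  "prime_el R p \<longleftrightarrow> p \<in> R \<and> p \<noteq> 0 \<and> \<not> unit_in R p \<and>
     (\<forall>a\<in>R. \<forall>b\<in>R. dvd_in R p (a * b) \<longrightarrow> dvd_in R p a \<or> dvd_in R p b)"

inductive prime_prod :: "'a::comm_ring_1 set \<Rightarrow> 'a \<Rightarrow> bool" for R where
  unit: "unit_in R u \<Longrightarrow> prime_prod R u"
| step: "prime_el R p \<Longrightarrow> prime_prod R f \<Longrightarrow> prime_prod R (p * f)"

text \<open>Only the existence of a factorization is asked. Since the factors are prime elements and
  not merely irreducible, uniqueness follows, see \<open>ufd_in_factorial_domain\<close>.\<close>

definition ufd_in :: "'a::comm_ring_1 set \<Rightarrow> bool" where
  "ufd_in R \<longleftrightarrow> closed_ring R \<and> (\<forall>f\<in>R. f \<noteq> 0 \<longrightarrow> prime_prod R f)"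

lemma unit_in_mult:
  assumes "closed_ring R" "unit_in R u" "unit_in R v"
  shows "unit_in R (u * v)"
proof -
  obtain u' v' where "u' \<in> R" "u * u' = 1" "v' \<in> R" "v * v' = 1"
    using assms by (auto simp: unit_in_def)
  moreover have "u * v * (u' * v') = (u * u') * (v * v')" by (simp add: ac_simps)
  ultimately show ?thesis
    using assms closed_ring_mult[OF assms(1)] unfolding unit_in_def
    by (metis mult.right_neutral)
qed

lemma unit_in_one: "closed_ring R \<Longrightarrow> unit_in R 1"
  using closed_ring_one unfolding unit_in_def by fastforce

lemma unit_in_dvd_one:
  assumes "closed_ring R" "u \<in> R" "dvd_in R u 1"
  shows "unit_in R u"
  using assms by (metis dvd_in_def unit_in_def)

lemma unit_in_nonzero: "unit_in R u \<Longrightarrow> u \<noteq> (0::'a::idom)"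
  by (auto simp: unit_in_def)

lemma dvd_in_unit:
  assumes "closed_ring R" "unit_in R u" "a \<in> R"
  shows "dvd_in R u a"
proof -
  obtain v where "v \<in> R" "u * v = 1" using assms by (auto simp: unit_in_def)
  then have "v * a \<in> R" "a = u * (v * a)"
    using assms closed_ring_mult by (auto simp: mult.assoc[symmetric])
  then show ?thesis unfolding dvd_in_def by blast
qed

lemma dvd_in_refl: "closed_ring R \<Longrightarrow> dvd_in R a a"
  unfolding dvd_in_def using closed_ring_one by force

lemma dvd_in_trans:
  assumes "closed_ring R" "dvd_in R a b" "dvd_in R b c"
  shows "dvd_in R a c"
  using assms closed_ring_mult unfolding dvd_in_def by (metis mult.assoc)

lemma prime_elD:
  assumes "prime_el R p"
  shows "p \<in> R" "p \<noteq> 0" "\<not> unit_in R p"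
    "a \<in> R \<Longrightarrow> b \<in> R \<Longrightarrow> dvd_in R p (a * b) \<Longrightarrow> dvd_in R p a \<or> dvd_in R p b"
  using assms by (auto simp: prime_el_def)

lemma prime_prod_mem:
  assumes R: "closed_ring R" and "prime_prod R f"
  shows "f \<in> R \<and> f \<noteq> (0::'a::idom)"
  using assms(2)
proof induction
  case (unit u)
  then show ?case using unit_in_nonzero by (auto simp: unit_in_def)
next
  case (step p f)
  then show ?case using closed_ring_mult[OF R] by (auto simp: prime_el_def)
qed

lemma unit_in_mult_prime_el:
  fixes p :: "'a::idom"
  assumes R: "closed_ring R" and u: "unit_in R u" and p: "prime_el R p"
  shows "prime_el R (u * p)"
proof -
  obtain v where v: "v \<in> R" "u * v = 1" using u by (auto simp: unit_in_def)
  have uR: "u \<in> R" using u by (auto simp: unit_in_def)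
  have iff: "dvd_in R (u * p) a \<longleftrightarrow> dvd_in R p a" for a
  proof
    assume "dvd_in R (u * p) a"
    then obtain c where "c \<in> R" "a = u * p * c" by (auto simp: dvd_in_def)
    then show "dvd_in R p a" using closed_ring_mult[OF R uR, of c]
      by (auto simp: dvd_in_def ac_simps intro!: bexI[of _ "u * c"])
  next
    assume "dvd_in R p a"
    then obtain c where c: "c \<in> R" "a = p * c" by (auto simp: dvd_in_def)
    have "a = (u * v) * (p * c)" using v c by simp
    then have "a = u * p * (v * c)" by (simp add: ac_simps)
    then show "dvd_in R (u * p) a" using closed_ring_mult[OF R v(1) c(1)]
      by (auto simp: dvd_in_def)
  qed
  have "\<not> unit_in R (u * p)"
  proof
    assume "unit_in R (u * p)"
    then have "dvd_in R p 1" using iff[of 1] dvd_in_unit[OF R _ closed_ring_one[OF R]] by blast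
    then show False using p unit_in_dvd_one[OF R] prime_elD by blast
  qed
  then show ?thesis
    using prime_elD[OF p] iff u closed_ring_mult[OF R uR] unit_in_nonzero[OF u]
    unfolding prime_el_def by auto
qed

text \<open>\<open>prime_prod\<close> carries its unit at the end. The unit that ends the first
  product is absorbed into the leading prime of the second, which stays prime by
  \<open>unit_in_mult_prime_el\<close>.\<close>

lemma prime_prod_mult:
  fixes f g :: "'a::idom"
  assumes R: "closed_ring R" and f: "prime_prod R f" and g: "prime_prod R g"
  shows "prime_prod R (f * g)"
  using f
proof induction
  case (unit u)
  show ?case using g
  proof cases
    case unit
    then show ?thesis using unit_in_mult[OF R \<open>unit_in R u\<close>] prime_prod.unit by blast
  next
    case (step p f)
    then show ?thesis
      using unit_in_mult_prime_el[OF R \<open>unit_in R u\<close>, of p] prime_prod.step[of R "u * p" f]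
      by (simp add: mult.assoc)
  qed
next
  case (step p f)
  then show ?case using prime_prod.step[of R p "f * g"] by (simp add: mult.assoc)
qed

text \<open>Covers both Nagata's criterion (\<open>M\<close> a monoid generated by primes of \<open>E\<close>) and the passage to
  a localization (\<open>M\<close> a monoid of units of \<open>E\<close>).\<close>

lemma ufd_in_transfer:
  fixes D E M :: "'a::idom set"
  defines "red \<equiv> \<lambda>p. p \<in> E \<and> p \<noteq> 0 \<and> (\<forall>m\<in>M. \<forall>k\<in>E. dvd_in E p (m * k) \<longrightarrow> dvd_in E p k)"
  assumes E: "closed_ring E" and DE: "D \<subseteq> E" and D: "ufd_in D"
    and M: "M \<subseteq> D" "1 \<in> M" "0 \<notin> M" "\<And>m m'. m \<in> M \<Longrightarrow> m' \<in> M \<Longrightarrow> m * m' \<in> M"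
    and clear: "\<And>e. e \<in> E \<Longrightarrow> \<exists>m\<in>M. m * e \<in> D"
    and split: "\<And>e. e \<in> E \<Longrightarrow> e \<noteq> 0 \<Longrightarrow> \<exists>m\<in>M. \<exists>e'. e = m * e' \<and> red e'"
    and Mprod: "\<And>m. m \<in> M \<Longrightarrow> prime_prod E m"
  shows "ufd_in E"
proof -
  have Dc: "closed_ring D" and Dp: "\<And>d. d \<in> D \<Longrightarrow> d \<noteq> 0 \<Longrightarrow> prime_prod D d"
    using D by (auto simp: ufd_in_def)
  have M0: "m \<noteq> 0" if "m \<in> M" for m using that M(3) by auto
  have ME: "m \<in> E" if "m \<in> M" for m using that M(1) DE by auto
  \<comment> \<open>\<open>red p\<close> says that elements of \<open>M\<close> contribute nothing
    to divisibility by \<open>p\<close>: in Nagata's situation, that \<open>p\<close> has no factor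
    among the primes generating \<open>M\<close>.\<close>
  have redE: "p \<in> E" "p \<noteq> 0" if "red p" for p using that by (auto simp: red_def)
  have redD: "dvd_in E p k" if "red p" "m \<in> M" "k \<in> E" "dvd_in E p (m * k)" for p m k
    using that by (auto simp: red_def)
  have red_mult: "red (p * q)" if p: "red p" and q: "red q" for p q
    unfolding red_def
  proof (intro conjI ballI impI)
    show "p * q \<in> E" "p * q \<noteq> 0" using redE p q closed_ring_mult[OF E] by auto
    fix m k assume m: "m \<in> M" and k: "k \<in> E" and d: "dvd_in E (p * q) (m * k)"
    obtain c where c: "c \<in> E" "m * k = p * q * c" using d by (auto simp: dvd_in_def)
    then have "dvd_in E p (m * k)" using redE[OF q] closed_ring_mult[OF E]
      by (auto simp: dvd_in_def mult.assoc)
    then obtain k1 where k1: "k1 \<in> E" "k = p * k1" using redD[OF p m k] by (auto simp: dvd_in_def)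
    have "p * (m * k1) = p * (q * c)" using c k1 by (simp add: ac_simps)
    then have "m * k1 = q * c" using redE[OF p] by simp
    then have "dvd_in E q k1" using redD[OF q m k1(1)] c(1) by (auto simp: dvd_in_def)
    then show "dvd_in E (p * q) k" using k1 by (auto simp: dvd_in_def mult.assoc)
  qed
  \<comment> \<open>A prime \<open>p\<close> of \<open>D\<close>, freed from its part in
    \<open>M\<close>, is a unit or a prime of \<open>E\<close>: a divisibility over \<open>E\<close>
    is multiplied into \<open>D\<close>, decided there by \<open>p\<close>, and brought back by
    \<open>red\<close>.\<close>
  have prime_red: "unit_in E p' \<or> prime_el E p'"
    if p: "prime_el D p" and m: "m \<in> M" and pm: "p = m * p'" and r: "red p'" for p m p'
  proof (rule disj_imp[THEN iffD2], rule impI)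
    assume nu: "\<not> unit_in E p'"
    show "prime_el E p'"
      unfolding prime_el_def
    proof (intro conjI ballI impI)
      show "p' \<in> E" "p' \<noteq> 0" "\<not> unit_in E p'" using redE[OF r] nu by auto
      fix f g assume f: "f \<in> E" and g: "g \<in> E" and "dvd_in E p' (f * g)"
      then obtain k where k: "k \<in> E" "f * g = p' * k" by (auto simp: dvd_in_def)
      obtain mf mg mk where mm: "mf \<in> M" "mg \<in> M" "mk \<in> M"
        and DD: "mf * f \<in> D" "mg * g \<in> D" "mk * k \<in> D"
        using clear f g k by metis
      \<comment> \<open>The denominators of \<open>f\<close>, \<open>g\<close> and \<open>k\<close>
        are cleared by \<open>mf\<close>, \<open>mg\<close>, \<open>mk\<close>; the further factor
        \<open>m\<close> completes \<open>p'\<close> to \<open>p\<close>.\<close>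
      have "(m * mk) * ((mf * f) * (mg * g)) = m * mk * mf * mg * (f * g)"
        by (simp add: ac_simps)
      also have "\<dots> = p * (mf * mg * (mk * k))" unfolding k pm by (simp add: ac_simps)
      finally have eq: "(m * mk) * ((mf * f) * (mg * g)) = p * (mf * mg * (mk * k))" .
      have "mf * mg * (mk * k) \<in> D" using mm DD(3) M(1) by (intro closed_ring_mult[OF Dc] DD(3)) auto
      then have d: "dvd_in D p ((m * mk) * ((mf * f) * (mg * g)))"
        unfolding dvd_in_def using eq by blast
      have mm': "m * mk \<in> M" using M(4) m mm by auto
      have "dvd_in D p (m * mk) \<or> dvd_in D p (mf * f) \<or> dvd_in D p (mg * g)"
        using prime_elD(4)[OF p _ _ d] prime_elD(4)[OF p DD(1,2)] closed_ring_mult[OF Dc DD(1,2)] mm' M(1)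
        by blast
      moreover have *: "dvd_in E p' (m' * x)" if "dvd_in D p (m' * x)" for m' x
      proof -
        obtain q where q: "q \<in> D" "m' * x = p * q" using \<open>dvd_in D p (m' * x)\<close> by (auto simp: dvd_in_def)
        then have "m' * x = p' * (m * q)" unfolding pm by (simp add: ac_simps)
        moreover have "m * q \<in> E" using ME[OF m] q DE by (intro closed_ring_mult[OF E]) auto
        ultimately show ?thesis by (auto simp: dvd_in_def)
      qed
      moreover have "\<not> dvd_in D p (m * mk)"
      proof
        assume "dvd_in D p (m * mk)"
        then have "dvd_in E p' 1"
          using *[of "m * mk" 1] redD[OF r mm' closed_ring_one[OF E]] by simp
        then show False using nu unit_in_dvd_one[OF E] redE[OF r] by blast
      qed
      ultimately show "dvd_in E p' f \<or> dvd_in E p' g"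
        using redD[OF r] mm f g by blast
    qed
  qed
  have decomp: "\<exists>m\<in>M. \<exists>P. prime_prod E P \<and> red P \<and> d = m * P" if "prime_prod D d" for d
    using that
  proof induction
    case (unit u)
    then have "unit_in E u" using DE by (auto simp: unit_in_def)
    moreover from this have "red u"
      using dvd_in_unit[OF E] unit_in_nonzero by (auto simp: red_def unit_in_def)
    ultimately show ?case using M(2) prime_prod.unit by (intro bexI[of _ 1] exI[of _ u]) auto
  next
    case (step p f)
    then obtain m1 P where mP: "m1 \<in> M" "prime_prod E P" "red P" "f = m1 * P" by blast
    have "p \<in> E" "p \<noteq> 0" using prime_elD[OF step(1)] DE by auto
    then obtain m p' where m: "m \<in> M" "p = m * p'" "red p'" using split by blast
    then have "prime_prod E p'"
      using prime_red[OF step(1) m] prime_prod.unit prime_prod.step[of E p' 1]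
        prime_prod.unit[OF unit_in_one[OF E]] by auto
    then have "prime_prod E (p' * P)" using prime_prod_mult[OF E] mP by blast
    moreover have "p * f = (m * m1) * (p' * P)" using m mP by (simp add: ac_simps)
    ultimately show ?case using M(4)[OF m(1) mP(1)] red_mult[OF m(3) mP(3)] by blast
  qed
  have "prime_prod E e" if e: "e \<in> E" "e \<noteq> 0" for e
  proof -
    obtain m e' where m: "m \<in> M" "e = m * e'" "red e'" using split[OF e] by blast
    obtain m1 where m1: "m1 \<in> M" "m1 * e' \<in> D" using clear[OF redE(1)[OF m(3)]] by blast
    moreover have "m1 * e' \<noteq> 0" using M0[OF m1(1)] redE[OF m(3)] by simp
    ultimately obtain m2 P where P: "m2 \<in> M" "prime_prod E P" "red P" "m1 * e' = m2 * P"
      using decomp Dp by blast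
    \<comment> \<open>In \<open>m1 * e' = m2 * P\<close> both \<open>e'\<close> and \<open>P\<close>
      are free of \<open>M\<close>, so each divides the other and they differ by a unit of
      \<open>E\<close>.\<close>
    have "dvd_in E e' (m2 * P)" unfolding P(4)[symmetric]
      using ME[OF m1(1)] by (auto simp: dvd_in_def mult.commute)
    then obtain w where w: "w \<in> E" "P = e' * w"
      using redD[OF m(3) P(1)] redE[OF P(3)] by (auto simp: dvd_in_def)
    have "dvd_in E P (m1 * e')" unfolding P(4)
      using ME[OF P(1)] by (auto simp: dvd_in_def mult.commute)
    then obtain w' where w': "w' \<in> E" "e' = P * w'"
      using redD[OF P(3) m1(1)] redE[OF m(3)] by (auto simp: dvd_in_def)
    have "P * (w' * w) = P * 1" using w w' by (metis mult.assoc mult.right_neutral)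
    then have "w' * w = 1" using redE[OF P(3)] by (metis mult_cancel_left)
    then have "prime_prod E w'" using w w' by (intro prime_prod.unit) (auto simp: unit_in_def)
    then have "prime_prod E e'" using prime_prod_mult[OF E P(2)] w' by simp
    then show ?thesis using prime_prod_mult[OF E Mprod[OF m(1)]] m(2) by simp
  qed
  then show ?thesis using E by (simp add: ufd_in_def)
qed

context dom_emb
begin

lemma im_dvd_in: "dvd_in (h ` R) (h a) (h b) \<longleftrightarrow> dvd_in R a b"
  by (auto simp: dvd_in_def simp del: hom_mult simp: hom_mult[symmetric])

lemma im_unit_in: "unit_in (h ` R) (h a) \<longleftrightarrow> unit_in R a"
  by (auto simp: unit_in_def simp del: hom_mult hom_one simp: hom_mult[symmetric] hom_one[symmetric])

lemma im_prime_el: "prime_el R p \<Longrightarrow> prime_el (h ` R) (h p)"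
  by (auto simp: prime_el_def im_unit_in im_dvd_in simp del: hom_mult simp: hom_mult[symmetric])

lemma im_prime_prod: "prime_prod R f \<Longrightarrow> prime_prod (h ` R) (h f)"
proof (induction rule: prime_prod.induct)
  case (unit u)
  then show ?case by (intro prime_prod.unit) (simp add: im_unit_in)
next
  case (step p f)
  then show ?case using prime_prod.step[OF im_prime_el[OF step(1)]] by simp
qed

lemma im_closed_ring: "closed_ring R \<Longrightarrow> closed_ring (h ` R)"
  unfolding closed_ring_def
  by (auto simp del: hom_mult hom_one hom_diff simp: hom_mult[symmetric] hom_one[symmetric] hom_diff[symmetric])

lemma im_ufd_in: "ufd_in R \<Longrightarrow> ufd_in (h ` R)"
  unfolding ufd_in_def using im_closed_ring im_prime_prod by auto

end

section \<open>Factorial domains and Krull domains\<close>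

lemma subring_of_simps [simp]:
  "carrier (subring_of R) = R" "monoid.mult (subring_of R) = (*)" "monoid.one (subring_of R) = 1"
  "ring.zero (subring_of R) = 0" "ring.add (subring_of R) = (+)"
  by (auto simp: ring_of_type_algebra_def fun_eq_iff)

lemma subring_of_domain: "closed_ring R \<Longrightarrow> domain (subring_of R)"
  using ring_emb.im_domain[OF ring_emb_id, of R] by simp

lemma Units_subring_of: "Units (subring_of R) = {u. unit_in R u}"
  using ring_emb.im_Units[OF ring_emb_id, of R] by (auto simp: unit_in_def)

text \<open>An irreducible element that is a product of primes is associated to one of them, so
  irreducibles are prime; this is the condition under which factorizations are unique.\<close>

lemma ufd_in_factorial_domain:
  fixes R :: "'a::field set"
  assumes "ufd_in R"
  shows "factorial_domain (subring_of R)"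
proof -
  have R: "closed_ring R" and pp: "\<And>f. f \<in> R \<Longrightarrow> f \<noteq> 0 \<Longrightarrow> prime_prod R f"
    using assms by (auto simp: ufd_in_def)
  interpret domain "subring_of R" using R by (rule subring_of_domain)
  let ?G = "mult_of (subring_of R)"
  have div: "a divides\<^bsub>?G\<^esub> b \<longleftrightarrow> dvd_in R a b" if "a \<in> R" "b \<in> R" "b \<noteq> 0" for a b
    using that by (auto simp: Divisibility.factor_def dvd_in_def)
  have units: "a \<in> Units ?G \<longleftrightarrow> unit_in R a" for a
    by (simp add: Units_subring_of)
  have prime: "Divisibility.prime ?G p" if "prime_el R p" for p
    unfolding Divisibility.prime_def
    using prime_elD[OF that] closed_ring_mult[OF R] by (auto simp: Units_subring_of div)
  have irr: "Divisibility.irreducible ?G p" if "prime_el R p" for p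
    using prime[OF that] prime_elD[OF that] mult_of.prime_irreducible by auto
  interpret P: primeness_condition_monoid ?G
  proof
    fix a assume a: "a \<in> carrier ?G" "Divisibility.irreducible ?G a"
    then have "prime_prod R a" using pp by auto
    then show "Divisibility.prime ?G a"
    proof cases
      case unit
      then show ?thesis using a(2) by (auto simp: Divisibility.irreducible_def Units_subring_of)
    next
      case (step p f)
      have f: "f \<in> R" "f \<noteq> 0" using prime_prod_mem[OF R step(3)] by auto
      have p: "p \<in> carrier ?G" using prime_elD[OF step(2)] by auto
      have "p divides\<^bsub>?G\<^esub> a" using step f unfolding Divisibility.factor_def by auto
      moreover have "p \<notin> Units ?G" using prime_elD[OF step(2)] units by auto
      ultimately have "a divides\<^bsub>?G\<^esub> p"
        using a p by (auto simp: Divisibility.irreducible_def properfactor_def)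
      then have "p \<sim>\<^bsub>?G\<^esub> a" using \<open>p divides\<^bsub>?G\<^esub> a\<close> by (auto simp: associated_def)
      then show ?thesis using mult_of.prime_cong[OF prime[OF step(2)]] a p by blast
    qed
  qed
  have "\<exists>fs. set fs \<subseteq> carrier ?G \<and> wfactors ?G fs a" if "prime_prod R a" for a
    using that
  proof induction
    case (unit u)
    then show ?case
      using mult_of.unit_wfactors[of u] units by (intro exI[of _ "[]"]) auto
  next
    case (step p f)
    then obtain fs where fs: "set fs \<subseteq> carrier ?G" "wfactors ?G fs f" by blast
    have c: "p \<in> carrier ?G" "f \<in> carrier ?G"
      using prime_elD[OF step(1)] prime_prod_mem[OF R step(2)] by auto
    then have "wfactors ?G (p # fs) (p \<otimes>\<^bsub>?G\<^esub> f)"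
      using mult_of.wfactors_mult_single[OF irr[OF step(1)] fs(2) c fs(1)] by simp
    then show ?case using c fs by (intro exI[of _ "p # fs"]) auto
  qed
  then have "factorial_monoid ?G"
    using P.wfactors_unique pp by (intro mult_of.factorial_monoidI) auto
  then show ?thesis by (intro factorial_domain.intro domain_axioms)
qed


text \<open>The localization of \<open>R\<close> at the prime ideal generated by \<open>p\<close>.
  For a UFD these rings form the family of discrete valuation rings that a Krull domain requires;
  associated primes give the same ring.\<close>

definition valuation_ring :: "'a::field set \<Rightarrow> 'a \<Rightarrow> 'a set" where
  "valuation_ring R p = {a / b | a b. a \<in> R \<and> b \<in> R \<and> \<not> dvd_in R p b}"

lemma prime_el_dvd_prime_el:
  fixes p q :: "'a::idom"
  assumes R: "closed_ring R" and p: "prime_el R p" and q: "prime_el R q" and d: "dvd_in R p q"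
  obtains c where "unit_in R c" "q = p * c"
proof -
  obtain c where c: "c \<in> R" "q = p * c" using d by (auto simp: dvd_in_def)
  have "dvd_in R q (p * c)" using c dvd_in_refl[OF R] by simp
  then have "dvd_in R q p \<or> dvd_in R q c" using prime_elD[OF q] prime_elD[OF p] c by blast
  then show thesis
  proof
    assume "dvd_in R q p"
    then obtain e where e: "e \<in> R" "p = q * e" by (auto simp: dvd_in_def)
    have "q * (c * e) = q * 1" using c e by (metis mult.assoc mult.commute mult.right_neutral)
    then have "c * e = 1" using prime_elD[OF q] by (metis mult_cancel_left)
    then show thesis using c e that by (auto simp: unit_in_def)
  next
    assume "dvd_in R q c"
    then obtain e where e: "e \<in> R" "c = q * e" by (auto simp: dvd_in_def)
    have "q * (p * e) = q * 1" using c e by (metis mult.left_commute mult.right_neutral)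
    then have "p * e = 1" using prime_elD[OF q] by (metis mult_cancel_left)
    then show thesis using e prime_elD[OF p] by (auto simp: unit_in_def)
  qed
qed

text \<open>The exponent is obtained from the factorization and not by repeated division: a prime
  factor divisible by \<open>p\<close> is \<open>p\<close> times a unit and raises \<open>n\<close>
  by one, any other goes into \<open>f'\<close>.\<close>

lemma prime_prod_split:
  fixes p :: "'a::idom"
  assumes R: "closed_ring R" and p: "prime_el R p" and f: "prime_prod R f"
  obtains n f' where "f = p ^ n * f'" "f' \<in> R" "\<not> dvd_in R p f'"
proof -
  have nu: "\<not> dvd_in R p u" if "unit_in R u" for u
  proof
    assume "dvd_in R p u"
    moreover have "dvd_in R u 1" using dvd_in_unit[OF R that closed_ring_one[OF R]] .
    ultimately show False using dvd_in_trans[OF R] unit_in_dvd_one[OF R] prime_elD[OF p] by blast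
  qed
  have "\<exists>n f'. f = p ^ n * f' \<and> f' \<in> R \<and> \<not> dvd_in R p f'"
    using f
  proof induction
    case (unit u)
    then show ?case using nu by (intro exI[of _ 0] exI[of _ u]) (auto simp: unit_in_def)
  next
    case (step q f)
    then obtain n f' where f: "f = p ^ n * f'" "f' \<in> R" "\<not> dvd_in R p f'" by blast
    show ?case
    proof (cases "dvd_in R p q")
      case True
      then obtain c where c: "unit_in R c" "q = p * c"
        using prime_el_dvd_prime_el[OF R p step(1)] by blast
      then have "c \<in> R" by (simp add: unit_in_def)
      then have "\<not> dvd_in R p (c * f')" using prime_elD(4)[OF p] f nu c by blast
      moreover have "q * f = p ^ Suc n * (c * f')" using c f by simp
      ultimately show ?thesis using closed_ring_mult[OF R \<open>c \<in> R\<close> f(2)] by blast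
    next
      case False
      have "q \<in> R" using prime_elD[OF step(1)] by blast
      then have "\<not> dvd_in R p (q * f')" using prime_elD(4)[OF p] f False by blast
      moreover have "q * f = p ^ n * (q * f')" using f by simp
      ultimately show ?thesis using closed_ring_mult[OF R \<open>q \<in> R\<close> f(2)] by blast
    qed
  qed
  then show thesis using that by blast
qed

context
  fixes R :: "'a::field set" and p :: 'a
  assumes ufd: "ufd_in R" and p: "prime_el R p"
begin

private lemma R: "closed_ring R"
  using ufd by (simp add: ufd_in_def)

private lemma V_memI: "a \<in> R \<Longrightarrow> b \<in> R \<Longrightarrow> \<not> dvd_in R p b \<Longrightarrow> a / b \<in> valuation_ring R p"
  by (auto simp: valuation_ring_def)

private lemma not_dvd_nonzero: "\<not> dvd_in R p b \<Longrightarrow> b \<noteq> 0"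
  unfolding dvd_in_def using closed_ring_zero[OF R] by force

private lemma not_dvd_one: "\<not> dvd_in R p 1"
  using prime_elD[OF p] unit_in_dvd_one[OF R] by blast

private lemma not_dvd_mult: "a \<in> R \<Longrightarrow> b \<in> R \<Longrightarrow> \<not> dvd_in R p a \<Longrightarrow> \<not> dvd_in R p b \<Longrightarrow> \<not> dvd_in R p (a * b)"
  using prime_elD(4)[OF p] by blast

lemma valuation_ring_superset: "R \<subseteq> valuation_ring R p"
  using V_memI[OF _ closed_ring_one[OF R] not_dvd_one] by force

lemma valuation_ring_closed: "closed_ring (valuation_ring R p)"
  unfolding closed_ring_def
proof (intro conjI ballI)
  show "1 \<in> valuation_ring R p" using valuation_ring_superset closed_ring_one[OF R] by blast
next
  fix x y assume "x \<in> valuation_ring R p" "y \<in> valuation_ring R p"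
  then obtain a b c d where e: "x = a / b" "y = c / d" "a \<in> R" "b \<in> R" "c \<in> R" "d \<in> R"
    "\<not> dvd_in R p b" "\<not> dvd_in R p d" by (auto simp: valuation_ring_def)
  have nz: "b \<noteq> 0" "d \<noteq> 0" using e not_dvd_nonzero by auto
  have "x - y = (a * d - c * b) / (b * d)" "x * y = (a * c) / (b * d)"
    using nz e by (auto simp: field_simps)
  moreover have "(a * d - c * b) / (b * d) \<in> valuation_ring R p" "(a * c) / (b * d) \<in> valuation_ring R p"
    using e not_dvd_mult[of b d] by (auto intro!: V_memI closed_ring_intros R)
  ultimately show "x - y \<in> valuation_ring R p" "x * y \<in> valuation_ring R p" by simp_all
qed

lemma unit_in_valuation_ring:
  assumes "a \<in> R" "b \<in> R" "\<not> dvd_in R p a" "\<not> dvd_in R p b"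
  shows "unit_in (valuation_ring R p) (a / b)"
  unfolding unit_in_def
  using V_memI[of a b] V_memI[of b a] assms not_dvd_nonzero by (auto intro!: bexI[of _ "b / a"])

lemma valuation_ring_not_unit: "z \<in> valuation_ring R p \<Longrightarrow> p * z \<noteq> 1"
proof
  assume "z \<in> valuation_ring R p" and eq: "p * z = 1"
  then obtain a b where e: "z = a / b" "a \<in> R" "b \<in> R" "\<not> dvd_in R p b"
    by (auto simp: valuation_ring_def)
  then have "b = p * a" using eq not_dvd_nonzero by (auto simp: field_simps)
  then show False using e by (auto simp: dvd_in_def)
qed

lemma valuation_ring_split:
  assumes "z \<in> valuation_ring R p" "z \<noteq> 0"
  obtains n w where "z = p ^ n * w" "unit_in (valuation_ring R p) w"
proof -
  obtain a b where e: "z = a / b" "a \<in> R" "b \<in> R" "\<not> dvd_in R p b"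
    using assms by (auto simp: valuation_ring_def)
  have "prime_prod R a" using e assms ufd by (auto simp: ufd_in_def)
  then obtain n a' where "a = p ^ n * a'" "a' \<in> R" "\<not> dvd_in R p a'"
    using prime_prod_split[OF R p] by blast
  then show thesis using e unit_in_valuation_ring[of a' b] by (intro that[of n "a' / b"]) auto
qed

lemma p_in_valuation_ring: "p \<in> valuation_ring R p"
  using valuation_ring_superset prime_elD[OF p] by blast

text \<open>By \<open>valuation_ring_split\<close> every nonzero element is a power of
  \<open>p\<close> times a unit, so a nonzero ideal is generated by the least power of
  \<open>p\<close> in it, and the nonunits are the multiples of \<open>p\<close>.\<close>

lemma valuation_ring_dvr: "dvr (subring_of (valuation_ring R p))"
proof -
  let ?V = "valuation_ring R p"
  interpret domain "subring_of ?V" using valuation_ring_closed by (rule subring_of_domain)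
  have "\<exists>a\<in>?V. I = {x * a | x. x \<in> ?V}" if I: "ideal_in I ?V" for I
  proof (cases "I \<subseteq> {0}")
    case True
    then have "I = {0}" using ideal_in_zero[OF I] by blast
    then show ?thesis using closed_ring_zero[OF valuation_ring_closed] by (intro bexI[of _ 0]) auto
  next
    case False
    then obtain z where z: "z \<in> I" "z \<noteq> 0" by blast
    have ex: "\<exists>n. p ^ n \<in> I \<and> (\<exists>w\<in>?V. z = w * p ^ n)" if "z \<in> I" "z \<noteq> 0" for z
    proof -
      obtain n w where w: "z = p ^ n * w" "unit_in ?V w"
        using valuation_ring_split ideal_in_sub[OF I] \<open>z \<in> I\<close> \<open>z \<noteq> 0\<close> by blast
      then obtain w' where w': "w' \<in> ?V" "w * w' = 1" by (auto simp: unit_in_def)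
      then have "z * w' \<in> I" using ideal_in_mult2[OF I] that by blast
      moreover have "z * w' = p ^ n * (w * w')" using w by (simp add: mult.assoc)
      ultimately have "p ^ n \<in> I" using w' by simp
      then show ?thesis using w by (auto simp: unit_in_def mult.commute)
    qed
    define n where "n = (LEAST n. p ^ n \<in> I)"
    have n: "p ^ n \<in> I" unfolding n_def using ex[OF z] by (metis LeastI)
    have "I = {x * p ^ n | x. x \<in> ?V}"
    proof
      show "{x * p ^ n | x. x \<in> ?V} \<subseteq> I" using ideal_in_mult[OF I _ n] by blast
      show "I \<subseteq> {x * p ^ n | x. x \<in> ?V}"
      proof
        fix z assume z: "z \<in> I"
        show "z \<in> {x * p ^ n | x. x \<in> ?V}"
        proof (cases "z = 0")
          case True
          then have "z = 0 * p ^ n" by simp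
          then show ?thesis using closed_ring_zero[OF valuation_ring_closed] by blast
        next
          case False
          then obtain m w where m: "p ^ m \<in> I" "w \<in> ?V" "z = w * p ^ m" using ex[OF z] by blast
          then have "n \<le> m" unfolding n_def by (simp add: Least_le)
          then have "z = (w * p ^ (m - n)) * p ^ n"
            using m by (simp add: mult.assoc power_add[symmetric])
          moreover have "w * p ^ (m - n) \<in> ?V"
            using m p_in_valuation_ring valuation_ring_closed by (intro closed_ring_intros)
          ultimately show ?thesis by blast
        qed
      qed
    qed
    then show ?thesis using n ideal_in_sub[OF I] by blast
  qed
  then have "principal_domain (subring_of ?V)"
    using ring_emb.im_ideal[OF ring_emb_id valuation_ring_closed]
    by (intro principal_domain.intro domain_axioms principal_domain_axioms.intro)
      (auto simp: cgenideal_def)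
  moreover have "local_ring (subring_of ?V)"
  proof -
    let ?M = "{p * z | z. z \<in> ?V}"
    have "?M = gen_in ?V {p}" using gen_in_single[OF valuation_ring_closed p_in_valuation_ring] by simp
    then have "ideal_in ?M ?V" using gen_in_ideal[OF valuation_ring_closed] p_in_valuation_ring by simp
    moreover have "1 \<notin> ?M" using valuation_ring_not_unit by force
    moreover have "\<exists>b\<in>?V. a * b = 1" if a: "a \<in> ?V" "a \<notin> ?M" for a
    proof -
      have "a \<noteq> 0" using a closed_ring_zero[OF valuation_ring_closed] by force
      then obtain n w where w: "a = p ^ n * w" "unit_in ?V w" using valuation_ring_split a by blast
      have "n = 0"
      proof (rule ccontr)
        assume "n \<noteq> 0"
        then obtain m where "n = Suc m" using not0_implies_Suc by blast
        then have "a = p * (p ^ m * w)" using w by simp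
        moreover have "p ^ m * w \<in> ?V" using w p_in_valuation_ring valuation_ring_closed
          by (intro closed_ring_intros) (auto simp: unit_in_def)
        ultimately show False using a by blast
      qed
      then show ?thesis using w by (auto simp: unit_in_def)
    qed
    ultimately show ?thesis
      using ring_emb.im_local_ring(1)[OF ring_emb_id valuation_ring_closed, of ?M] by simp
  qed
  moreover have "\<not> field (subring_of ?V)"
  proof
    assume "field (subring_of ?V)"
    then have "p \<in> Units (subring_of ?V)"
      using field.field_Units p_in_valuation_ring prime_elD[OF p] by force
    then show False using valuation_ring_not_unit by (auto simp: Units_subring_of unit_in_def)
  qed
  ultimately show ?thesis by (simp add: dvr_def)
qed

lemma fraction_field_valuation_ring: "fraction_field (valuation_ring R p) = fraction_field R"
proof
  show "fraction_field R \<subseteq> fraction_field (valuation_ring R p)"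
    using valuation_ring_superset unfolding fraction_field_def by blast
  show "fraction_field (valuation_ring R p) \<subseteq> fraction_field R"
  proof
    fix z assume "z \<in> fraction_field (valuation_ring R p)"
    then obtain x y where z: "z = x / y" "x \<in> valuation_ring R p" "y \<in> valuation_ring R p" "y \<noteq> 0"
      by (auto simp: fraction_field_def)
    then obtain a b c d where e: "x = a / b" "y = c / d" "a \<in> R" "b \<in> R" "c \<in> R" "d \<in> R"
      "\<not> dvd_in R p b" "\<not> dvd_in R p d" by (auto simp: valuation_ring_def)
    have nz: "b \<noteq> 0" "d \<noteq> 0" "c \<noteq> 0" using e z not_dvd_nonzero by auto
    then have "z = (a * d) / (b * c)" "b * c \<noteq> 0" using z e by (auto simp: field_simps)
    moreover have "a * d \<in> R" "b * c \<in> R" using e closed_ring_mult[OF R] by auto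
    ultimately show "z \<in> fraction_field R" unfolding fraction_field_def by blast
  qed
qed

end

theorem ufd_in_krull_domain:
  fixes R :: "'a::field set"
  assumes ufd: "ufd_in R"
  shows "krull_domain R"
proof -
  have R: "closed_ring R" using ufd by (simp add: ufd_in_def)
  let ?W = "{valuation_ring R p | p. prime_el R p}"
  have dvr: "\<forall>V\<in>?W. dvr (subring_of V) \<and> fraction_field V = fraction_field R"
    using valuation_ring_dvr[OF ufd] fraction_field_valuation_ring[OF ufd] by blast
  \<comment> \<open>Induction on the factorization of the denominator: membership in the valuation
    ring of a prime factor \<open>p\<close> of the denominator forces \<open>p\<close> to divide the
    numerator, and \<open>p\<close> cancels.\<close>
  have inter: "a / b \<in> R" if "prime_prod R b" "a \<in> R" "\<forall>p. prime_el R p \<longrightarrow> a / b \<in> valuation_ring R p"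
    for a b
    using that
  proof (induction arbitrary: a)
    case (unit u)
    then obtain v where v: "v \<in> R" "u * v = 1" by (auto simp: unit_in_def)
    then have "a / u = a * v" by (metis divide_eq_eq mult.assoc mult.commute mult.right_neutral mult_zero_left zero_neq_one)
    then show ?case using v unit closed_ring_mult[OF R] by simp
  next
    case (step p f)
    have f: "f \<noteq> 0" "f \<in> R" using prime_prod_mem[OF R step(2)] by auto
    have p: "p \<noteq> 0" "p \<in> R" using prime_elD[OF step(1)] by auto
    obtain c d where cd: "a / (p * f) = c / d" "c \<in> R" "d \<in> R" "\<not> dvd_in R p d"
      using step(1,5) by (auto simp: valuation_ring_def)
    have "d \<noteq> 0" using cd(4) closed_ring_zero[OF R] by (force simp: dvd_in_def)
    then have "a * d = p * (f * c)" using cd(1) f p by (simp add: field_simps)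
    then have "dvd_in R p (a * d)" using closed_ring_mult[OF R f(2) cd(2)] by (auto simp: dvd_in_def)
    then have "dvd_in R p a" using prime_elD(4)[OF step(1)] cd step(4) by blast
    then obtain a' where a': "a' \<in> R" "a = p * a'" by (auto simp: dvd_in_def)
    then have "a / (p * f) = a' / f" using p by simp
    then show ?case using step(3)[OF a'(1)] step(5) by simp
  qed
  have "R = {z \<in> fraction_field R. \<forall>V\<in>?W. z \<in> V}"
  proof
    show "R \<subseteq> {z \<in> fraction_field R. \<forall>V\<in>?W. z \<in> V}"
      using valuation_ring_superset[OF ufd] closed_ring_one[OF R] by (force simp: fraction_field_def)
    show "{z \<in> fraction_field R. \<forall>V\<in>?W. z \<in> V} \<subseteq> R"
    proof
      fix z assume "z \<in> {z \<in> fraction_field R. \<forall>V\<in>?W. z \<in> V}"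
      then obtain a b where z: "z = a / b" "a \<in> R" "b \<in> R" "b \<noteq> 0"
        and *: "\<forall>p. prime_el R p \<longrightarrow> z \<in> valuation_ring R p" by (auto simp: fraction_field_def)
      have "prime_prod R b" using ufd z by (simp add: ufd_in_def)
      then show "z \<in> R" using inter z * by blast
    qed
  qed
  moreover have "finite {V \<in> ?W. a \<notin> Units (subring_of V)}" if "prime_prod R a" for a
    using that
  proof induction
    case (unit u)
    then have "unit_in (valuation_ring R p) u" if "prime_el R p" for p
      using valuation_ring_superset[OF ufd that] by (auto simp: unit_in_def)
    then have "{V \<in> ?W. u \<notin> Units (subring_of V)} = {}" by (auto simp: Units_subring_of)
    then show ?case by (simp only: finite.emptyI)
  next
    case (step p f)
    \<comment> \<open>A new prime factor \<open>p\<close> adds at most one ring: it is a nonunit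
      only at primes \<open>q\<close> dividing it, and these are associated to
      \<open>p\<close>.\<close>
    have "V = valuation_ring R p" if V: "V \<in> ?W" "p * f \<notin> Units (subring_of V)" "f \<in> Units (subring_of V)" for V
    proof -
      obtain q where q: "prime_el R q" "V = valuation_ring R q" using V by blast
      have Vc: "closed_ring V" using valuation_ring_closed[OF ufd q(1)] q by simp
      have "\<not> unit_in V p" using V unit_in_mult[OF Vc] by (auto simp: Units_subring_of)
      moreover have "unit_in V p" if "\<not> dvd_in R q p"
      proof -
        have "\<not> dvd_in R q 1" using prime_elD[OF q(1)] unit_in_dvd_one[OF R] by blast
        then show ?thesis
          using unit_in_valuation_ring[OF ufd q(1) _ closed_ring_one[OF R] that] prime_elD[OF step(1)] q
          by simp
      qed
      ultimately have "dvd_in R q p" by blast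
      then obtain c where c: "unit_in R c" "p = q * c"
        using prime_el_dvd_prime_el[OF R q(1) step(1)] by blast
      obtain c' where c': "c' \<in> R" "c * c' = 1" using c by (auto simp: unit_in_def)
      have "q = p * c'" unfolding c(2) mult.assoc c'(2) by simp
      then have "dvd_in R p q" using c' by (auto simp: dvd_in_def)
      then have "dvd_in R q b \<longleftrightarrow> dvd_in R p b" for b
        using \<open>dvd_in R q p\<close> dvd_in_trans[OF R] by blast
      then show ?thesis unfolding q(2) valuation_ring_def by simp
    qed
    then have "{V \<in> ?W. p * f \<notin> Units (subring_of V)} \<subseteq>
      insert (valuation_ring R p) {V \<in> ?W. f \<notin> Units (subring_of V)}" by blast
    then show ?case using step(3) by (meson finite_insert finite_subset)
  qed
  then have "\<forall>a\<in>R - {0}. finite {V \<in> ?W. a \<notin> Units (subring_of V)}"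
    using ufd unfolding ufd_in_def by blast
  ultimately show ?thesis
    unfolding krull_domain_def using subring_of_domain[OF R] dvr by blast
qed

section \<open>Order and division in k[[x]][[y]]\<close>

text \<open>The outer variable is \<open>y\<close>: \<open>cf f j i\<close> is the coefficient of \<open>x^i y^j\<close>, and \<open>fps_nth f 0\<close> is
  the value of \<open>f\<close> at \<open>y = 0\<close>.\<close>

abbreviation cf :: "'a::zero fps fps \<Rightarrow> nat \<Rightarrow> nat \<Rightarrow> 'a" where
  "cf f j i \<equiv> fps_nth (fps_nth f j) i"

abbreviation cc :: "'a::zero \<Rightarrow> 'a fps fps" where
  "cc c \<equiv> fps_const (fps_const c)"

abbreviation Xv :: "'a::{zero,one} fps fps" where
  "Xv \<equiv> fps_const fps_X"

abbreviation Yv :: "'a::{zero,one} fps fps" where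
  "Yv \<equiv> fps_X"

definition ord_ge :: "nat \<Rightarrow> 'a::field fps fps set" where
  "ord_ge n = {f. \<forall>i j. i + j < n \<longrightarrow> cf f j i = 0}"

lemma fps2_eqI: "(\<And>j i. cf f j i = cf g j i) \<Longrightarrow> f = g"
  by (intro fps_ext) simp

lemma ord_ge_0 [simp]: "ord_ge 0 = UNIV"
  by (auto simp: ord_ge_def)

lemma ord_ge_mono: "m \<le> n \<Longrightarrow> ord_ge n \<subseteq> ord_ge m"
  by (auto simp: ord_ge_def)

lemma ord_ge_zero [simp]: "0 \<in> ord_ge n"
  by (simp add: ord_ge_def)

lemma ord_ge_add: "f \<in> ord_ge n \<Longrightarrow> g \<in> ord_ge n \<Longrightarrow> f + g \<in> ord_ge n"
  by (simp add: ord_ge_def)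

lemma ord_ge_uminus: "f \<in> ord_ge n \<Longrightarrow> - f \<in> ord_ge n"
  by (simp add: ord_ge_def)

lemma ord_ge_diff: "f \<in> ord_ge n \<Longrightarrow> g \<in> ord_ge n \<Longrightarrow> f - g \<in> ord_ge n"
  by (simp add: ord_ge_def)

lemma ord_ge_mult: "f \<in> ord_ge n \<Longrightarrow> g \<in> ord_ge m \<Longrightarrow> f * g \<in> ord_ge (n + m)"
proof -
  assume f: "f \<in> ord_ge n" and g: "g \<in> ord_ge m"
  have "cf f l k * cf g (j - l) (i - k) = 0" if "l \<le> j" "k \<le> i" "i + j < n + m" for i j k l
  proof (cases "k + l < n")
    case True
    then show ?thesis using f by (simp add: ord_ge_def)
  next
    case False
    then have "(i - k) + (j - l) < m" using that by linarith
    then show ?thesis using g by (simp add: ord_ge_def)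
  qed
  then show ?thesis
    by (auto simp: ord_ge_def fps_mult_nth fps_sum_nth intro!: sum.neutral)
qed

lemma ord_ge_mult_left: "f \<in> ord_ge n \<Longrightarrow> g * f \<in> ord_ge n"
  using ord_ge_mult[of g 0 f n] by simp

lemma ord_ge_1: "f \<in> ord_ge (Suc 0) \<longleftrightarrow> cf f 0 0 = 0"
  by (auto simp: ord_ge_def)

lemma ord_ge_Inter: "(\<And>n. f \<in> ord_ge n) \<Longrightarrow> f = 0"
  by (rule fps2_eqI) (auto simp: ord_ge_def dest: spec)

lemma ord_ge_shift: "f \<in> ord_ge (Suc n) \<Longrightarrow> fps_shift 1 f \<in> ord_ge n"
  by (auto simp: ord_ge_def)

lemma ord_ge_slice: "f \<in> ord_ge n \<Longrightarrow> fps_const (fps_nth f 0) \<in> ord_ge n"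
  by (auto simp: ord_ge_def)

lemma ord_ge_const: "fps_const u \<in> ord_ge n \<longleftrightarrow> (\<forall>i<n. fps_nth u i = 0)"
  by (auto simp: ord_ge_def)

lemma ord_ge_const_shift: "fps_const u \<in> ord_ge (Suc n) \<Longrightarrow> fps_const (fps_shift 1 u) \<in> ord_ge n"
  by (simp add: ord_ge_const)

lemma fps_decomp_shift: "f = fps_const (fps_nth f 0) + fps_X * fps_shift 1 f"
  for f :: "'b::comm_ring_1 fps"
  by (rule fps_ext) auto

text \<open>The pieces are the constant term, a series in x alone divided by x, and the rest divided
  by y. A subring closed under just these operations therefore contains the pieces, which is what
  \<open>stable_ring\<close> axiomatizes.\<close>

lemma fps2_decomp:
  fixes f :: "'a::field fps fps"
  shows "f = cc (cf f 0 0) + Xv * fps_const (fps_shift 1 (fps_nth f 0)) + Yv * fps_shift 1 f"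
  by (subst fps_decomp_shift, subst fps_decomp_shift[of "fps_nth f 0"])
    (simp add: fps_const_mult fps_const_add del: fps_const_mult fps_const_add flip: fps_const_mult fps_const_add)

lemma fps2_X_divisible:
  fixes f :: "'b::comm_ring_1 fps"
  assumes "fps_nth f 0 = 0"
  shows "f = fps_X * fps_shift 1 f"
  using fps_decomp_shift[of f] assms by simp

text \<open>Unrolled \<open>n\<close> times, the recursion reads
  \<open>f 0 = g * s n + Yv ^ n * f n\<close>, and the last term tends to 0 in the y-adic
  topology.\<close>

lemma approx_limit:
  fixes f a :: "nat \<Rightarrow> 'a::field fps fps"
  assumes "\<And>n. f n = g * a n + Yv * f (Suc n)"
  obtains h where "f 0 = g * h" 
proof -
  define s where "s n = (\<Sum>i<n. a i * Yv ^ i)" for n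
  \<comment> \<open>From index \<open>Suc j\<close> on, the partial sums have a fixed coefficient of
    \<open>Yv ^ j\<close>, so it may be read off there.\<close>
  define h where "h = Abs_fps (\<lambda>j. fps_nth (s (Suc j)) j)"
  have f: "f 0 = g * s n + Yv ^ n * f n" for n
  proof (induction n)
    case (Suc n)
    show ?case unfolding Suc assms[of n] s_def by (simp add: algebra_simps)
  qed (simp add: s_def)
  have s: "fps_nth (s m) j = fps_nth (s (Suc j)) j" if "Suc j \<le> m" for m j
    using that
  proof (induction m rule: dec_induct)
    case (step m)
    then have "fps_nth (a m * Yv ^ m) j = 0" by (simp add: fps_X_power_mult_right_nth)
    then show ?case using step by (simp add: s_def)
  qed simp
  have "f 0 = g * h"
  proof (rule fps_ext)
    fix j
    have "fps_nth (f 0) j = fps_nth (g * s (Suc j)) j"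
      unfolding f[of "Suc j"] by (simp add: fps_X_power_mult_nth del: power_Suc)
    also have "\<dots> = fps_nth (g * h) j"
      unfolding fps_mult_nth h_def
      by (intro sum.cong refl) (simp add: s[where m = "Suc j" and j = "j - _"])
    finally show "fps_nth (f 0) j = fps_nth (g * h) j" .
  qed
  then show thesis by (rule that)
qed

lemma var_eq: "x_var = to_fract Xv" "y_var = to_fract Yv"
proof -
  show "x_var = to_fract Xv" by (simp add: in_x_def)
  have "Abs_fps (\<lambda>j. fps_const (fps_nth fps_X j)) = Yv" by (rule fps_ext) (simp add: fps_X_def)
  then show "y_var = to_fract Yv" by (simp add: in_y_def)
qed

section \<open>Subrings of k[[x,y]] that are closed under division by x and y\<close>

text \<open>\<open>shift_x\<close> speaks of series in x alone. Together with \<open>slice\<close>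
  this suffices, because an element is first reduced to its value at y = 0 before x is divided
  out.\<close>

locale stable_ring =
  fixes R :: "'a::field fps fps set"
  assumes ring: "closed_ring R"
    and const: "cc c \<in> R"
    and X_mem: "Xv \<in> R" and Y_mem: "Yv \<in> R"
    and slice: "f \<in> R \<Longrightarrow> fps_const (fps_nth f 0) \<in> R"
    and shift_y: "f \<in> R \<Longrightarrow> fps_shift 1 f \<in> R"
    and shift_x: "fps_const u \<in> R \<Longrightarrow> fps_const (fps_shift 1 u) \<in> R"
begin

abbreviation mx :: "'a fps fps set" where
  "mx \<equiv> {f \<in> R. cf f 0 0 = 0}"

lemma mx_decomp:
  assumes "f \<in> R" "f \<in> ord_ge (Suc n)"
  obtains u v where "f = Xv * u + Yv * v" "u \<in> R" "v \<in> R" "u \<in> ord_ge n" "v \<in> ord_ge n"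
proof -
  have "cf f 0 0 = 0" using assms by (simp add: ord_ge_def)
  then have "f = Xv * fps_const (fps_shift 1 (fps_nth f 0)) + Yv * fps_shift 1 f"
    using fps2_decomp[of f] by simp
  then show thesis
    using shift_x[OF slice[OF assms(1)]] shift_y[OF assms(1)]
      ord_ge_const_shift[OF ord_ge_slice[OF assms(2)]] ord_ge_shift[OF assms(2)]
    by (rule that)
qed

lemma mx_ideal: "ideal_in mx R"
  unfolding ideal_in_def using ring
  by (auto intro: closed_ring_intros)

lemma gen_XY: "gen_in R {Xv, Yv} = mx"
proof
  show "gen_in R {Xv, Yv} \<subseteq> mx"
    by (rule gen_in_least[OF mx_ideal]) (auto simp: X_mem Y_mem)
  show "mx \<subseteq> gen_in R {Xv, Yv}"
  proof
    fix f assume "f \<in> mx"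
    then have "f \<in> R" "f \<in> ord_ge (Suc 0)" by (auto simp: ord_ge_1)
    then obtain u v where "f = Xv * u + Yv * v" "u \<in> R" "v \<in> R" using mx_decomp by blast
    then show "f \<in> gen_in R {Xv, Yv}" using gen_in_pair[OF ring X_mem Y_mem] by blast
  qed
qed

lemma ord_ideal: "ideal_in (R \<inter> ord_ge n) R"
  unfolding ideal_in_def using ring
  by (auto intro: closed_ring_intros ord_ge_add ord_ge_mult_left)

abbreviation imR :: "'a fps fps fract ring" where
  "imR \<equiv> emb_fract.im R"

text \<open>Orders add up under products; conversely, \<open>mx_decomp\<close> writes an element of
  order at least \<open>Suc n\<close> as \<open>Xv * u + Yv * v\<close> with \<open>u\<close>,
  \<open>v\<close> in \<open>R\<close> of order at least \<open>n\<close>.\<close>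

lemma ideal_power_mx: "ideal_power imR (to_fract ` mx) n = to_fract ` (R \<inter> ord_ge n)"
proof (induction n)
  case 0
  show ?case by (simp add: ideals_set_def)
next
  case (Suc n)
  have "ideal_power imR (to_fract ` mx) (Suc n) = ideal_prod imR (to_fract ` (R \<inter> ord_ge n)) (to_fract ` mx)"
    using Suc by (simp add: ideals_set_def)
  also have "\<dots> = to_fract ` (R \<inter> ord_ge (Suc n))"
  proof
    show "ideal_prod imR (to_fract ` (R \<inter> ord_ge n)) (to_fract ` mx) \<subseteq> to_fract ` (R \<inter> ord_ge (Suc n))"
    proof
      fix z assume "z \<in> ideal_prod imR (to_fract ` (R \<inter> ord_ge n)) (to_fract ` mx)"
      then show "z \<in> to_fract ` (R \<inter> ord_ge (Suc n))"
      proof induction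
        case (prod i j)
        then obtain a b where "i = to_fract a" "j = to_fract b" "a \<in> R" "a \<in> ord_ge n" "b \<in> R" "b \<in> ord_ge (Suc 0)"
          by (auto simp: ord_ge_1)
        then have "i \<otimes>\<^bsub>imR\<^esub> j = to_fract (a * b)" "a * b \<in> R \<inter> ord_ge (Suc n)"
          using closed_ring_mult[OF ring] ord_ge_mult[of a n b "Suc 0"] by auto
        then show ?case by blast
      next
        case (sum s t)
        then obtain a b where "s = to_fract a" "t = to_fract b" "a \<in> R \<inter> ord_ge (Suc n)" "b \<in> R \<inter> ord_ge (Suc n)"
          by blast
        then have "s \<oplus>\<^bsub>imR\<^esub> t = to_fract (a + b)" "a + b \<in> R \<inter> ord_ge (Suc n)"
          using ideal_in_add[OF ord_ideal] by auto
        then show ?case by blast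
      qed
    qed
    show "to_fract ` (R \<inter> ord_ge (Suc n)) \<subseteq> ideal_prod imR (to_fract ` (R \<inter> ord_ge n)) (to_fract ` mx)"
    proof
      fix z assume "z \<in> to_fract ` (R \<inter> ord_ge (Suc n))"
      then obtain f where f: "z = to_fract f" "f \<in> R" "f \<in> ord_ge (Suc n)" by blast
      then obtain u v where uv: "f = Xv * u + Yv * v" "u \<in> R" "v \<in> R" "u \<in> ord_ge n" "v \<in> ord_ge n"
        using mx_decomp by blast
      have "to_fract u \<in> to_fract ` (R \<inter> ord_ge n)" "to_fract Xv \<in> to_fract ` mx"
        "to_fract v \<in> to_fract ` (R \<inter> ord_ge n)" "to_fract Yv \<in> to_fract ` mx"
        using uv X_mem Y_mem by auto
      from ideal_prod.sum[OF ideal_prod.prod[OF this(1,2)] ideal_prod.prod[OF this(3,4)], of imR]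
      show "z \<in> ideal_prod imR (to_fract ` (R \<inter> ord_ge n)) (to_fract ` mx)"
        using f uv by (simp add: mult.commute)
    qed
  qed
  finally show ?case .
qed

text \<open>\<open>f\<close> may be any power series, also outside \<open>R\<close>. By density
  (\<open>nbhd_approx\<close>) the set is always a coset of \<open>R \<inter> ord_ge n\<close>, and
  so an element of the quotient ring is named by a power series.\<close>

definition nbhd :: "nat \<Rightarrow> 'a fps fps \<Rightarrow> 'a fps fps set" where
  "nbhd n f = {r \<in> R. r - f \<in> ord_ge n}"

lemma nbhd_coset:
  assumes "a \<in> R"
  shows "to_fract ` (R \<inter> ord_ge n) +>\<^bsub>imR\<^esub> to_fract a = to_fract ` nbhd n a"
proof -
  have "{i + a | i. i \<in> R \<inter> ord_ge n} = nbhd n a"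
  proof
    show "{i + a | i. i \<in> R \<inter> ord_ge n} \<subseteq> nbhd n a"
      using assms ring by (auto simp: nbhd_def intro: closed_ring_intros)
    show "nbhd n a \<subseteq> {i + a | i. i \<in> R \<inter> ord_ge n}"
    proof
      fix r assume "r \<in> nbhd n a"
      then have "r = (r - a) + a" "r - a \<in> R \<inter> ord_ge n"
        using assms ring by (auto simp: nbhd_def intro: closed_ring_intros)
      then show "r \<in> {i + a | i. i \<in> R \<inter> ord_ge n}" by blast
    qed
  qed
  then show ?thesis by (simp add: emb_fract.im_coset)
qed

lemma nbhd_cong:
  assumes "f - g \<in> ord_ge n"
  shows "nbhd n f = nbhd n g"
proof -
  have "r - f \<in> ord_ge n \<longleftrightarrow> r - g \<in> ord_ge n" for r
    using ord_ge_add[OF _ assms, of "r - f"] ord_ge_diff[OF _ assms, of "r - g"] by auto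
  then show ?thesis by (simp add: nbhd_def)
qed

text \<open>Density of \<open>R\<close> in k[[x,y]], by repeated use of \<open>fps2_decomp\<close>:
  the approximations of the two cofactors are multiplied by x and y and so gain one order.\<close>

lemma nbhd_approx: "\<exists>r\<in>R. r - f \<in> ord_ge n"
proof (induction n arbitrary: f)
  case 0
  then show ?case using closed_ring_one[OF ring] by auto
next
  case (Suc n)
  define u where "u = fps_const (fps_shift 1 (fps_nth f 0))"
  define v where "v = fps_shift 1 f"
  obtain r s where rs: "r \<in> R" "r - u \<in> ord_ge n" "s \<in> R" "s - v \<in> ord_ge n"
    using Suc by metis
  let ?t = "cc (cf f 0 0) + Xv * r + Yv * s"
  have "?t - f = Xv * (r - u) + Yv * (s - v)"
    by (subst (2) fps2_decomp[of f]) (simp add: u_def v_def algebra_simps)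
  moreover have "Xv * (r - u) \<in> ord_ge (Suc n)" "Yv * (s - v) \<in> ord_ge (Suc n)"
    using ord_ge_mult[of Xv "Suc 0" "r - u" n] ord_ge_mult[of Yv "Suc 0" "s - v" n] rs
    by (auto simp: ord_ge_1)
  ultimately have "?t - f \<in> ord_ge (Suc n)" using ord_ge_add by metis
  moreover have "?t \<in> R" by (intro closed_ring_intros ring const X_mem Y_mem rs)
  ultimately show ?case by blast
qed

lemma nbhd_nonempty: obtains r where "r \<in> R" "nbhd n f = nbhd n r" "r - f \<in> ord_ge n"
proof -
  obtain r where "r \<in> R" "r - f \<in> ord_ge n" using nbhd_approx by blast
  then show thesis using that nbhd_cong[of r f n] by simp
qed

lemma nbhd_eq_iff: "nbhd n f = nbhd n g \<longleftrightarrow> f - g \<in> ord_ge n"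
proof
  assume eq: "nbhd n f = nbhd n g"
  obtain r where r: "r \<in> R" "r - f \<in> ord_ge n" using nbhd_approx by blast
  then have "r - g \<in> ord_ge n" using eq by (auto simp: nbhd_def)
  then have "(r - g) - (r - f) \<in> ord_ge n" using r ord_ge_diff by blast
  then show "f - g \<in> ord_ge n" by simp
qed (rule nbhd_cong)

lemma nbhd_limit:
  assumes s: "\<And>n. r n \<in> R" "\<And>n. r (Suc n) - r n \<in> ord_ge n"
  obtains f where "\<And>n. r n - f \<in> ord_ge n"
proof
  \<comment> \<open>The coefficient of x^i y^j no longer changes once the index exceeds
    \<open>i + j\<close>.\<close>
  define f where "f = Abs_fps (\<lambda>j. Abs_fps (\<lambda>i. cf (r (Suc (i + j))) j i))"
  have *: "r m - r n \<in> ord_ge n" if "n \<le> m" for m n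
    using that
  proof (induction m rule: dec_induct)
    case (step m)
    have "r (Suc m) - r m \<in> ord_ge n" using s(2) step ord_ge_mono by blast
    then have "(r (Suc m) - r m) + (r m - r n) \<in> ord_ge n" using step ord_ge_add by blast
    then show ?case by simp
  qed simp
  show "r n - f \<in> ord_ge n" for n
    unfolding ord_ge_def
  proof (intro CollectI allI impI)
    fix i j assume "i + j < n"
    then have "r n - r (Suc (i + j)) \<in> ord_ge (Suc (i + j))" by (intro *) simp
    then show "cf (r n - f) j i = 0" by (simp add: ord_ge_def f_def)
  qed
qed

text \<open>The isomorphism is built backwards: \<open>\<psi> f\<close> is the sequence of all
  cosets of \<open>f\<close>, injective because only 0 has arbitrarily high order and surjective
  because coherent sequences converge; \<open>\<phi>\<close> is its inverse.\<close>

lemma canonically_completes: "canonically_completes_to imR (to_fract ` mx) (subring_of power_series_xy)"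
proof -
  let ?S = "emb_fract.im (UNIV :: 'a fps fps set)"
  let ?C = "adic_completion imR (to_fract ` mx)"
  have S: "subring_of (power_series_xy :: 'a fps fps fract set) = ?S"
    by (simp add: power_series_xy_def)
  \<comment> \<open>k[[x,y]] is itself a stable ring, so \<open>ideal_power_mx\<close> also computes
    the powers of the extended ideal.\<close>
  interpret S: stable_ring "UNIV :: 'a fps fps set"
    by unfold_locales (auto simp: closed_ring_def)
  define P where "P n = to_fract ` (R \<inter> ord_ge n)" for n
  have P: "ideal_power imR (to_fract ` mx) n = P n" for n
    unfolding P_def by (rule ideal_power_mx)
  have idealP: "ideal (P n) imR" for n
    unfolding P_def using emb_fract.im_ideal_image[OF ring] ord_ideal by blast
  have coset: "to_fract ` nbhd n r = P n +>\<^bsub>imR\<^esub> to_fract r" if "r \<in> R" for n r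
    using nbhd_coset[OF that] by (simp add: P_def)
  have carrierQ: "A \<in> carrier (imR Quot P n) \<longleftrightarrow> (\<exists>r\<in>R. A = to_fract ` nbhd n r)" for A n
  proof -
    have "carrier (imR Quot P n) = {P n +>\<^bsub>imR\<^esub> a | a. a \<in> carrier imR}"
      by (auto simp: FactRing_def A_RCOSETS_def')
    also have "\<dots> = {P n +>\<^bsub>imR\<^esub> to_fract r | r. r \<in> R}" by auto
    also have "\<dots> = {to_fract ` nbhd n r | r. r \<in> R}" using coset[of _ n] by (intro Collect_cong) auto
    finally show ?thesis by blast
  qed
  define \<psi> where "\<psi> f = (\<lambda>n. to_fract ` nbhd n f)" for f
  have multQ: "\<psi> f n \<otimes>\<^bsub>imR Quot P n\<^esub> \<psi> g n = \<psi> (f * g) n" for f g n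
  proof -
    obtain r where r: "r \<in> R" "nbhd n f = nbhd n r" "r - f \<in> ord_ge n" using nbhd_nonempty by blast
    obtain t where t: "t \<in> R" "nbhd n g = nbhd n t" "t - g \<in> ord_ge n" using nbhd_nonempty by blast
    have "r * t - f * g = t * (r - f) + f * (t - g)" by (simp add: algebra_simps)
    then have "r * t - f * g \<in> ord_ge n" using r t ord_ge_add ord_ge_mult_left by metis
    then have fg: "nbhd n (f * g) = nbhd n (r * t)" by (metis nbhd_eq_iff)
    have "\<psi> f n \<otimes>\<^bsub>imR Quot P n\<^esub> \<psi> g n = P n +>\<^bsub>imR\<^esub> (to_fract r \<otimes>\<^bsub>imR\<^esub> to_fract t)"
      unfolding \<psi>_def r t coset[OF r(1)] coset[OF t(1)]
      using ideal.rcoset_mult_add[OF idealP, of "to_fract r" "to_fract t" n] r t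
      by (simp add: FactRing_def)
    also have "\<dots> = \<psi> (f * g) n"
      unfolding \<psi>_def fg coset[OF closed_ring_mult[OF ring r(1) t(1)]] by simp
    finally show ?thesis .
  qed
  have addQ: "\<psi> f n \<oplus>\<^bsub>imR Quot P n\<^esub> \<psi> g n = \<psi> (f + g) n" for f g n
  proof -
    obtain r where r: "r \<in> R" "nbhd n f = nbhd n r" "r - f \<in> ord_ge n" using nbhd_nonempty by blast
    obtain t where t: "t \<in> R" "nbhd n g = nbhd n t" "t - g \<in> ord_ge n" using nbhd_nonempty by blast
    have "(r + t) - (f + g) = (r - f) + (t - g)" by (simp add: algebra_simps)
    then have "(r + t) - (f + g) \<in> ord_ge n" using r t ord_ge_add by metis
    then have fg: "nbhd n (f + g) = nbhd n (r + t)" by (metis nbhd_eq_iff)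
    interpret ideal "P n" imR by (rule idealP)
    have "\<psi> f n \<oplus>\<^bsub>imR Quot P n\<^esub> \<psi> g n = P n +>\<^bsub>imR\<^esub> (to_fract r \<oplus>\<^bsub>imR\<^esub> to_fract t)"
      unfolding \<psi>_def r t coset[OF r(1)] coset[OF t(1)]
      using a_rcos_sum[of "to_fract r" "to_fract t"] r t
      by (simp add: FactRing_def)
    also have "\<dots> = \<psi> (f + g) n"
      unfolding \<psi>_def fg coset[OF closed_ring_add[OF ring r(1) t(1)]] by simp
    finally show ?thesis .
  qed
  have oneQ: "\<psi> 1 n = \<one>\<^bsub>imR Quot P n\<^esub>" for n
    unfolding \<psi>_def coset[OF closed_ring_one[OF ring]] by (simp add: FactRing_def)
  have \<psi>C: "\<psi> f \<in> carrier ?C" for f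
  proof -
    have "\<psi> f n \<in> carrier (imR Quot P n)" for n
      unfolding carrierQ \<psi>_def using nbhd_nonempty[of n f] by metis
    moreover have "\<psi> f (Suc n) \<subseteq> \<psi> f n" for n
      unfolding \<psi>_def nbhd_def using ord_ge_mono[of n "Suc n"] by auto
    ultimately show ?thesis by (simp add: adic_completion_def P)
  qed
  have \<psi>_inj: "f = g" if "\<psi> f = \<psi> g" for f g
  proof -
    have "nbhd n f = nbhd n g" for n using fun_cong[OF that, of n] by (simp add: \<psi>_def)
    then have "f - g = 0" by (intro ord_ge_Inter) (simp add: nbhd_eq_iff)
    then show ?thesis by simp
  qed
  have \<psi>_surj: "\<exists>f. s = \<psi> f" if "s \<in> carrier ?C" for s
  proof -
    have s: "s n \<in> carrier (imR Quot P n)" "s (Suc n) \<subseteq> s n" for n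
      using that by (auto simp: adic_completion_def P)
    then have "\<forall>n. \<exists>r. r \<in> R \<and> s n = to_fract ` nbhd n r" unfolding carrierQ by blast
    from choice[OF this] obtain r where "\<forall>n. r n \<in> R \<and> s n = to_fract ` nbhd n (r n)" by blast
    then have r: "\<And>n. r n \<in> R" "\<And>n. s n = to_fract ` nbhd n (r n)" by blast+
    have "r (Suc n) \<in> nbhd (Suc n) (r (Suc n))" for n using r by (simp add: nbhd_def)
    then have "r (Suc n) \<in> nbhd n (r n)" for n using s(2)[of n] unfolding r(2) by auto
    then have "r (Suc n) - r n \<in> ord_ge n" for n by (simp add: nbhd_def)
    then obtain f where "\<And>n. r n - f \<in> ord_ge n" using nbhd_limit r(1) by metis
    then have "s = \<psi> f" using r(2) by (auto simp: \<psi>_def nbhd_cong fun_eq_iff)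
    then show ?thesis by blast
  qed
  define \<phi> where "\<phi> s = to_fract (THE f. s = \<psi> f)" for s
  have \<phi>: "\<phi> (\<psi> f) = to_fract f" for f
    unfolding \<phi>_def using \<psi>_inj by (metis (mono_tags, lifting) the_equality)
  have opsC: "\<psi> f \<otimes>\<^bsub>?C\<^esub> \<psi> g = \<psi> (f * g)" "\<psi> f \<oplus>\<^bsub>?C\<^esub> \<psi> g = \<psi> (f + g)" "\<one>\<^bsub>?C\<^esub> = \<psi> 1" for f g
    unfolding adic_completion_def using multQ addQ oneQ by (simp_all add: P fun_eq_iff)
  have carC: "carrier ?C = range \<psi>"
  proof
    show "carrier ?C \<subseteq> range \<psi>"
    proof
      fix s assume "s \<in> carrier ?C"
      from \<psi>_surj[OF this] obtain f where "s = \<psi> f" by blast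
      then show "s \<in> range \<psi>" by (rule range_eqI)
    qed
    show "range \<psi> \<subseteq> carrier ?C" using \<psi>C by (rule image_subsetI)
  qed
  have "\<phi> \<in> ring_iso ?C ?S"
    unfolding ring_iso_def
  proof (intro CollectI conjI ring_hom_memI)
    show "bij_betw \<phi> (carrier ?C) (carrier ?S)"
      unfolding carC by (rule bij_betwI[of _ _ _ "\<lambda>z. \<psi> (the_inv to_fract z)"])
        (auto simp: \<phi> the_inv_f_f[OF emb_fract.inj_h])
    fix s t assume "s \<in> carrier ?C" "t \<in> carrier ?C"
    then obtain f g where fg: "s = \<psi> f" "t = \<psi> g" using carC by auto
    show "\<phi> (s \<otimes>\<^bsub>?C\<^esub> t) = \<phi> s \<otimes>\<^bsub>?S\<^esub> \<phi> t" unfolding fg opsC \<phi> by simp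
    show "\<phi> (s \<oplus>\<^bsub>?C\<^esub> t) = \<phi> s \<oplus>\<^bsub>?S\<^esub> \<phi> t" unfolding fg opsC \<phi> by simp
  next
    show "\<phi> \<one>\<^bsub>?C\<^esub> = \<one>\<^bsub>?S\<^esub>" unfolding opsC \<phi> by simp
  next
    fix s assume "s \<in> carrier ?C"
    then obtain f where "s = \<psi> f" using carC by auto
    then show "\<phi> s \<in> carrier ?S" by (simp add: \<phi>)
  qed
  moreover have "s n \<subseteq> ideal_power ?S (genideal ?S (to_fract ` mx)) n +>\<^bsub>?S\<^esub> \<phi> s"
    if "s \<in> carrier ?C" for s n
  proof -
    from \<psi>_surj[OF that] obtain f where f: "s = \<psi> f" by blast
    \<comment> \<open>The extension of the maximal ideal of \<open>R\<close> is that of k[[x,y]], as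
      both are generated by x and y.\<close>
    have "gen_in UNIV mx = S.mx"
    proof (rule gen_in_eqI[OF S.mx_ideal])
      fix J assume J: "ideal_in J (UNIV :: 'a fps fps set)" "mx \<subseteq> J"
      then have "{Xv, Yv} \<subseteq> J" using X_mem Y_mem by auto
      then show "S.mx \<subseteq> J" using gen_in_least[OF J(1)] S.gen_XY by metis
    qed auto
    then have g: "genideal ?S (to_fract ` mx) = to_fract ` S.mx"
      using emb_fract.im_genideal_gen_in[OF S.ring, of mx] by simp
    have "ideal_power ?S (genideal ?S (to_fract ` mx)) n +>\<^bsub>?S\<^esub> \<phi> s = to_fract ` S.nbhd n f"
      unfolding g S.ideal_power_mx f \<phi> by (rule S.nbhd_coset) simp
    then show ?thesis unfolding f \<psi>_def by (auto simp: nbhd_def S.nbhd_def)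
  qed
  ultimately show ?thesis
    unfolding canonically_completes_to_def S by blast
qed

section \<open>The adic topology of a stable ring\<close>

abbreviation adic_top :: "'a fps fps fract topology" where
  "adic_top \<equiv> adic_topology imR (to_fract ` mx)"

lemma top_eq: "adic_top = topology_generated_by {to_fract ` nbhd n a | n a. a \<in> R}"
proof -
  have "{ideal_power imR (to_fract ` mx) n +>\<^bsub>imR\<^esub> a | n a. a \<in> carrier imR} =
    {to_fract ` nbhd n a | n a. a \<in> R}" (is "?l = ?r")
  proof
    show "?l \<subseteq> ?r" unfolding ideal_power_mx using nbhd_coset by force
    show "?r \<subseteq> ?l" unfolding ideal_power_mx using nbhd_coset by force
  qed
  then show ?thesis by (simp add: adic_topology_def)
qed

lemma topspace_top: "topspace adic_top = to_fract ` R"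
proof -
  have "\<Union>{to_fract ` nbhd n a | n a. a \<in> R} = to_fract ` R"
  proof
    show "\<Union>{to_fract ` nbhd n a | n a. a \<in> R} \<subseteq> to_fract ` R" by (auto simp: nbhd_def)
    show "to_fract ` R \<subseteq> \<Union>{to_fract ` nbhd n a | n a. a \<in> R}"
    proof
      fix z assume "z \<in> to_fract ` R"
      then obtain a where "z = to_fract a" "a \<in> R" by blast
      then have "z \<in> to_fract ` nbhd 0 a" by (simp add: nbhd_def)
      then show "z \<in> \<Union>{to_fract ` nbhd n a | n a. a \<in> R}" using \<open>a \<in> R\<close> by blast
    qed
  qed
  then show ?thesis unfolding top_eq by simp
qed

lemma openin_nbhd: "a \<in> R \<Longrightarrow> openin adic_top (to_fract ` nbhd n a)"
  unfolding top_eq by (rule topology_generated_by_Basis) blast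

text \<open>Cosets through a common point are nested, so a finite intersection of basic sets around
  \<open>f\<close> still contains one of them.\<close>

lemma openin_top_nbhd:
  assumes "openin adic_top V" "to_fract f \<in> V" "f \<in> R"
  shows "\<exists>n. to_fract ` nbhd n f \<subseteq> V"
proof -
  have "generate_topology_on {to_fract ` nbhd n a | n a. a \<in> R} V"
    using assms(1) unfolding top_eq by (rule openin_topology_generated_by)
  then show ?thesis using assms(2)
  proof induction
    case (Int a b)
    then obtain m n where "to_fract ` nbhd n f \<subseteq> a" "to_fract ` nbhd m f \<subseteq> b" by auto
    moreover have "nbhd (max m n) f \<subseteq> nbhd n f" "nbhd (max m n) f \<subseteq> nbhd m f"
      using ord_ge_mono[of m "max m n"] ord_ge_mono[of n "max m n"] by (auto simp: nbhd_def)
    ultimately have "to_fract ` nbhd (max m n) f \<subseteq> a \<inter> b" by blast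
    then show ?case by blast
  next
    case (UN K)
    then obtain k where "k \<in> K" "to_fract f \<in> k" by blast
    then show ?case using UN(2) by blast
  next
    case (Basis s)
    then obtain n a where s: "s = to_fract ` nbhd n a" "a \<in> R" by blast
    then have "f - a \<in> ord_ge n" using Basis(2) by (auto simp: nbhd_def)
    then have "nbhd n f = nbhd n a" by (rule nbhd_cong)
    then show ?case using s by blast
  qed simp
qed

lemma Hausdorff_top: "Hausdorff_space adic_top"
  unfolding Hausdorff_space_def topspace_top
proof (intro allI impI)
  fix x y assume "x \<in> to_fract ` R \<and> y \<in> to_fract ` R \<and> x \<noteq> y"
  then obtain a b where ab: "x = to_fract a" "y = to_fract b" "a \<in> R" "b \<in> R" "a - b \<noteq> 0" by auto
  then obtain n where n: "a - b \<notin> ord_ge n" using ord_ge_Inter by blast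
  have False if "r - a \<in> ord_ge n" "r - b \<in> ord_ge n" for r
    using ord_ge_diff[OF that(2,1)] n by simp
  then have "nbhd n a \<inter> nbhd n b = {}" unfolding nbhd_def by blast
  then have "disjnt (to_fract ` nbhd n a) (to_fract ` nbhd n b)"
    by (simp add: disjnt_def image_Int[OF emb_fract.inj_h, symmetric])
  moreover have "x \<in> to_fract ` nbhd n a" "y \<in> to_fract ` nbhd n b"
    using ab by (auto simp: nbhd_def)
  ultimately show "\<exists>U V. openin adic_top U \<and> openin adic_top V \<and> x \<in> U \<and> y \<in> V \<and> disjnt U V"
    using openin_nbhd ab by blast
qed

lemma closedin_top_iff:
  assumes "I \<subseteq> R"
  shows "closedin adic_top (to_fract ` I) \<longleftrightarrow>
    (\<forall>f\<in>R. (\<forall>n. \<exists>i\<in>I. f - i \<in> ord_ge n) \<longrightarrow> f \<in> I)"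
proof
  assume cl: "closedin adic_top (to_fract ` I)"
  show "\<forall>f\<in>R. (\<forall>n. \<exists>i\<in>I. f - i \<in> ord_ge n) \<longrightarrow> f \<in> I"
  proof (intro ballI impI, rule ccontr)
    fix f assume f: "f \<in> R" "\<forall>n. \<exists>i\<in>I. f - i \<in> ord_ge n" "f \<notin> I"
    have "openin adic_top (to_fract ` R - to_fract ` I)"
      using cl unfolding closedin_def topspace_top by simp
    then obtain n where n: "to_fract ` nbhd n f \<subseteq> to_fract ` R - to_fract ` I"
      using openin_top_nbhd[of "to_fract ` R - to_fract ` I" f] f by auto
    obtain i where i: "i \<in> I" "f - i \<in> ord_ge n" using f by blast
    then have "i \<in> nbhd n f" using assms ord_ge_uminus[OF i(2)] by (auto simp: nbhd_def)
    then show False using n i by auto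
  qed
next
  assume *: "\<forall>f\<in>R. (\<forall>n. \<exists>i\<in>I. f - i \<in> ord_ge n) \<longrightarrow> f \<in> I"
  have "\<exists>V. openin adic_top V \<and> z \<in> V \<and> V \<subseteq> to_fract ` R - to_fract ` I"
    if z: "z \<in> to_fract ` R - to_fract ` I" for z
  proof -
    obtain f where f: "z = to_fract f" "f \<in> R" "f \<notin> I" using z by blast
    then obtain n where n: "\<And>i. i \<in> I \<Longrightarrow> f - i \<notin> ord_ge n" using * by blast
    have "to_fract ` nbhd n f \<subseteq> to_fract ` R - to_fract ` I"
    proof
      fix w assume "w \<in> to_fract ` nbhd n f"
      then obtain r where r: "w = to_fract r" "r \<in> R" "r - f \<in> ord_ge n" by (auto simp: nbhd_def)
      then have "r \<notin> I" using n[of r] ord_ge_uminus[OF r(3)] by auto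
      then show "w \<in> to_fract ` R - to_fract ` I" using r by auto
    qed
    moreover have "z \<in> to_fract ` nbhd n f" using f by (simp add: nbhd_def)
    ultimately show ?thesis using openin_nbhd[OF f(2)] by blast
  qed
  then have "openin adic_top (to_fract ` R - to_fract ` I)" by (subst openin_subopen) blast
  then show "closedin adic_top (to_fract ` I)"
    unfolding closedin_def topspace_top using assms by auto
qed

section \<open>Prime ideals of stable rings\<close>

lemma Y_prime: "prime_in {f \<in> R. fps_nth f 0 = 0} R"
  unfolding prime_in_def ideal_in_def using ring
  by (auto intro: closed_ring_intros)

lemma Y_gen: "f \<in> R \<Longrightarrow> fps_nth f 0 = 0 \<Longrightarrow> \<exists>g\<in>R. f = Yv * g"
  using fps2_X_divisible[of f] shift_y by auto

lemma mx_prime: "prime_in mx R"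
  unfolding prime_in_def using mx_ideal by auto

lemma zero_prime: "prime_in {0} R"
  unfolding prime_in_def ideal_in_def using closed_ring_zero[OF ring] by auto

text \<open>Gives the lower bound 2 for the dimension of \<open>A\<close> and of \<open>B\<close>
  alike, by the ideals 0, (y) and (x,y).\<close>

lemma chain_2: "\<exists>P. (\<forall>i\<le>2. prime_in (P i) R) \<and> (\<forall>i<2. P i \<subset> P (Suc i))"
proof -
  let ?Y = "{f \<in> R. fps_nth f 0 = 0}"
  let ?P = "\<lambda>i::nat. if i = 0 then {0} else if i = 1 then ?Y else mx"
  have "{0} \<subset> ?Y"
  proof
    show "{0} \<subseteq> ?Y" using closed_ring_zero[OF ring] by auto
    have "Yv \<in> ?Y" using Y_mem by simp
    then show "{0} \<noteq> ?Y" using fps_X_neq_zero by blast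
  qed
  moreover have "?Y \<subset> mx"
  proof
    show "?Y \<subseteq> mx" by auto
    have "Xv \<in> mx" "Xv \<notin> ?Y" using X_mem by auto
    then show "?Y \<noteq> mx" by blast
  qed
  ultimately have "?P i \<subset> ?P (Suc i)" if "i < 2" for i
    using that by (cases i) auto
  then show ?thesis using zero_prime Y_prime mx_prime by (intro exI[of _ ?P]) auto
qed

end

locale local_stable_ring = stable_ring +
  assumes inverse_ex: "f \<in> R \<Longrightarrow> cf f 0 0 \<noteq> 0 \<Longrightarrow> \<exists>g\<in>R. f * g = 1"
begin

lemma im_local: "local_ring imR" "max_ideal imR = to_fract ` mx"
  using emb_fract.im_local_ring[OF ring mx_ideal] inverse_ex by auto

lemma im_local_domain: "local_domain (to_fract ` R)"
  using im_local emb_fract.im_domain[OF ring] by (simp add: local_domain_def)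

lemma prime_sub_mx:
  assumes "prime_in P R"
  shows "P \<subseteq> mx"
proof
  fix f assume f: "f \<in> P"
  have P: "ideal_in P R" using assms by (rule prime_in_ideal)
  show "f \<in> mx"
  proof (rule ccontr)
    assume "f \<notin> mx"
    then obtain g where "g \<in> R" "f * g = 1" using inverse_ex ideal_in_sub[OF P f] by auto
    then show False using ideal_in_mult2[OF P _ f] prime_in_one[OF assms] by metis
  qed
qed

lemma const_div_X_power: "fps_const (fps_X ^ n * u) \<in> R \<Longrightarrow> fps_const u \<in> R"
proof (induction n)
  case (Suc n)
  have "fps_shift 1 (fps_X ^ Suc n * u) = fps_X ^ n * u" by (rule fps_ext) (simp add: mult.assoc)
  then show ?case using shift_x[OF Suc(2)] Suc(1) by metis
qed simp

text \<open>Modulo y the ring consists of series in x alone, where each nonzero element is a power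
  of x times a unit. A prime above (y) is therefore (y) itself or contains x as well.\<close>

lemma prime_contains_Y:
  assumes P: "prime_in P R" and Y: "Yv \<in> P" and ne: "P \<noteq> mx"
  shows "P = {f \<in> R. fps_nth f 0 = 0}"
proof
  have I: "ideal_in P R" using P by (rule prime_in_ideal)
  show "{f \<in> R. fps_nth f 0 = 0} \<subseteq> P"
    using Y_gen ideal_in_mult2[OF I _ Y] by blast
  have "fps_nth f 0 = 0" if f: "f \<in> P" for f
  proof (rule ccontr)
    assume nz: "fps_nth f 0 \<noteq> 0"
    have fR: "f \<in> R" using f ideal_in_sub[OF I] by blast
    have "Yv * fps_shift 1 f \<in> P" using ideal_in_mult2[OF I shift_y[OF fR] Y] .
    then have "f - Yv * fps_shift 1 f \<in> P" using ideal_in_diff[OF ring I f] by blast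
    moreover have "f - Yv * fps_shift 1 f = fps_const (fps_nth f 0)"
      using fps_decomp_shift[of f] by (simp add: algebra_simps)
    ultimately have c: "fps_const (fps_nth f 0) \<in> P" by simp
    define n where "n = subdegree (fps_nth f 0)"
    define u where "u = unit_factor (fps_nth f 0)"
    have dec: "fps_nth f 0 = fps_X ^ n * u"
      unfolding n_def u_def using fps_unit_factor_decompose[of "fps_nth f 0"] by (simp add: mult.commute)
    have uR: "fps_const u \<in> R" using const_div_X_power slice[OF fR] dec by metis
    have "cf (fps_const u) 0 0 \<noteq> 0" unfolding u_def using nz by simp
    then have uP: "fps_const u \<notin> P" using prime_sub_mx[OF P] by blast
    have X: "Xv ^ n \<in> R" using X_mem ring by (intro closed_ring_intros)
    have "Xv ^ n * fps_const u \<in> P" using c dec by simp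
    then have "Xv ^ n \<in> P" using prime_in_mult[OF P X uR] uP by blast
    then have "Xv \<in> P" using prime_in_power[OF ring P X_mem] by blast
    then have "mx \<subseteq> P" using Y gen_in_least[OF I, of "{Xv, Yv}"] gen_XY by simp
    then show False using ne prime_sub_mx[OF P] by blast
  qed
  then show "P \<subseteq> {f \<in> R. fps_nth f 0 = 0}" using ideal_in_sub[OF I] by blast
qed

text \<open>(y) has height one: a nonzero element of \<open>P\<close> divided by its highest power
  of y stays in \<open>P\<close>, because y is not in \<open>P\<close>, yet its value at y = 0 is
  nonzero.\<close>

lemma prime_below_Y:
  assumes P: "prime_in P R" and sub: "P \<subset> {f \<in> R. fps_nth f 0 = 0}"
  shows "P = {0}"
proof -
  have I: "ideal_in P R" using P by (rule prime_in_ideal)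
  have Y: "Yv \<notin> P"
  proof
    assume "Yv \<in> P"
    then have "{f \<in> R. fps_nth f 0 = 0} \<subseteq> P" using Y_gen ideal_in_mult2[OF I] by blast
    then show False using sub by blast
  qed
  have "f = 0" if f: "f \<in> P" for f
  proof (rule ccontr)
    assume "f \<noteq> 0"
    have fR: "f \<in> R" using f ideal_in_sub[OF I] by blast
    have g: "fps_shift n f \<in> R" for n
    proof (induction n)
      case (Suc n)
      have "fps_shift (Suc n) f = fps_shift 1 (fps_shift n f)" by (rule fps_ext) (simp add: ac_simps)
      then show ?case using shift_y[OF Suc] by metis
    qed (use fR in simp)
    define n where "n = subdegree f"
    have "f = fps_shift n f * Yv ^ n" unfolding n_def by (rule subdegree_decompose)
    moreover have "Yv ^ n \<in> R" using Y_mem ring by (intro closed_ring_intros)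
    ultimately have "fps_shift n f \<in> P \<or> Yv ^ n \<in> P" using prime_in_mult[OF P g] f by metis
    then have "fps_shift n f \<in> P" using prime_in_power[OF ring P Y_mem] Y by blast
    then have "fps_nth (fps_shift n f) 0 = 0" using sub by blast
    then show False using \<open>f \<noteq> 0\<close> by (simp add: n_def)
  qed
  then show ?thesis using ideal_in_zero[OF I] by blast
qed

end

section \<open>Subrings of k[[x,y]] that are intersections with a field\<close>

text \<open>\<open>R\<close> is the intersection of its fraction field with k[[x,y]].
  \<open>AA\<close> always has this property; \<open>BB\<close> has it only if it equals
  \<open>AA\<close>.\<close>

locale saturated_ring = stable_ring +
  assumes saturated: "f \<in> R \<Longrightarrow> f \<noteq> 0 \<Longrightarrow> f * h \<in> R \<Longrightarrow> h \<in> R"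

lemma fps2_inverse_ex:
  fixes f :: "'a::field fps fps"
  assumes "cf f 0 0 \<noteq> 0"
  obtains g where "f * g = 1"
proof -
  have "fps_nth f 0 * inverse (fps_nth f 0) = 1"
    using assms inverse_mult_eq_1'[of "fps_nth f 0"] by simp
  then have "f * fps_right_inverse f (inverse (fps_nth f 0)) = 1" by (rule fps_right_inverse)
  then show thesis by (rule that)
qed

sublocale saturated_ring \<subseteq> local_stable_ring
proof
  fix f assume f: "f \<in> R" "cf f 0 0 \<noteq> 0"
  then obtain g where g: "f * g = 1" using fps2_inverse_ex by blast
  have "f \<noteq> 0" using g by auto
  moreover have "f * g \<in> R" using g closed_ring_one[OF ring] by simp
  ultimately show "\<exists>g\<in>R. f * g = 1" using saturated[OF f(1)] g by blast
qed

definition divides_slices :: "'a::field fps fps \<Rightarrow> 'a fps fps set \<Rightarrow> bool" where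
  "divides_slices g J \<longleftrightarrow> g \<in> J \<and> (\<forall>b\<in>J. fps_nth g 0 dvd fps_nth b 0)"

text \<open>k[[x]] is a discrete valuation ring, so a slice of least order divides all others. If
  every slice vanishes, 0 takes the role of \<open>g\<close>.\<close>

lemma divides_slices_ex:
  assumes "ideal_in J R"
  obtains g where "divides_slices g J"
proof (cases "\<forall>b\<in>J. fps_nth b 0 = 0")
  case True
  then show thesis using that[of 0] ideal_in_zero[OF assms] by (auto simp: divides_slices_def)
next
  case False
  then obtain b where b: "b \<in> J" "fps_nth b 0 \<noteq> 0" by blast
  define A where "A = {b \<in> J. fps_nth b 0 \<noteq> 0}"
  obtain g where g: "g \<in> A" "\<And>b. b \<in> A \<Longrightarrow> subdegree (fps_nth g 0) \<le> subdegree (fps_nth b 0)"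
    using ex_has_least_nat[of "\<lambda>b. b \<in> A" b "\<lambda>b. subdegree (fps_nth b 0)"] b unfolding A_def by blast
  have "fps_nth g 0 dvd fps_nth b 0" if "b \<in> J" for b
    using g that by (cases "fps_nth b 0 = 0") (auto simp: A_def fps_dvd_iff)
  then show thesis using that[of g] g(1) by (auto simp: divides_slices_def A_def)
qed

context saturated_ring
begin

text \<open>Saturation keeps the quotient of two slices in \<open>R\<close>. The last clause fixes
  the quotient when the divisor is 0; \<open>closure_division\<close> compares two quotients and
  relies on this choice.\<close>

lemma slice_quotient:
  assumes "g \<in> R" "b \<in> R" "fps_nth g 0 dvd fps_nth b 0"
  obtains c where "fps_const c \<in> R" "fps_nth b 0 = fps_nth g 0 * c" "fps_nth g 0 = 0 \<Longrightarrow> c = 0"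
proof (cases "fps_nth g 0 = 0")
  case True
  then show thesis using that[of 0] assms closed_ring_zero[OF ring] by simp
next
  case False
  obtain c where c: "fps_nth b 0 = fps_nth g 0 * c" using assms(3) by blast
  have "fps_const (fps_nth g 0) * fps_const c \<in> R" using slice[OF assms(2)] c by simp
  then have "fps_const c \<in> R" using saturated[OF slice[OF assms(1)]] False by simp
  then show thesis using that c False by blast
qed

lemma slice_division:
  assumes "g \<in> R" "b \<in> R" "fps_nth b 0 = fps_nth g 0 * c" "fps_const c \<in> R"
  obtains b' where "b' \<in> R" "b = g * fps_const c + Yv * b'"
proof -
  have "b - g * fps_const c \<in> R" using assms ring by (intro closed_ring_intros)
  moreover have "fps_nth (b - g * fps_const c) 0 = 0" using assms by simp
  ultimately obtain b' where "b' \<in> R" "b - g * fps_const c = Yv * b'" using Y_gen by blast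
  then show thesis using that[of b'] by (simp add: algebra_simps)
qed

lemma divides_slices_division:
  assumes J: "ideal_in J R" and g: "divides_slices g J" and b: "b \<in> J"
  obtains a b' where "a \<in> R" "b' \<in> R" "b = g * a + Yv * b'" "Yv * b' \<in> J"
proof -
  have gJ: "g \<in> J" and gd: "fps_nth g 0 dvd fps_nth b 0" using g b by (auto simp: divides_slices_def)
  have gb: "g \<in> R" "b \<in> R" using gJ b ideal_in_sub[OF J] by auto
  obtain c where c: "fps_const c \<in> R" "fps_nth b 0 = fps_nth g 0 * c"
    using slice_quotient[OF gb gd] by blast
  obtain b' where b': "b' \<in> R" "b = g * fps_const c + Yv * b'"
    using slice_division[OF gb c(2,1)] by blast
  have "Yv * b' = b - g * fps_const c" using b' by (simp add: algebra_simps)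
  then have "Yv * b' \<in> J" using ideal_in_diff[OF ring J b] ideal_in_mult2[OF J c(1) gJ] by simp
  then show thesis using that c b' by blast
qed

text \<open>The quotients by \<open>g\<close> form a series in \<open>y\<close> that converges in \<open>k[[x,y]]\<close>; saturation puts its
  sum into \<open>R\<close>.\<close>

lemma division_chain:
  assumes g: "g \<in> R" and K: "K \<subseteq> R"
    and step: "\<And>b. b \<in> K \<Longrightarrow> \<exists>a b'. b' \<in> K \<and> b = g * a + Yv * b'"
    and b: "b \<in> K"
  shows "\<exists>h\<in>R. b = g * h"
proof -
  obtain A B where AB: "\<And>b. b \<in> K \<Longrightarrow> B b \<in> K" "\<And>b. b \<in> K \<Longrightarrow> b = g * A b + Yv * B b"
    using step by metis
  define f where "f n = (B ^^ n) b" for n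
  have "f n \<in> K" for n by (induction n) (auto simp: f_def b AB(1))
  then have "f n = g * A (f n) + Yv * f (Suc n)" for n
    using AB(2)[of "f n"] by (simp add: f_def)
  then obtain h where "f 0 = g * h" using approx_limit[of f g "\<lambda>n. A (f n)"] by blast
  then have h: "b = g * h" by (simp add: f_def)
  show ?thesis
  proof (cases "g = 0")
    case True
    then show ?thesis using h closed_ring_zero[OF ring] by auto
  next
    case False
    then have "h \<in> R" using saturated[OF g, of h] h K b by blast
    then show ?thesis using h by blast
  qed
qed

abbreviation closure_of_ideal :: "'a fps fps set \<Rightarrow> 'a fps fps set" where
  "closure_of_ideal I \<equiv> {f \<in> R. \<forall>n. \<exists>i\<in>I. f - i \<in> ord_ge n}"

lemma slice_ord: "r \<in> ord_ge n \<Longrightarrow> i < n \<Longrightarrow> cf r 0 i = 0"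
  by (simp add: ord_ge_def)

text \<open>Division by \<open>g\<close> is compatible with limits: close elements have close
  quotients and close remainders. The loss of order is bounded by \<open>d\<close>, the order of the
  slice of \<open>g\<close>, plus one for the division by y.\<close>

lemma closure_division:
  assumes I: "ideal_in I R" and g: "divides_slices g I"
    and I': "\<And>b. b \<in> R \<Longrightarrow> Yv * b \<in> I \<Longrightarrow> b \<in> I'"
    and f: "f \<in> closure_of_ideal I"
  shows "\<exists>a\<in>R. \<exists>f'\<in>closure_of_ideal I'. f = g * a + Yv * f'"
proof -
  have fR: "f \<in> R" and fcl: "\<And>n. \<exists>i\<in>I. f - i \<in> ord_ge n" using f by auto
  have gI: "g \<in> I" and gd: "\<And>b. b \<in> I \<Longrightarrow> fps_nth g 0 dvd fps_nth b 0"
    using g by (auto simp: divides_slices_def)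
  have gR: "g \<in> R" using gI ideal_in_sub[OF I] by blast
  define d where "d = subdegree (fps_nth g 0)"
  have dvd: "fps_nth g 0 dvd fps_nth f 0"
  proof (cases "fps_nth g 0 = 0")
    case True
    have "fps_nth (fps_nth f 0) n = 0" for n
    proof -
      obtain i where i: "i \<in> I" "f - i \<in> ord_ge (Suc n)" using fcl by blast
      then have "fps_nth i 0 = 0" using gd True by fastforce
      then show ?thesis using slice_ord[OF i(2), of n] by simp
    qed
    then have "fps_nth f 0 = 0" by (intro fps_ext) simp
    then show ?thesis by simp
  next
    case False
    \<comment> \<open>Precision \<open>d\<close> is enough: every series in x of order at least
      \<open>d\<close> is divisible by the slice of \<open>g\<close>.\<close>
    obtain i where i: "i \<in> I" "f - i \<in> ord_ge d" using fcl by blast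
    have "fps_nth g 0 dvd fps_nth (f - i) 0"
    proof (cases "fps_nth (f - i) 0 = 0")
      case nz: False
      then have "d \<le> subdegree (fps_nth (f - i) 0)"
        using slice_ord[OF i(2)] by (intro subdegree_geI) auto
      then show ?thesis using False nz by (subst fps_dvd_iff) (auto simp: d_def)
    qed simp
    then have "fps_nth g 0 dvd fps_nth (f - i) 0 + fps_nth i 0" using gd[OF i(1)] by (rule dvd_add)
    then show ?thesis by simp
  qed
  obtain c where c: "fps_const c \<in> R" "fps_nth f 0 = fps_nth g 0 * c" "fps_nth g 0 = 0 \<Longrightarrow> c = 0"
    using slice_quotient[OF gR fR dvd] by blast
  obtain f' where f': "f' \<in> R" "f = g * fps_const c + Yv * f'"
    using slice_division[OF gR fR c(2,1)] by blast
  have "\<exists>i'\<in>I'. f' - i' \<in> ord_ge n" for n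
  proof -
    \<comment> \<open>The slice quotient loses \<open>d\<close> orders and the division by y one, so
      precision \<open>Suc n + d\<close> leaves precision \<open>n\<close> for the
      remainder.\<close>
    obtain i where i: "i \<in> I" "f - i \<in> ord_ge (Suc n + d)" using fcl by blast
    have iR: "i \<in> R" using i ideal_in_sub[OF I] by blast
    obtain e where e: "fps_const e \<in> R" "fps_nth i 0 = fps_nth g 0 * e" "fps_nth g 0 = 0 \<Longrightarrow> e = 0"
      using slice_quotient[OF gR iR gd[OF i(1)]] by blast
    obtain i' where i': "i' \<in> R" "i = g * fps_const e + Yv * i'"
      using slice_division[OF gR iR e(2,1)] by blast
    have "Yv * i' = i - g * fps_const e" using i' by (simp add: algebra_simps)
    then have "Yv * i' \<in> I" using ideal_in_diff[OF ring I i(1)] ideal_in_mult2[OF I e(1) gI] by simp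
    then have "i' \<in> I'" using I' i' by blast
    have ce: "fps_nth (c - e) l = 0" if l: "l < Suc n" for l
    proof (cases "c - e = 0 \<or> fps_nth g 0 = 0")
      case True
      then show ?thesis using c e by auto
    next
      case False
      have eq: "fps_nth (f - i) 0 = fps_nth g 0 * (c - e)" using c e by (simp add: algebra_simps)
      have "Suc n + d \<le> subdegree (fps_nth g 0 * (c - e))"
      proof (rule subdegree_geI)
        show "fps_nth g 0 * (c - e) \<noteq> 0" using False by auto
        show "fps_nth (fps_nth g 0 * (c - e)) l = 0" if "l < Suc n + d" for l
          unfolding eq[symmetric] using i(2) that by (rule slice_ord)
      qed
      then have "Suc n \<le> subdegree (c - e)" using False by (simp add: d_def)
      then have "l < subdegree (c - e)" using l by linarith
      then show ?thesis by (rule nth_less_subdegree_zero)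
    qed
    then have "fps_const (c - e) \<in> ord_ge (Suc n)" by (simp add: ord_ge_const)
    then have 1: "g * fps_const (c - e) \<in> ord_ge (Suc n)" by (rule ord_ge_mult_left)
    have 2: "f - i \<in> ord_ge (Suc n)" using i(2) ord_ge_mono[of "Suc n" "Suc n + d"] by auto
    have "Yv * (f' - i') = (f - i) - g * fps_const (c - e)"
      unfolding f'(2) i'(2) by (simp add: algebra_simps flip: fps_const_sub)
    then have "Yv * (f' - i') \<in> ord_ge (Suc n)" using ord_ge_diff[OF 2 1] by simp
    then have "fps_shift 1 (Yv * (f' - i')) \<in> ord_ge n" by (rule ord_ge_shift)
    moreover have "fps_shift 1 (Yv * (f' - i')) = f' - i'"
      by (rule fps_ext) simp
    ultimately show ?thesis using \<open>i' \<in> I'\<close> by auto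
  qed
  then have "f' \<in> closure_of_ideal I'" using f' by simp
  then show ?thesis using c f' by blast
qed

definition colon_y :: "'a fps fps set \<Rightarrow> nat \<Rightarrow> 'a fps fps set" where
  "colon_y I j = {b \<in> R. Yv ^ j * b \<in> I}"

lemma colon_y_0: "ideal_in I R \<Longrightarrow> colon_y I 0 = I"
  using ideal_in_sub by (auto simp: colon_y_def)

lemma colon_y_ideal:
  assumes "ideal_in I R"
  shows "ideal_in (colon_y I j) R"
  unfolding ideal_in_def colon_y_def using assms ring
  by (auto simp: distrib_left mult.left_commute intro: closed_ring_intros ideal_in_zero ideal_in_add ideal_in_mult)

lemma colon_y_step: "b \<in> R \<Longrightarrow> Yv * b \<in> colon_y I j \<Longrightarrow> b \<in> colon_y I (Suc j)"
  by (simp add: colon_y_def ac_simps)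

lemma colon_y_mult:
  assumes "b \<in> colon_y I (Suc j)"
  shows "Yv * b \<in> colon_y I j"
  using assms Y_mem closed_ring_mult[OF ring] by (auto simp: colon_y_def ac_simps)

lemma colon_y_mono:
  assumes I: "ideal_in I R" and "i \<le> j"
  shows "colon_y I i \<subseteq> colon_y I j"
proof
  fix b assume b: "b \<in> colon_y I i"
  have eq: "Yv ^ j * b = Yv ^ (j - i) * (Yv ^ i * b)"
    using assms(2) by (simp add: mult.assoc[symmetric] power_add[symmetric])
  have "Yv ^ (j - i) \<in> R" using Y_mem ring by (intro closed_ring_intros)
  moreover have "Yv ^ i * b \<in> I" using b by (simp add: colon_y_def)
  ultimately have "Yv ^ j * b \<in> I" unfolding eq by (rule ideal_in_mult[OF I])
  then show "b \<in> colon_y I j" using b by (simp add: colon_y_def)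
qed

text \<open>The union \<open>J\<close> of all \<open>colon_y I j\<close> is closed under division by
  y, so remainders of the division by \<open>g\<close> stay in \<open>J\<close> and
  \<open>division_chain\<close> makes \<open>J\<close> principal. The stage \<open>N\<close> is one
  that contains the generator.\<close>

lemma colon_y_stable:
  assumes I: "ideal_in I R"
  shows "\<exists>N g. divides_slices g (colon_y I N) \<and>
    (\<forall>b\<in>R. Yv * b \<in> colon_y I N \<longrightarrow> b \<in> colon_y I N) \<and> colon_y I N = {g * r | r. r \<in> R}"
proof -
  define J where "J = (\<Union>j. colon_y I j)"
  have J: "ideal_in J R"
    unfolding ideal_in_def
  proof (intro conjI ballI)
    show "J \<subseteq> R" by (auto simp: J_def colon_y_def)
    show "0 \<in> J" using ideal_in_zero[OF colon_y_ideal[OF I]] by (auto simp: J_def)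
    show "a + b \<in> J" if ab: "a \<in> J" "b \<in> J" for a b
    proof -
      obtain i j where ij: "a \<in> colon_y I i" "b \<in> colon_y I j" using ab by (auto simp: J_def)
      then have "a \<in> colon_y I (max i j)" "b \<in> colon_y I (max i j)"
        using colon_y_mono[OF I, of i "max i j"] colon_y_mono[OF I, of j "max i j"] by auto
      then show ?thesis using ideal_in_add[OF colon_y_ideal[OF I]] by (auto simp: J_def)
    qed
    show "r * a \<in> J" if "r \<in> R" "a \<in> J" for r a
      using that ideal_in_mult[OF colon_y_ideal[OF I]] by (auto simp: J_def)
  qed
  have Jstep: "b \<in> J" if "b \<in> R" "Yv * b \<in> J" for b
    using that colon_y_step unfolding J_def by blast
  obtain g where g: "divides_slices g J" using divides_slices_ex[OF J] by blast
  then obtain N where N: "g \<in> colon_y I N" by (auto simp: divides_slices_def J_def)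
  have gR: "g \<in> R" using N by (simp add: colon_y_def)
  have JgR: "\<exists>h\<in>R. b = g * h" if "b \<in> J" for b
  proof (rule division_chain[OF gR _ _ that])
    show "J \<subseteq> R" using ideal_in_sub[OF J] by blast
    show "\<exists>a b'. b' \<in> J \<and> b = g * a + Yv * b'" if "b \<in> J" for b
      using divides_slices_division[OF J g that] Jstep by metis
  qed
  have "{g * r | r. r \<in> R} \<subseteq> colon_y I N" using ideal_in_mult2[OF colon_y_ideal[OF I] _ N] by blast
  moreover have "J \<subseteq> {g * r | r. r \<in> R}" using JgR by blast
  moreover have "colon_y I N \<subseteq> J" by (auto simp: J_def)
  ultimately have eq: "colon_y I N = J" "J = {g * r | r. r \<in> R}" by auto
  show ?thesis using g Jstep eq by blast
qed

lemma noetherian: "noetherian_ring imR"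
  unfolding emb_fract.im_noetherian[OF ring]
proof (intro allI impI)
  fix I assume I: "ideal_in I R"
  obtain N g where g: "divides_slices g (colon_y I N)" "colon_y I N = {g * r | r. r \<in> R}"
    using colon_y_stable[OF I] by blast
  have "\<exists>G\<subseteq>R. finite G \<and> colon_y I j = gen_in R G" if "j \<le> N" for j
    using that
  proof (induction j rule: inc_induct)
    case base
    have "g \<in> R" using g(1) by (simp add: divides_slices_def colon_y_def)
    then show ?case using g(2) gen_in_single[OF ring] by (intro exI[of _ "{g}"]) auto
  next
    case (step j)
    then obtain G where G: "G \<subseteq> R" "finite G" "colon_y I (Suc j) = gen_in R G" by blast
    note Ij = colon_y_ideal[OF I, of j]
    obtain p where p: "divides_slices p (colon_y I j)" using divides_slices_ex[OF Ij] by blast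
    \<comment> \<open>Division by \<open>p\<close> leaves a remainder \<open>Yv * b'\<close> with
      \<open>b'\<close> in the next colon ideal, so \<open>p\<close> and the y-multiples of the
      generators one step higher generate \<open>colon_y I j\<close>.\<close>
    let ?G = "insert p ((*) Yv ` G)"
    have pj: "p \<in> colon_y I j" using p by (simp add: divides_slices_def)
    have GI: "?G \<subseteq> colon_y I j" using pj G gen_in_incl[of G R] colon_y_mult by blast
    then have GR: "?G \<subseteq> R" using ideal_in_sub[OF Ij] by blast
    note gI = gen_in_ideal[OF ring GR]
    have "ideal_in {b \<in> R. Yv * b \<in> gen_in R ?G} R"
      unfolding ideal_in_def using gI ring
      by (auto simp: distrib_left mult.left_commute intro: closed_ring_intros ideal_in_zero ideal_in_add ideal_in_mult)
    moreover have "G \<subseteq> {b \<in> R. Yv * b \<in> gen_in R ?G}" using G(1) gen_in_incl[of ?G R] by blast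
    ultimately have YG: "gen_in R G \<subseteq> {b \<in> R. Yv * b \<in> gen_in R ?G}" by (rule gen_in_least)
    have "colon_y I j = gen_in R ?G"
    proof
      show "gen_in R ?G \<subseteq> colon_y I j" using GI by (rule gen_in_least[OF Ij])
      show "colon_y I j \<subseteq> gen_in R ?G"
      proof
        fix b assume "b \<in> colon_y I j"
        then obtain a b' where b: "a \<in> R" "b' \<in> R" "b = p * a + Yv * b'" "Yv * b' \<in> colon_y I j"
          using divides_slices_division[OF Ij p] by blast
        then have "b' \<in> gen_in R G" using colon_y_step G(3) by blast
        then have "Yv * b' \<in> gen_in R ?G" using YG by blast
        moreover have "p * a \<in> gen_in R ?G" using ideal_in_mult2[OF gI b(1)] gen_in_incl[of ?G R] by blast
        ultimately show "b \<in> gen_in R ?G" using b(3) ideal_in_add[OF gI] by blast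
      qed
    qed
    then show ?case using GR G(2) by blast
  qed
  then show "\<exists>G\<subseteq>R. finite G \<and> I = gen_in R G" using colon_y_0[OF I] by (metis le0)
qed

lemma ideal_closed:
  assumes I: "ideal_in I R"
  shows "closedin adic_top (to_fract ` I)"
proof -
  obtain N g where g: "divides_slices g (colon_y I N)"
      "\<And>b. b \<in> R \<Longrightarrow> Yv * b \<in> colon_y I N \<Longrightarrow> b \<in> colon_y I N"
      "colon_y I N = {g * r | r. r \<in> R}"
    using colon_y_stable[OF I] by blast
  \<comment> \<open>Descent from \<open>N\<close> as in \<open>noetherian\<close>: at
    \<open>N\<close> the closure is stable under the division step, so it lies in the multiples of
    \<open>g\<close>; below \<open>N\<close> one division reduces \<open>j\<close> to
    \<open>Suc j\<close>.\<close>
  have "closure_of_ideal (colon_y I j) \<subseteq> colon_y I j" if "j \<le> N" for j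
    using that
  proof (induction j rule: inc_induct)
    case base
    have gR: "g \<in> R" using g(1) ideal_in_sub[OF colon_y_ideal[OF I]] by (auto simp: divides_slices_def)
    show ?case
    proof
      fix f assume f: "f \<in> closure_of_ideal (colon_y I N)"
      have "\<exists>h\<in>R. f = g * h"
      proof (rule division_chain[OF gR _ _ f])
        show "\<exists>a b'. b' \<in> closure_of_ideal (colon_y I N) \<and> b = g * a + Yv * b'"
          if "b \<in> closure_of_ideal (colon_y I N)" for b
          using closure_division[OF colon_y_ideal[OF I] g(1) g(2) that] by blast
      qed auto
      then show "f \<in> colon_y I N" using g(3) by blast
    qed
  next
    case (step j)
    note Ij = colon_y_ideal[OF I, of j]
    obtain p where p: "divides_slices p (colon_y I j)" using divides_slices_ex[OF Ij] by blast
    then have pj: "p \<in> colon_y I j" by (simp add: divides_slices_def)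
    show ?case
    proof
      fix f assume f: "f \<in> closure_of_ideal (colon_y I j)"
      obtain a f' where a: "a \<in> R" "f' \<in> closure_of_ideal (colon_y I (Suc j))" "f = p * a + Yv * f'"
        using closure_division[OF Ij p colon_y_step f] by blast
      then have "f' \<in> colon_y I (Suc j)" using step by blast
      then have "Yv * f' \<in> colon_y I j" by (rule colon_y_mult)
      then show "f \<in> colon_y I j" using a ideal_in_add[OF Ij] ideal_in_mult2[OF Ij a(1) pj] by simp
    qed
  qed
  from this[OF le0] have "closure_of_ideal I \<subseteq> I" unfolding colon_y_0[OF I] .
  then show ?thesis using closedin_top_iff[of I] ideal_in_sub[OF I] by auto
qed

text \<open>A prime without y is closed under division by y, so \<open>division_chain\<close>
  applies to it directly; a nonmaximal prime with y is (y) by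
  \<open>prime_contains_Y\<close>.\<close>

lemma prime_principal:
  assumes P: "prime_in P R" and ne: "P \<noteq> mx"
  shows "\<exists>p\<in>R. P = {p * r | r. r \<in> R}"
proof -
  have I: "ideal_in P R" using P by (rule prime_in_ideal)
  show ?thesis
  proof (cases "Yv \<in> P")
    case False
    obtain g where g: "divides_slices g P" using divides_slices_ex[OF I] by blast
    then have gP: "g \<in> P" by (simp add: divides_slices_def)
    then have gR: "g \<in> R" using ideal_in_sub[OF I] by blast
    have "\<exists>h\<in>R. b = g * h" if "b \<in> P" for b
    proof (rule division_chain[OF gR _ _ that])
      show "P \<subseteq> R" using ideal_in_sub[OF I] by blast
      show "\<exists>a b'. b' \<in> P \<and> b = g * a + Yv * b'" if "b \<in> P" for b
        using divides_slices_division[OF I g that] prime_in_mult[OF P Y_mem] False by metis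
    qed
    then have "P = {g * r | r. r \<in> R}" using ideal_in_mult2[OF I _ gP] by blast
    then show ?thesis using gR by blast
  next
    case True
    then have "P = {f \<in> R. fps_nth f 0 = 0}" using prime_contains_Y[OF P _ ne] by blast
    then have "P \<subseteq> {Yv * r | r. r \<in> R}" using Y_gen ideal_in_sub[OF I] by blast
    moreover have "{Yv * r | r. r \<in> R} \<subseteq> P" using ideal_in_mult2[OF I _ True] by blast
    ultimately show ?thesis using Y_mem by blast
  qed
qed

text \<open>In a chain of four primes the two in the middle differ from \<open>mx\<close>, hence are
  principal, and two comparable nonzero principal primes are equal.\<close>

lemma dim_2: "krull_dim imR = 2"
proof (rule antisym)
  have "n \<le> 2" if P: "\<forall>i\<le>n. prime_in (P i) R" "\<forall>i<n. P i \<subset> P (Suc i)" for n P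
  proof (rule ccontr)
    assume "\<not> n \<le> 2"
    then have P': "prime_in (P 0) R" "prime_in (P 1) R" "prime_in (P 2) R" "prime_in (P 3) R"
      and sub: "P 0 \<subset> P 1" "P 1 \<subset> P 2" "P 2 \<subset> P 3"
      using P by (auto simp: numeral_2_eq_2 numeral_3_eq_3)
    have "P 1 \<noteq> mx" "P 2 \<noteq> mx" using sub prime_sub_mx[OF P'(4)] by auto
    then obtain p q where p: "p \<in> R" "P 1 = {p * r | r. r \<in> R}" and q: "q \<in> R" "P 2 = {q * r | r. r \<in> R}"
      using prime_principal[OF P'(2)] prime_principal[OF P'(3)] by blast
    have "p * 1 \<in> P 1" "q * 1 \<in> P 2" using p q closed_ring_one[OF ring] by blast+
    then have pP: "p \<in> P 1" and qP: "q \<in> P 2" by simp_all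
    have "p \<noteq> 0"
    proof
      assume "p = 0"
      then have "P 1 \<subseteq> {0}" using p by auto
      then show False using sub(1) ideal_in_zero[OF prime_in_ideal[OF P'(1)]] by auto
    qed
    \<comment> \<open>With \<open>q\<close> outside the prime generated by \<open>p\<close>, the
      factor \<open>r\<close> is a multiple of \<open>p\<close>; cancelling \<open>p\<close> makes
      \<open>q\<close> a unit.\<close>
    obtain r where r: "r \<in> R" "p = q * r" using pP sub(2) q by blast
    have "q \<notin> P 1"
    proof
      assume "q \<in> P 1"
      then have "P 2 \<subseteq> P 1" unfolding q(2) using ideal_in_mult2[OF prime_in_ideal[OF P'(2)]] by auto
      then show False using sub(2) by blast
    qed
    then have "r \<in> P 1" using prime_in_mult[OF P'(2) q(1) r(1)] pP r by simp
    then obtain s where s: "s \<in> R" "r = p * s" using p by blast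
    have "p * (q * s) = p * 1" using r(2) s(2) by (metis mult.left_commute mult.right_neutral)
    then have "q * s = 1" using \<open>p \<noteq> 0\<close> by (metis mult_cancel_left)
    then show False using ideal_in_mult2[OF prime_in_ideal[OF P'(3)] s(1) qP] prime_in_one[OF P'(3)] by simp
  qed
  then show "krull_dim imR \<le> 2"
    unfolding emb_fract.im_krull_dim[OF ring]
    by (intro Sup_least) (auto simp: numeral_eq_enat)
  show "2 \<le> krull_dim imR"
    unfolding emb_fract.im_krull_dim[OF ring] using chain_2
    by (intro Sup_upper) (auto simp: numeral_eq_enat)
qed

lemma im_gen_XY: "genideal imR {x_var, y_var} = to_fract ` mx"
  using emb_fract.im_genideal_gen_in[OF ring, of "{Xv, Yv}"] X_mem Y_mem gen_XY
  by (simp add: var_eq)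

lemma regular: "two_dim_regular_local_domain (to_fract ` R)"
proof -
  \<comment> \<open>The number of generators has to equal the dimension 2, so the two variables must
    be distinct elements.\<close>
  have ne: "x_var \<noteq> (y_var :: 'a fps fps fract)"
  proof
    assume "x_var = (y_var :: 'a fps fps fract)"
    then have "cf Xv 0 1 = cf (Yv :: 'a fps fps) 0 1" unfolding var_eq by simp
    then show False by simp
  qed
  have xy: "{x_var, y_var} \<subseteq> to_fract ` R"
    unfolding var_eq using X_mem Y_mem by simp
  have "regular_local_ring imR"
    unfolding regular_local_ring_def
  proof (intro conjI exI[of _ "{x_var, y_var}"])
    show "{x_var, y_var} \<subseteq> carrier imR" using xy by auto
    show "enat (card {x_var, y_var :: 'a fps fps fract}) = krull_dim imR"
      using ne dim_2 by (simp add: numeral_eq_enat)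
  qed (use noetherian im_local im_gen_XY in simp_all)
  then show ?thesis
    using emb_fract.im_domain[OF ring] dim_2 by (simp add: two_dim_regular_local_domain_def)
qed

end

section \<open>The rings of the construction inside k[[x,y]]\<close>

text \<open>The k-algebra generated by \<open>G\<close> inside k[[x,y]];
  \<open>adjoin_ring_image\<close> identifies its image with \<open>adjoin_ring\<close>. Differences
  stand for sums and negatives, which leaves four cases in inductions.\<close>

inductive_set gring :: "'a::field fps fps set \<Rightarrow> 'a fps fps set" for G where
  gconst: "cc c \<in> gring G"
| gincl: "g \<in> G \<Longrightarrow> g \<in> gring G"
| gdiff: "f \<in> gring G \<Longrightarrow> g \<in> gring G \<Longrightarrow> f - g \<in> gring G"
| gmult: "f \<in> gring G \<Longrightarrow> g \<in> gring G \<Longrightarrow> f * g \<in> gring G"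

lemma gring_closed: "closed_ring (gring G)"
  unfolding closed_ring_def
  using gconst[of 1 G, unfolded fps_const_1_eq_1] gdiff[of _ G] gmult[of _ G] by blast

lemma gring_subset:
  assumes "closed_ring R" "\<And>c. cc c \<in> R" "G \<subseteq> R"
  shows "gring G \<subseteq> R"
proof
  fix f assume "f \<in> gring G"
  then show "f \<in> R" by induction (use assms closed_ring_diff closed_ring_mult in auto)
qed

lemma ring_of_type_simps:
  "carrier (ring_of_type_algebra :: 'a::comm_ring_1 ring) = UNIV"
  "monoid.mult (ring_of_type_algebra :: 'a ring) = (*)" "monoid.one (ring_of_type_algebra :: 'a ring) = 1"
  "ring.zero (ring_of_type_algebra :: 'a ring) = 0" "ring.add (ring_of_type_algebra :: 'a ring) = (+)"
  by (auto simp: ring_of_type_algebra_def)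

lemma ring_of_type_a_inv: "\<ominus>\<^bsub>ring_of_type_algebra\<^esub> (z :: 'a::field) = - z"
proof -
  interpret cring "ring_of_type_algebra :: 'a ring" by (rule cring_from_type_algebra)
  show ?thesis by (rule minus_equality) (auto simp: ring_of_type_simps)
qed

lemma ring_of_type_m_inv:
  assumes "(z :: 'a::field) \<noteq> 0"
  shows "inv\<^bsub>ring_of_type_algebra\<^esub> z = inverse z"
proof -
  interpret cring "ring_of_type_algebra :: 'a ring" by (rule cring_from_type_algebra)
  show ?thesis using assms by (intro comm_inv_char) (auto simp: ring_of_type_simps)
qed

lemma adjoin_ring_image: "adjoin_ring (to_fract ` G) = to_fract ` gring G"
proof
  show "adjoin_ring (to_fract ` G) \<subseteq> to_fract ` gring G"
  proof
    fix z assume "z \<in> adjoin_ring (to_fract ` G)"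
    then show "z \<in> to_fract ` gring G"
      unfolding adjoin_ring_def
    proof induction
      case one
      have "1 = to_fract (1 :: 'a fps fps)" by simp
      then show ?case using closed_ring_one[OF gring_closed] by (metis imageI ring_of_type_simps(3))
    next
      case (incl z)
      then show ?case by (auto simp: base_field_def gconst gincl)
    next
      case (a_inv z)
      then obtain f where "z = to_fract f" "f \<in> gring G" by blast
      then have "- z = to_fract (- f)" "- f \<in> gring G" using closed_ring_uminus[OF gring_closed] by auto
      then show ?case unfolding ring_of_type_a_inv by blast
    next
      case (eng_add z w)
      then obtain f g where "z = to_fract f" "f \<in> gring G" "w = to_fract g" "g \<in> gring G" by blast
      then have "z + w = to_fract (f + g)" "f + g \<in> gring G" using closed_ring_add[OF gring_closed] by auto
      then show ?case unfolding ring_of_type_simps by blast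
    next
      case (eng_mult z w)
      then obtain f g where "z = to_fract f" "f \<in> gring G" "w = to_fract g" "g \<in> gring G" by blast
      then have "z * w = to_fract (f * g)" "f * g \<in> gring G" using gmult by auto
      then show ?case unfolding ring_of_type_simps by blast
    qed
  qed
  have "to_fract f \<in> adjoin_ring (to_fract ` G)" if "f \<in> gring G" for f
    using that unfolding adjoin_ring_def
  proof induction
    case (gconst c)
    then show ?case by (intro generate_ring.incl) (auto simp: base_field_def)
  next
    case (gincl g)
    then show ?case by (intro generate_ring.incl) auto
  next
    case (gdiff f g)
    from generate_ring.eng_add[OF gdiff(3) generate_ring.a_inv[OF gdiff(4)]]
    show ?case by (simp add: ring_of_type_a_inv ring_of_type_simps)
  next
    case (gmult f g)
    from generate_ring.eng_mult[OF gmult(3,4)]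
    show ?case by (simp add: ring_of_type_simps)
  qed
  then show "to_fract ` gring G \<subseteq> adjoin_ring (to_fract ` G)" by blast
qed

lemma adjoin_field_closed:
  shows adjoin_field_const: "to_fract (cc c) \<in> adjoin_field H"
    and adjoin_field_incl: "z \<in> H \<Longrightarrow> z \<in> adjoin_field H"
    and adjoin_field_add: "z \<in> adjoin_field H \<Longrightarrow> w \<in> adjoin_field H \<Longrightarrow> z + w \<in> adjoin_field H"
    and adjoin_field_diff: "z \<in> adjoin_field H \<Longrightarrow> w \<in> adjoin_field H \<Longrightarrow> z - w \<in> adjoin_field H"
    and adjoin_field_mult: "z \<in> adjoin_field H \<Longrightarrow> w \<in> adjoin_field H \<Longrightarrow> z * w \<in> adjoin_field H"
    and adjoin_field_divide: "z \<in> adjoin_field H \<Longrightarrow> w \<in> adjoin_field H \<Longrightarrow> z / w \<in> adjoin_field H"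
proof -
  note simps = ring_of_type_simps ring_of_type_a_inv
  show const: "to_fract (cc c) \<in> adjoin_field H" for c
    unfolding adjoin_field_def by (rule generate_field.incl) (auto simp: base_field_def)
  show "z \<in> H \<Longrightarrow> z \<in> adjoin_field H"
    unfolding adjoin_field_def by (rule generate_field.incl) auto
  show "z \<in> adjoin_field H \<Longrightarrow> w \<in> adjoin_field H \<Longrightarrow> z + w \<in> adjoin_field H"
    unfolding adjoin_field_def using generate_field.eng_add[of z ring_of_type_algebra _ w] by (simp add: simps)
  show "z \<in> adjoin_field H \<Longrightarrow> w \<in> adjoin_field H \<Longrightarrow> z - w \<in> adjoin_field H"
    unfolding adjoin_field_def
    using generate_field.eng_add[OF _ generate_field.a_inv[of w ring_of_type_algebra], of z] by (simp add: simps)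
  show mult: "z \<in> adjoin_field H \<Longrightarrow> w \<in> adjoin_field H \<Longrightarrow> z * w \<in> adjoin_field H" for z w
    unfolding adjoin_field_def using generate_field.eng_mult[of z ring_of_type_algebra _ w] by (simp add: simps)
  show "z \<in> adjoin_field H \<Longrightarrow> w \<in> adjoin_field H \<Longrightarrow> z / w \<in> adjoin_field H"
  proof (cases "w = 0")
    case True
    then show ?thesis using const[of 0] by simp
  next
    case False
    assume z: "z \<in> adjoin_field H" and w: "w \<in> adjoin_field H"
    have "inverse w \<in> adjoin_field H"
      using generate_field.m_inv[of w ring_of_type_algebra] w False ring_of_type_m_inv[OF False]
      unfolding adjoin_field_def by (simp add: simps)
    then show ?thesis using mult[OF z] by (simp add: divide_inverse)
  qed
qed

section \<open>Exchange of the variables, and endpieces\<close>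

definition yc :: "'a::field fps \<Rightarrow> 'a fps fps" where
  "yc f = Abs_fps (\<lambda>j. fps_const (fps_nth f j))"

text \<open>The exchange of x and y, which maps \<open>UU \<sigma> \<tau>\<close> to
  \<open>UU \<tau> \<sigma>\<close>. It carries statements about the outer variable y over to the
  inner variable x.\<close>

definition sw :: "'a::field fps fps \<Rightarrow> 'a fps fps" where
  "sw f = Abs_fps (\<lambda>j. Abs_fps (\<lambda>i. cf f i j))"

lemma cf_yc [simp]: "cf (yc f) j i = (if i = 0 then fps_nth f j else 0)"
  by (simp add: yc_def)

lemma cf_sw [simp]: "cf (sw f) j i = cf f i j"
  by (simp add: sw_def)

lemma in_y_yc: "in_y f = to_fract (yc f)"
  by (simp add: in_y_def yc_def)

lemma sw_sw [simp]: "sw (sw f) = f"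
  by (rule fps2_eqI) simp

lemma sw_const [simp]: "sw (fps_const u) = yc u"
  by (rule fps2_eqI) simp

lemma sw_yc [simp]: "sw (yc u) = fps_const u"
  by (rule fps2_eqI) simp

lemma yc_const: "yc (fps_const c) = cc c"
  by (rule fps2_eqI) simp

lemma yc_X: "yc fps_X = Yv"
  by (rule fps2_eqI) simp

lemma sw_diff: "sw (f - g) = sw f - sw g"
  by (rule fps2_eqI) simp

lemma sw_add: "sw (f + g) = sw f + sw g"
  by (rule fps2_eqI) simp

lemma cf_mult: "cf (f * g) j i = (\<Sum>l=0..j. \<Sum>k=0..i. cf f l k * cf g (j - l) (i - k))"
  by (simp add: fps_mult_nth fps_sum_nth)

lemma sw_mult: "sw (f * g) = sw f * sw g"
proof (rule fps2_eqI)
  fix j i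
  show "cf (sw (f * g)) j i = cf (sw f * sw g) j i"
    unfolding cf_sw cf_mult by (rule sum.swap)
qed

lemma sw_eq_iff [simp]: "sw f = sw g \<longleftrightarrow> f = g"
  by (metis sw_sw)

lemma sw_1: "sw 1 = 1"
  by (rule fps2_eqI) simp

lemma dom_emb_sw: "dom_emb sw"
  by unfold_locales (simp_all add: sw_1 sw_add sw_mult)

lemma sw_0 [simp]: "sw 0 = 0"
  by (rule fps2_eqI) simp

lemma sw_eq_0 [simp]: "sw f = 0 \<longleftrightarrow> f = 0"
  using sw_eq_iff[of f 0] by simp

lemma sw_power: "sw (f ^ n) = sw f ^ n"
  by (induction n) (auto simp: sw_mult intro: fps2_eqI)

lemma sw_Yv [simp]: "sw Yv = Xv"
  by (rule fps2_eqI) simp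

lemma yc_mult: "yc (f * g) = yc f * yc g"
  using arg_cong[OF fps_const_mult[of f g], of sw] by (simp only: sw_mult sw_const)

lemma yc_add: "yc (f + g) = yc f + yc g"
  by (rule fps2_eqI) simp

lemma sw_gring: "f \<in> gring G \<Longrightarrow> sw f \<in> gring (sw ` G)"
proof (induction rule: gring.induct)
  case (gconst c)
  then show ?case using gring.gconst[of c] by (simp add: yc_const)
qed (auto simp: sw_diff sw_mult intro: gring.intros)

text \<open>The recursion \<sigma>_n = x (a_(n+1) + \<sigma>_(n+1)). It yields the inclusion of each
  level of \<open>U\<close> in the next, and read as a division by x it is the reason why
  \<open>U\<close> is closed under such division.\<close>

lemma endpiece_rec: "endpiece n f = fps_X * (fps_const (fps_nth f (Suc n)) + endpiece (Suc n) f)"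
proof (rule fps_ext)
  fix j
  show "fps_nth (endpiece n f) j = fps_nth (fps_X * (fps_const (fps_nth f (Suc n)) + endpiece (Suc n) f)) j"
    by (cases j) (auto simp: endpiece_def)
qed

lemma endpiece_0: "fps_nth f 0 = 0 \<Longrightarrow> endpiece 0 f = f"
  by (rule fps_ext) (simp add: endpiece_def)

lemma endpiece_nth_0 [simp]: "fps_nth (endpiece n f) 0 = 0"
  by (simp add: endpiece_def)

lemma shift_endpiece: "fps_shift 1 (endpiece n f) = fps_const (fps_nth f (Suc n)) + endpiece (Suc n) f"
  by (rule fps_ext) (simp add: endpiece_def)

text \<open>A product rule for the difference quotient (f - f(0)) / y, which reduces closure under
  division by y to the generators.\<close>

lemma fps_shift_1_mult:
  "fps_shift 1 (f * g) = fps_shift 1 f * g + fps_const (fps_nth f 0) * fps_shift 1 (g :: 'b::comm_ring_1 fps)"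
proof -
  have "f * g = fps_const (fps_nth f 0) * g + fps_X * (fps_shift 1 f * g)"
    by (subst fps_decomp_shift[of f]) (simp add: algebra_simps)
  also have "\<dots> = fps_const (fps_nth f 0) * fps_const (fps_nth g 0) +
      fps_X * (fps_shift 1 f * g + fps_const (fps_nth f 0) * fps_shift 1 g)"
    by (subst fps_decomp_shift[of g]) (simp add: algebra_simps)
  finally have *: "f * g = fps_const (fps_nth f 0 * fps_nth g 0) +
      fps_X * (fps_shift 1 f * g + fps_const (fps_nth f 0) * fps_shift 1 g)" by simp
  show ?thesis by (rule fps_ext) (subst *, simp)
qed

lemma shift_1_Y_mult [simp]: "fps_shift (Suc 0) (fps_X * f) = (f :: 'b::comm_ring_1 fps)"
  by (rule fps_ext) simp

section \<open>The ring U\<close>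

definition Ug :: "'a::field fps \<Rightarrow> 'a fps \<Rightarrow> nat \<Rightarrow> 'a fps fps set" where
  "Ug \<sigma> \<tau> n = {Xv, Yv, fps_const (endpiece n \<sigma>), yc (endpiece n \<tau>)}"

abbreviation Ulev :: "'a::field fps \<Rightarrow> 'a fps \<Rightarrow> nat \<Rightarrow> 'a fps fps set" where
  "Ulev \<sigma> \<tau> n \<equiv> gring (Ug \<sigma> \<tau> n)"

definition UU :: "'a::field fps \<Rightarrow> 'a fps \<Rightarrow> 'a fps fps set" where
  "UU \<sigma> \<tau> = (\<Union>n\<in>{1..}. Ulev \<sigma> \<tau> n)"

lemma gens_Ug: "gens \<sigma> \<tau> n = to_fract ` Ug \<sigma> \<tau> n"
  by (simp add: gens_def Ug_def in_y_yc yc_X in_x_def)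

lemma ring_Un_eq: "ring_Un \<sigma> \<tau> n = to_fract ` Ulev \<sigma> \<tau> n"
  by (simp add: ring_Un_def gens_Ug adjoin_ring_image)

lemma ring_U_eq: "ring_U \<sigma> \<tau> = to_fract ` UU \<sigma> \<tau>"
  by (auto simp: ring_U_def ring_Un_eq UU_def)

lemma sw_Ulev: "f \<in> Ulev \<sigma> \<tau> n \<Longrightarrow> sw f \<in> Ulev \<tau> \<sigma> n"
proof -
  have "sw ` Ug \<sigma> \<tau> n = Ug \<tau> \<sigma> n" by (auto simp: Ug_def yc_X)
  then show "f \<in> Ulev \<sigma> \<tau> n \<Longrightarrow> sw f \<in> Ulev \<tau> \<sigma> n" using sw_gring by metis
qed

lemma sw_UU: "f \<in> UU \<sigma> \<tau> \<Longrightarrow> sw f \<in> UU \<tau> \<sigma>"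
  unfolding UU_def using sw_Ulev by blast

lemma Ulev_step: "Ulev \<sigma> \<tau> n \<subseteq> Ulev \<sigma> \<tau> (Suc n)"
proof (rule gring_subset[OF gring_closed gconst])
  have "fps_const (endpiece n \<sigma>) = Xv * (cc (fps_nth \<sigma> (Suc n)) + fps_const (endpiece (Suc n) \<sigma>))"
    by (subst endpiece_rec) simp
  moreover have "yc (endpiece n \<tau>) = Yv * (cc (fps_nth \<tau> (Suc n)) + yc (endpiece (Suc n) \<tau>))"
    by (subst endpiece_rec) (simp add: yc_mult yc_add yc_X yc_const)
  moreover have "Xv * (cc (fps_nth \<sigma> (Suc n)) + fps_const (endpiece (Suc n) \<sigma>)) \<in> Ulev \<sigma> \<tau> (Suc n)"
    "Yv * (cc (fps_nth \<tau> (Suc n)) + yc (endpiece (Suc n) \<tau>)) \<in> Ulev \<sigma> \<tau> (Suc n)"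
    by (intro closed_ring_intros gring_closed gconst gincl; simp add: Ug_def)+
  ultimately have "fps_const (endpiece n \<sigma>) \<in> Ulev \<sigma> \<tau> (Suc n)" "yc (endpiece n \<tau>) \<in> Ulev \<sigma> \<tau> (Suc n)"
    by simp_all
  moreover have "Xv \<in> Ulev \<sigma> \<tau> (Suc n)" "Yv \<in> Ulev \<sigma> \<tau> (Suc n)" by (auto simp: Ug_def intro!: gincl)
  ultimately show "Ug \<sigma> \<tau> n \<subseteq> Ulev \<sigma> \<tau> (Suc n)" unfolding Ug_def by blast
qed

lemma Ulev_mono: "m \<le> n \<Longrightarrow> Ulev \<sigma> \<tau> m \<subseteq> Ulev \<sigma> \<tau> n"
  by (rule lift_Suc_mono_le[of "Ulev \<sigma> \<tau>", OF Ulev_step])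

lemma UU_iff: "f \<in> UU \<sigma> \<tau> \<longleftrightarrow> (\<exists>n. f \<in> Ulev \<sigma> \<tau> n)"
proof
  assume "\<exists>n. f \<in> Ulev \<sigma> \<tau> n"
  then obtain n where "f \<in> Ulev \<sigma> \<tau> n" by blast
  then have "f \<in> Ulev \<sigma> \<tau> (Suc n)" using Ulev_step by blast
  then show "f \<in> UU \<sigma> \<tau>" by (auto simp: UU_def intro!: bexI[of _ "Suc n"])
qed (auto simp: UU_def)

lemma UU_common:
  assumes "f \<in> UU \<sigma> \<tau>" "g \<in> UU \<sigma> \<tau>"
  obtains n where "n \<ge> 1" "f \<in> Ulev \<sigma> \<tau> n" "g \<in> Ulev \<sigma> \<tau> n"
proof -
  obtain i j where ij: "f \<in> Ulev \<sigma> \<tau> i" "g \<in> Ulev \<sigma> \<tau> j" using assms UU_iff by metis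
  let ?n = "max 1 (max i j)"
  have "f \<in> Ulev \<sigma> \<tau> ?n" by (rule subsetD[OF Ulev_mono ij(1)]) simp
  moreover have "g \<in> Ulev \<sigma> \<tau> ?n" by (rule subsetD[OF Ulev_mono ij(2)]) simp
  ultimately show thesis using that[of ?n] by simp
qed

lemma UU_closed: "closed_ring (UU \<sigma> \<tau>)"
  unfolding closed_ring_def
proof (intro conjI ballI)
  let ?U = "UU \<sigma> \<tau>"
  show "1 \<in> ?U" using closed_ring_one[OF gring_closed] UU_iff by blast
  fix f g assume "f \<in> ?U" "g \<in> ?U"
  then obtain n where "f \<in> Ulev \<sigma> \<tau> n" "g \<in> Ulev \<sigma> \<tau> n" using UU_common by blast
  then show "f - g \<in> ?U" "f * g \<in> ?U" using gdiff gmult UU_iff by blast+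
qed

lemma Ulev_slice: "f \<in> Ulev \<sigma> \<tau> n \<Longrightarrow> fps_const (fps_nth f 0) \<in> Ulev \<sigma> \<tau> n"
proof (induction rule: gring.induct)
  case (gconst c)
  then show ?case using gring.gconst[of c] by simp
next
  case (gincl g)
  have "fps_const (fps_nth (yc (endpiece n \<tau>)) 0) = cc 0"
    by (rule fps2_eqI) simp
  then show ?case using gincl gring.gincl[of g "Ug \<sigma> \<tau> n"] gring.gconst[of 0 "Ug \<sigma> \<tau> n"]
    by (auto simp: Ug_def)
next
  case (gdiff f g)
  then show ?case using gring.gdiff by (fastforce simp flip: fps_const_sub)
next
  case (gmult f g)
  then show ?case using gring.gmult by (fastforce simp flip: fps_const_mult)
qed

text \<open>Division by y, after the constant term in y is removed, sends \<tau>_n to b_(n+1) +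
  \<tau>_(n+1). The level rises by one, and it is the union of the levels that is closed under the
  operation.\<close>

lemma Ulev_shift_y: "f \<in> Ulev \<sigma> \<tau> n \<Longrightarrow> fps_shift 1 f \<in> Ulev \<sigma> \<tau> (Suc n)"
proof (induction rule: gring.induct)
  case (gconst c)
  have "fps_shift 1 (cc c) = cc 0" by (rule fps2_eqI) simp
  then show ?case by (simp only: gring.gconst)
next
  case (gincl g)
  have s: "fps_shift 1 (fps_const u) = cc 0" for u :: "'a fps" by (rule fps2_eqI) simp
  have "fps_shift 1 Yv = (cc 1 :: 'a fps fps)" by (rule fps2_eqI) simp
  moreover have "fps_shift 1 (yc (endpiece n \<tau>)) = yc (fps_shift 1 (endpiece n \<tau>))"
    by (rule fps2_eqI) simp
  then have "fps_shift 1 (yc (endpiece n \<tau>)) = cc (fps_nth \<tau> (Suc n)) + yc (endpiece (Suc n) \<tau>)"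
    unfolding shift_endpiece by (simp add: yc_add yc_const)
  moreover have "cc (fps_nth \<tau> (Suc n)) + yc (endpiece (Suc n) \<tau>) \<in> Ulev \<sigma> \<tau> (Suc n)"
    by (intro closed_ring_add gring_closed gring.gconst gring.gincl) (simp add: Ug_def)
  ultimately show ?case
    using gincl s gring.gconst[of 0 "Ug \<sigma> \<tau> (Suc n)"] gring.gconst[of 1 "Ug \<sigma> \<tau> (Suc n)"]
    unfolding Ug_def by (metis insertE singletonD)
next
  case (gdiff f g)
  have "fps_shift 1 (f - g) = fps_shift 1 f - fps_shift 1 g" by (rule fps_ext) simp
  then show ?case using gring.gdiff gdiff by metis
next
  case (gmult f g)
  have "g \<in> Ulev \<sigma> \<tau> (Suc n)" "fps_const (fps_nth f 0) \<in> Ulev \<sigma> \<tau> (Suc n)"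
    using gmult(1,2) Ulev_slice Ulev_step by blast+
  then show ?case unfolding fps_shift_1_mult
    using gmult by (intro closed_ring_add gring_closed gring.gmult)
qed

lemma UU_slice: "f \<in> UU \<sigma> \<tau> \<Longrightarrow> fps_const (fps_nth f 0) \<in> UU \<sigma> \<tau>"
  using Ulev_slice UU_iff by metis

lemma UU_shift_y: "f \<in> UU \<sigma> \<tau> \<Longrightarrow> fps_shift 1 f \<in> UU \<sigma> \<tau>"
  using Ulev_shift_y UU_iff by metis

lemma UU_div_Y: "Yv * f \<in> UU \<sigma> \<tau> \<Longrightarrow> f \<in> UU \<sigma> \<tau>"
  using UU_shift_y[of "Yv * f"] by simp

lemma UU_div_X:
  assumes "Xv * f \<in> UU \<sigma> \<tau>"
  shows "f \<in> UU \<sigma> \<tau>"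
proof -
  have "sw (Xv * f) = Yv * sw f" by (simp add: sw_mult yc_X)
  then have "sw f \<in> UU \<tau> \<sigma>" using sw_UU[OF assms] UU_div_Y by metis
  then show ?thesis using sw_UU by force
qed

lemma UU_const: "cc c \<in> UU \<sigma> \<tau>"
  using gconst UU_iff by blast

lemma UU_X: "Xv \<in> UU \<sigma> \<tau>"
  unfolding UU_iff by (rule exI[of _ 0], rule gincl) (simp add: Ug_def)

lemma UU_Y: "Yv \<in> UU \<sigma> \<tau>"
  unfolding UU_iff by (rule exI[of _ 0], rule gincl) (simp add: Ug_def)

section \<open>B and A as rings of fractions of U inside k[[x,y]]\<close>

definition frac_by :: "'a::field fps \<Rightarrow> 'a fps \<Rightarrow> ('a fps fps \<Rightarrow> bool) \<Rightarrow> 'a fps fps set" where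
  "frac_by \<sigma> \<tau> S = {h. \<exists>g\<in>UU \<sigma> \<tau>. S g \<and> g * h \<in> UU \<sigma> \<tau>}"

lemma frac_by_superset: "S 1 \<Longrightarrow> UU \<sigma> \<tau> \<subseteq> frac_by \<sigma> \<tau> S"
  using closed_ring_one[OF UU_closed] by (force simp: frac_by_def)

text \<open>Differences and products use a common denominator, and division by x and y is inherited
  from \<open>U\<close>. The slice alone depends on \<open>S\<close>: it needs a denominator whose
  own value at y = 0 is admissible.\<close>

lemma frac_by_stable:
  fixes \<sigma> \<tau> :: "'a::field fps"
  assumes S: "S 1" "\<And>f g. S f \<Longrightarrow> S g \<Longrightarrow> S (f * g)"
    and slice: "\<And>h. h \<in> frac_by \<sigma> \<tau> S \<Longrightarrow>
      \<exists>g\<in>UU \<sigma> \<tau>. S (fps_const (fps_nth g 0)) \<and> g * h \<in> UU \<sigma> \<tau>"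
  shows "stable_ring (frac_by \<sigma> \<tau> S)"
proof
  let ?U = "UU \<sigma> \<tau>"
  let ?F = "frac_by \<sigma> \<tau> S"
  note U = UU_closed[of \<sigma> \<tau>]
  have memI: "h \<in> ?F" if "g \<in> ?U" "S g" "g * h \<in> ?U" for g h
    using that by (auto simp: frac_by_def)
  show R: "closed_ring ?F"
    unfolding closed_ring_def
  proof (intro conjI ballI)
    show "1 \<in> ?F" using frac_by_superset[where S = S, OF S(1)] closed_ring_one[OF U] by blast
    fix h h' assume "h \<in> ?F" "h' \<in> ?F"
    then obtain g g' where g: "g \<in> ?U" "S g" "g * h \<in> ?U"
      "g' \<in> ?U" "S g'" "g' * h' \<in> ?U" by (auto simp: frac_by_def)
    have "g * g' * (h - h') = g' * (g * h) - g * (g' * h')" "g * g' * (h * h') = (g * h) * (g' * h')"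
      by (auto simp: algebra_simps)
    moreover have "g' * (g * h) - g * (g' * h') \<in> ?U" "(g * h) * (g' * h') \<in> ?U"
      "g * g' \<in> ?U" using g by (blast intro: closed_ring_diff[OF U] closed_ring_mult[OF U])+
    ultimately show "h - h' \<in> ?F" "h * h' \<in> ?F" using memI[of "g * g'"] S(2)[OF g(2,5)] by metis+
  qed
  have sup: "?U \<subseteq> ?F" using frac_by_superset[where S = S, OF S(1)] .
  show const: "cc c \<in> ?F" for c using sup UU_const by blast
  show "Xv \<in> ?F" "Yv \<in> ?F" using sup UU_X UU_Y by blast+
  show slice': "fps_const (fps_nth h 0) \<in> ?F" if "h \<in> ?F" for h
  proof -
    from slice[OF that]
    obtain g where g: "g \<in> ?U" "S (fps_const (fps_nth g 0))" "g * h \<in> ?U" by blast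
    then show ?thesis using UU_slice[OF g(1)] UU_slice[OF g(3)]
      by (intro memI[of "fps_const (fps_nth g 0)"]) auto
  qed
  show "fps_shift 1 h \<in> ?F" if "h \<in> ?F" for h
  proof -
    have "h - fps_const (fps_nth h 0) \<in> ?F" using closed_ring_diff[OF R that slice'[OF that]] .
    moreover have "h - fps_const (fps_nth h 0) = Yv * fps_shift 1 h"
      by (subst (1) fps_decomp_shift[of h]) simp
    ultimately obtain g where g: "g \<in> ?U" "S g" "g * (Yv * fps_shift 1 h) \<in> ?U"
      by (auto simp: frac_by_def)
    have "Yv * (g * fps_shift 1 h) \<in> ?U" using g(3) by (simp add: mult.left_commute)
    then show ?thesis using memI g UU_div_Y by blast
  qed
  show "fps_const (fps_shift 1 u) \<in> ?F" if "fps_const u \<in> ?F" for u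
  proof -
    have "fps_const u - cc (fps_nth u 0) \<in> ?F" using closed_ring_diff[OF R that const] .
    moreover have "fps_const u - cc (fps_nth u 0) = Xv * fps_const (fps_shift 1 u)"
      by (subst (1) fps_decomp_shift[of u]) simp
    ultimately obtain g where g: "g \<in> ?U" "S g" "g * (Xv * fps_const (fps_shift 1 u)) \<in> ?U"
      by (auto simp: frac_by_def)
    have "Xv * (g * fps_const (fps_shift 1 u)) \<in> ?U" using g(3) by (simp add: mult.left_commute)
    then show ?thesis using memI g UU_div_X by blast
  qed
qed

definition BB :: "'a::field fps \<Rightarrow> 'a fps \<Rightarrow> 'a fps fps set" where
  "BB \<sigma> \<tau> = frac_by \<sigma> \<tau> (\<lambda>g. cf g 0 0 \<noteq> 0)"

definition AA :: "'a::field fps \<Rightarrow> 'a fps \<Rightarrow> 'a fps fps set" where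
  "AA \<sigma> \<tau> = frac_by \<sigma> \<tau> (\<lambda>g. g \<noteq> 0)"

lemma BB_local_stable: "local_stable_ring (BB \<sigma> \<tau>)"
proof -
  let ?B = "BB \<sigma> \<tau>"
  interpret stable_ring "?B"
    unfolding BB_def by (rule frac_by_stable) (auto simp: frac_by_def)
  show ?thesis
  proof
    fix f assume f: "f \<in> ?B" "cf f 0 0 \<noteq> 0"
    then obtain g where g: "g \<in> UU \<sigma> \<tau>" "cf g 0 0 \<noteq> 0" "g * f \<in> UU \<sigma> \<tau>"
      by (auto simp: BB_def frac_by_def)
    obtain h where h: "f * h = 1" using fps2_inverse_ex f by blast
    \<comment> \<open>\<open>g * f\<close> serves as a denominator for the inverse \<open>h\<close>,
      with numerator \<open>g\<close>.\<close>
    have eq: "g * f * h = g" using h by (simp add: mult.assoc)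
    have "(g * f) * h \<in> UU \<sigma> \<tau>" unfolding eq by (rule g(1))
    moreover have "cf (g * f) 0 0 \<noteq> 0" using g f by simp
    ultimately have "h \<in> ?B" unfolding BB_def frac_by_def using g(3) by blast
    then show "\<exists>g\<in>?B. f * g = 1" using h by blast
  qed
qed

lemma UU_div_Y_power: "Yv ^ n * f \<in> UU \<sigma> \<tau> \<Longrightarrow> f \<in> UU \<sigma> \<tau>"
  by (induction n) (auto simp: mult.assoc dest: UU_div_Y)

lemma UU_div_X_power: "Xv ^ n * f \<in> UU \<sigma> \<tau> \<Longrightarrow> f \<in> UU \<sigma> \<tau>"
proof (induction n)
  case (Suc n)
  have "Xv * (Xv ^ n * f) \<in> UU \<sigma> \<tau>" using Suc(2) by (simp only: power_Suc mult.assoc)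
  then show ?case using Suc(1) UU_div_X by blast
qed simp

lemma fps_Y_decompose:
  fixes f :: "'b::comm_ring_1 fps"
  assumes "f \<noteq> 0"
  obtains n g where "f = fps_X ^ n * g" "fps_nth g 0 \<noteq> 0"
proof
  show "f = fps_X ^ subdegree f * fps_shift (subdegree f) f"
    using subdegree_decompose[of f] by (simp add: mult.commute)
  show "fps_nth (fps_shift (subdegree f) f) 0 \<noteq> 0" using assms by simp
qed

lemma AA_saturated: "saturated_ring (AA \<sigma> \<tau>)"
proof -
  let ?U = "UU \<sigma> \<tau>"
  let ?A = "AA \<sigma> \<tau>"
  interpret stable_ring "?A"
    unfolding AA_def
  proof (rule frac_by_stable)
    fix h assume "h \<in> frac_by \<sigma> \<tau> (\<lambda>g. g \<noteq> 0)"
    then obtain g where g: "g \<in> ?U" "g \<noteq> 0" "g * h \<in> ?U" by (auto simp: frac_by_def)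
    \<comment> \<open>A denominator divisible by y would vanish at y = 0. Its power of y is
      cancelled, which \<open>U\<close> permits.\<close>
    obtain n g' where g': "g = Yv ^ n * g'" "fps_nth g' 0 \<noteq> 0" using fps_Y_decompose[OF g(2)] by blast
    have "g' \<in> ?U" "g' * h \<in> ?U"
      using g g' UU_div_Y_power[of n] by (auto simp: mult.assoc)
    then show "\<exists>g\<in>?U. fps_const (fps_nth g 0) \<noteq> 0 \<and> g * h \<in> ?U" using g' by auto
  qed auto
  show ?thesis
  proof
    fix f h assume f: "f \<in> ?A" "f \<noteq> 0" and fh: "f * h \<in> ?A"
    obtain g g' where g: "g \<in> ?U" "g \<noteq> 0" "g * f \<in> ?U"
      "g' \<in> ?U" "g' \<noteq> 0" "g' * (f * h) \<in> ?U"
      using f(1) fh unfolding AA_def frac_by_def by blast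
    have eq: "(g' * (g * f)) * h = g * (g' * (f * h))" by (simp add: ac_simps)
    have "(g' * (g * f)) * h \<in> ?U"
      unfolding eq by (rule closed_ring_mult[OF UU_closed g(1) g(6)])
    moreover have "g' * (g * f) \<in> ?U" using closed_ring_mult[OF UU_closed g(4) g(3)] .
    moreover have "g' * (g * f) \<noteq> 0" using g f(2) by simp
    ultimately show "h \<in> ?A" unfolding AA_def frac_by_def by blast
  qed
qed

section \<open>Comparison with the rings of the statement\<close>

lemma AA_sup: "UU \<sigma> \<tau> \<subseteq> AA \<sigma> \<tau>" and BB_sup: "UU \<sigma> \<tau> \<subseteq> BB \<sigma> \<tau>"
  unfolding AA_def BB_def by (auto intro: frac_by_superset[THEN subsetD])

lemma BB_sub_AA: "BB \<sigma> \<tau> \<subseteq> AA \<sigma> \<tau>"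
proof
  fix h assume "h \<in> BB \<sigma> \<tau>"
  then obtain g where "g \<in> UU \<sigma> \<tau>" "cf g 0 0 \<noteq> 0" "g * h \<in> UU \<sigma> \<tau>" unfolding BB_def frac_by_def by blast
  moreover from this have "g \<noteq> 0" by auto
  ultimately show "h \<in> AA \<sigma> \<tau>" unfolding AA_def frac_by_def by blast
qed

text \<open>Every element of the level is congruent to its constant term modulo the generators, so
  the localization in \<open>ring_Bn\<close> inverts exactly the elements with nonzero constant
  term.\<close>

lemma gen_Ug: "gen_in (Ulev \<sigma> \<tau> n) (Ug \<sigma> \<tau> n) = {f \<in> Ulev \<sigma> \<tau> n. cf f 0 0 = 0}"
proof -
  let ?R = "Ulev \<sigma> \<tau> n" and ?G = "Ug \<sigma> \<tau> n"
  note R = gring_closed[of ?G]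
  have G: "?G \<subseteq> ?R" using gincl by blast
  note I = gen_in_ideal[OF R G]
  have G0: "cf g 0 0 = 0" if "g \<in> ?G" for g using that by (auto simp: Ug_def)
  have "ideal_in {f \<in> ?R. cf f 0 0 = 0} ?R"
    unfolding ideal_in_def using R by (auto intro: closed_ring_intros)
  then have "gen_in ?R ?G \<subseteq> {f \<in> ?R. cf f 0 0 = 0}" using G G0 by (intro gen_in_least) auto
  moreover have "f - cc (cf f 0 0) \<in> gen_in ?R ?G" if "f \<in> ?R" for f
    using that
  proof induction
    case (gconst c)
    then show ?case using ideal_in_zero[OF I] by simp
  next
    case (gincl g)
    then show ?case using G0[OF gincl] gen_in_incl[of ?G ?R] by auto
  next
    case (gdiff f g)
    have "f - g - cc (cf (f - g) 0 0) = (f - cc (cf f 0 0)) - (g - cc (cf g 0 0))"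
      by (rule fps2_eqI) simp
    then show ?case using ideal_in_diff[OF R I] gdiff by metis
  next
    case (gmult f g)
    have "cc (cf (f * g) 0 0) = cc (cf f 0 0) * cc (cf g 0 0)" by simp
    then have "f * g - cc (cf (f * g) 0 0) = f * (g - cc (cf g 0 0)) + cc (cf g 0 0) * (f - cc (cf f 0 0))"
      by (simp add: algebra_simps del: fps_const_mult)
    then show ?case using ideal_in_add[OF I] ideal_in_mult[OF I] gmult gring.gconst by metis
  qed
  then have "{f \<in> ?R. cf f 0 0 = 0} \<subseteq> gen_in ?R ?G" by force
  ultimately show ?thesis by blast
qed

lemma ring_B_eq: "ring_B \<sigma> \<tau> = to_fract ` BB \<sigma> \<tau>"
proof -
  let ?U = "UU \<sigma> \<tau>"
  let ?B = "BB \<sigma> \<tau>"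
  have Bn: "ring_Bn \<sigma> \<tau> n =
    {to_fract f / to_fract g | f g. f \<in> Ulev \<sigma> \<tau> n \<and> g \<in> Ulev \<sigma> \<tau> n \<and> cf g 0 0 \<noteq> 0}" for n
  proof -
    have "genideal (subring_of (ring_Un \<sigma> \<tau> n)) (gens \<sigma> \<tau> n) = to_fract ` {f \<in> Ulev \<sigma> \<tau> n. cf f 0 0 = 0}"
      unfolding ring_Un_eq gens_Ug gen_Ug[symmetric]
      by (rule emb_fract.im_genideal_gen_in[OF gring_closed]) (auto intro: gincl)
    moreover have "to_fract ` Ulev \<sigma> \<tau> n - to_fract ` {f \<in> Ulev \<sigma> \<tau> n. cf f 0 0 = 0} =
        to_fract ` {f \<in> Ulev \<sigma> \<tau> n. cf f 0 0 \<noteq> 0}"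
      unfolding image_set_diff[OF emb_fract.inj_h, symmetric] by (rule arg_cong[of _ _ "(`) to_fract"]) blast
    ultimately show ?thesis unfolding ring_Bn_def localization_def ring_Un_eq by blast
  qed
  show ?thesis
  proof
    show "ring_B \<sigma> \<tau> \<subseteq> to_fract ` ?B"
    proof
      fix z assume "z \<in> ring_B \<sigma> \<tau>"
      then obtain n f g where n: "f \<in> Ulev \<sigma> \<tau> n" "g \<in> Ulev \<sigma> \<tau> n" "cf g 0 0 \<noteq> 0" "z = to_fract f / to_fract g"
        unfolding ring_B_def Bn by blast
      then have U: "f \<in> ?U" "g \<in> ?U" using UU_iff by blast+
      obtain g' where g': "g * g' = 1" using fps2_inverse_ex n by blast
      have "g * (f * g') = f * (g * g')" by (simp add: ac_simps)
      then have eq: "g * (f * g') = f" using g' by simp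
      have "g \<noteq> 0" using g' by auto
      moreover have "to_fract (f * g') * to_fract g = to_fract f"
        unfolding emb_fract.hom_mult[symmetric] emb_fract.hom_inj using eq by (simp only: mult.commute)
      ultimately have "z = to_fract (f * g')" unfolding n(4) by (intro eq_divide_imp[symmetric]) simp_all
      moreover have "f * g' \<in> ?B"
        unfolding BB_def frac_by_def
        by (intro CollectI bexI[of _ g] conjI, rule n(3), unfold eq, rule U(1), rule U(2))
      ultimately show "z \<in> to_fract ` ?B" by blast
    qed
    show "to_fract ` ?B \<subseteq> ring_B \<sigma> \<tau>"
    proof
      fix z assume "z \<in> to_fract ` ?B"
      then obtain h g where h: "z = to_fract h" "g \<in> ?U" "cf g 0 0 \<noteq> 0" "g * h \<in> ?U"
        by (auto simp: BB_def frac_by_def)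
      obtain n where n: "n \<ge> 1" "g \<in> Ulev \<sigma> \<tau> n" "g * h \<in> Ulev \<sigma> \<tau> n" using UU_common[OF h(2,4)] by blast
      have "g \<noteq> 0" using h(3) by auto
      then have "z = to_fract (g * h) / to_fract g" using h(1) by simp
      then have "z \<in> ring_Bn \<sigma> \<tau> n" unfolding Bn using n h(3) by blast
      then show "z \<in> ring_B \<sigma> \<tau>" using n(1) by (auto simp: ring_B_def)
    qed
  qed
qed

lemma UU_sigma_tau:
  assumes "fps_nth \<sigma> 0 = 0" "fps_nth \<tau> 0 = 0"
  shows "fps_const \<sigma> \<in> Ulev \<sigma> \<tau> 0" "yc \<tau> \<in> Ulev \<sigma> \<tau> 0"
  using assms endpiece_0[of \<sigma>] endpiece_0[of \<tau>] by (auto simp: Ug_def intro!: gincl)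

text \<open>Passing to endpieces does not enlarge the field: \<sigma>_(n+1) is \<sigma>_n / x -
  a_(n+1), and likewise for \<tau>. So k(x,y,\<sigma>,\<tau>) is the fraction field of
  \<open>U\<close>.\<close>

lemma adjoin_field_eq:
  fixes \<sigma> \<tau> :: "'a::field fps"
  assumes st: "fps_nth \<sigma> 0 = 0" "fps_nth \<tau> 0 = 0"
  shows "adjoin_field {x_var, y_var, in_x \<sigma>, in_y \<tau>} =
    {to_fract f / to_fract g | f g. f \<in> UU \<sigma> \<tau> \<and> g \<in> UU \<sigma> \<tau> \<and> g \<noteq> 0}" (is "?L = ?R")
proof
  let ?U = "UU \<sigma> \<tau>"
  note U = UU_closed[of \<sigma> \<tau>]
  have incl: "to_fract f \<in> ?R" if "f \<in> ?U" for f
  proof -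
    have "to_fract f = to_fract f / to_fract 1" by simp
    then show ?thesis using that closed_ring_one[OF U] by (metis (mono_tags, lifting) mem_Collect_eq one_neq_zero)
  qed
  show "?L \<subseteq> ?R"
  proof
    fix z assume "z \<in> ?L"
    then show "z \<in> ?R"
      unfolding adjoin_field_def
    proof induction
      case one
      then show ?case using incl[OF closed_ring_one[OF U]] by (simp add: ring_of_type_simps)
    next
      case (incl z)
      have "fps_const \<sigma> \<in> ?U" "yc \<tau> \<in> ?U" using UU_sigma_tau[OF st] UU_iff by blast+
      then have "z \<in> to_fract ` ?U"
        using incl by (auto simp: base_field_def in_x_def in_y_yc yc_X UU_const UU_X UU_Y)
      then show ?case using \<open>\<And>f. f \<in> ?U \<Longrightarrow> to_fract f \<in> ?R\<close> by blast
    next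
      case (a_inv z)
      then obtain f g where fg: "z = to_fract f / to_fract g" "f \<in> ?U" "g \<in> ?U" "g \<noteq> 0" by blast
      then have "- z = to_fract (- f) / to_fract g" by simp
      then show ?case unfolding ring_of_type_a_inv using fg closed_ring_uminus[OF U fg(2)] by blast
    next
      case (m_inv z)
      then obtain f g where fg: "z = to_fract f / to_fract g" "f \<in> ?U" "g \<in> ?U" "g \<noteq> 0" by blast
      have z: "z \<noteq> 0" using m_inv by (simp add: ring_of_type_simps)
      then have "inverse z = to_fract g / to_fract f" "f \<noteq> 0" using fg by auto
      then show ?case unfolding ring_of_type_m_inv[OF z] using fg by blast
    next
      case (eng_add z w)
      then obtain f g f' g' where fg: "z = to_fract f / to_fract g" "f \<in> ?U" "g \<in> ?U" "g \<noteq> 0"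
        "w = to_fract f' / to_fract g'" "f' \<in> ?U" "g' \<in> ?U" "g' \<noteq> 0" by blast
      have "z + w = to_fract (f * g' + f' * g) / to_fract (g * g')" using fg by (simp add: field_simps)
      moreover have "f * g' + f' * g \<in> ?U" "g * g' \<in> ?U" "g * g' \<noteq> 0"
        using fg by (auto intro!: closed_ring_add[OF U] closed_ring_mult[OF U])
      ultimately show ?case unfolding ring_of_type_simps by blast
    next
      case (eng_mult z w)
      then obtain f g f' g' where fg: "z = to_fract f / to_fract g" "f \<in> ?U" "g \<in> ?U" "g \<noteq> 0"
        "w = to_fract f' / to_fract g'" "f' \<in> ?U" "g' \<in> ?U" "g' \<noteq> 0" by blast
      have "z * w = to_fract (f * f') / to_fract (g * g')" using fg by (simp add: field_simps)
      moreover have "f * f' \<in> ?U" "g * g' \<in> ?U" "g * g' \<noteq> 0"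
        using fg by (auto intro!: closed_ring_mult[OF U])
      ultimately show ?case unfolding ring_of_type_simps by blast
    qed
  qed
  have X: "to_fract Xv \<in> ?L" and Y: "to_fract Yv \<in> ?L"
    using adjoin_field_incl[of _ "{x_var, y_var, in_x \<sigma>, in_y \<tau>}"] by (auto simp: in_x_def in_y_yc yc_X)
  have end_x: "to_fract (fps_const (endpiece n \<sigma>)) \<in> ?L" for n
  proof (induction n)
    case 0
    then show ?case using endpiece_0[OF st(1)] adjoin_field_incl[of "in_x \<sigma>"] by (simp add: in_x_def)
  next
    case (Suc n)
    have "fps_const (endpiece n \<sigma>) = Xv * (cc (fps_nth \<sigma> (Suc n)) + fps_const (endpiece (Suc n) \<sigma>))"
      by (subst endpiece_rec) simp
    from arg_cong[OF this, of to_fract]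
    have "to_fract (fps_const (endpiece (Suc n) \<sigma>)) =
      to_fract (fps_const (endpiece n \<sigma>)) / to_fract Xv - to_fract (cc (fps_nth \<sigma> (Suc n)))"
      by (simp add: field_simps del: fps_const_mult fps_const_add)
    then show ?case using Suc X adjoin_field_const adjoin_field_diff adjoin_field_divide by metis
  qed
  have end_y: "to_fract (yc (endpiece n \<tau>)) \<in> ?L" for n
  proof (induction n)
    case 0
    then show ?case using endpiece_0[OF st(2)] adjoin_field_incl[of "in_y \<tau>"] by (simp add: in_y_yc)
  next
    case (Suc n)
    have "yc (endpiece n \<tau>) = Yv * (cc (fps_nth \<tau> (Suc n)) + yc (endpiece (Suc n) \<tau>))"
      by (subst endpiece_rec) (simp add: yc_mult yc_add yc_X yc_const)
    from arg_cong[OF this, of to_fract]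
    have "to_fract (yc (endpiece (Suc n) \<tau>)) =
      to_fract (yc (endpiece n \<tau>)) / to_fract Yv - to_fract (cc (fps_nth \<tau> (Suc n)))"
      by (simp add: field_simps)
    then show ?case using Suc Y adjoin_field_const adjoin_field_diff adjoin_field_divide by metis
  qed
  have "to_fract f \<in> ?L" if f: "f \<in> ?U" for f
  proof -
    obtain n where "f \<in> Ulev \<sigma> \<tau> n" using f UU_iff by blast
    then show ?thesis
    proof induction
      case (gconst c)
      show ?case by (rule adjoin_field_const)
    next
      case (gincl g)
      then show ?case using X Y end_x end_y by (auto simp: Ug_def)
    next
      case (gdiff f g)
      show ?case unfolding emb_fract.hom_diff using gdiff(3,4) by (rule adjoin_field_diff)
    next
      case (gmult f g)
      show ?case unfolding emb_fract.hom_mult using gmult(3,4) by (rule adjoin_field_mult)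
    qed
  qed
  then show "?R \<subseteq> ?L" using adjoin_field_divide by blast
qed

lemma ring_A_eq:
  assumes st: "fps_nth \<sigma> 0 = 0" "fps_nth \<tau> 0 = 0"
  shows "ring_A \<sigma> \<tau> = to_fract ` AA \<sigma> \<tau>"
proof
  let ?U = "UU \<sigma> \<tau>"
  let ?A = "AA \<sigma> \<tau>"
  show "ring_A \<sigma> \<tau> \<subseteq> to_fract ` ?A"
  proof
    fix z assume "z \<in> ring_A \<sigma> \<tau>"
    then obtain f g h where z: "z = to_fract f / to_fract g" "f \<in> ?U" "g \<in> ?U" "g \<noteq> 0" "z = to_fract h"
      unfolding ring_A_def adjoin_field_eq[OF st] power_series_xy_def by blast
    then have "to_fract (g * h) = to_fract f" by (simp add: field_simps)
    then have "g * h = f" by (simp only: emb_fract.hom_inj)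
    then have "h \<in> ?A" unfolding AA_def frac_by_def using z by auto
    then show "z \<in> to_fract ` ?A" using z by blast
  qed
  show "to_fract ` ?A \<subseteq> ring_A \<sigma> \<tau>"
  proof
    fix z assume "z \<in> to_fract ` ?A"
    then obtain h g where h: "z = to_fract h" "g \<in> ?U" "g \<noteq> 0" "g * h \<in> ?U"
      by (auto simp: AA_def frac_by_def)
    then have "z = to_fract (g * h) / to_fract g" by simp
    then show "z \<in> ring_A \<sigma> \<tau>"
      unfolding ring_A_def adjoin_field_eq[OF st] power_series_xy_def using h by blast
  qed
qed

lemma fraction_field_frac_by:
  assumes "UU \<sigma> \<tau> \<subseteq> R" "R \<subseteq> AA \<sigma> \<tau>"
  shows "fraction_field (to_fract ` R) =
    {to_fract f / to_fract g | f g. f \<in> UU \<sigma> \<tau> \<and> g \<in> UU \<sigma> \<tau> \<and> g \<noteq> 0}" (is "_ = ?R")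
proof
  let ?U = "UU \<sigma> \<tau>"
  show "?R \<subseteq> fraction_field (to_fract ` R)"
    unfolding fraction_field_def using assms(1) by (auto 0 4)
  show "fraction_field (to_fract ` R) \<subseteq> ?R"
  proof
    fix z assume "z \<in> fraction_field (to_fract ` R)"
    then obtain a b where z: "z = to_fract a / to_fract b" "a \<in> AA \<sigma> \<tau>" "b \<in> AA \<sigma> \<tau>" "b \<noteq> 0"
      unfolding fraction_field_def using assms(2) by auto
    then obtain g g' where g: "g \<in> ?U" "g \<noteq> 0" "g * a \<in> ?U" "g' \<in> ?U" "g' \<noteq> 0" "g' * b \<in> ?U"
      unfolding AA_def frac_by_def by blast
    have "z = to_fract (g' * (g * a)) / to_fract (g * (g' * b))" using z g by simp
    moreover have "g' * (g * a) \<in> ?U" "g * (g' * b) \<in> ?U" "g * (g' * b) \<noteq> 0"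
      using g z closed_ring_mult[OF UU_closed] by auto
    ultimately show "z \<in> ?R" by blast
  qed
qed

lemma birational:
  assumes st: "fps_nth \<sigma> 0 = 0" "fps_nth \<tau> 0 = 0"
  shows "birationally_dominates (ring_A \<sigma> \<tau>) (ring_B \<sigma> \<tau>)"
proof -
  interpret A: saturated_ring "AA \<sigma> \<tau>" by (rule AA_saturated)
  interpret B: local_stable_ring "BB \<sigma> \<tau>" by (rule BB_local_stable)
  have "to_fract ` A.mx \<inter> to_fract ` BB \<sigma> \<tau> = to_fract ` B.mx"
    unfolding image_Int[OF emb_fract.inj_h, symmetric] using BB_sub_AA by (intro arg_cong[of _ _ "(`) to_fract"]) auto
  moreover have "fraction_field (to_fract ` AA \<sigma> \<tau>) = fraction_field (to_fract ` BB \<sigma> \<tau>)"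
    unfolding fraction_field_frac_by[OF AA_sup order_refl] fraction_field_frac_by[OF BB_sup BB_sub_AA] ..
  ultimately show ?thesis
    unfolding birationally_dominates_def ring_A_eq[OF st] ring_B_eq A.im_local(2) B.im_local(2)
    using A.im_local_domain B.im_local_domain by (intro conjI image_mono[OF BB_sub_AA])
qed

section \<open>Conditions that force B = A\<close>

lemma principal_closed_imp_eq:
  assumes cl: "\<And>a. a \<in> BB \<sigma> \<tau> \<Longrightarrow>
    \<forall>f\<in>BB \<sigma> \<tau>. (\<forall>n. \<exists>i\<in>{a * r | r. r \<in> BB \<sigma> \<tau>}. f - i \<in> ord_ge n) \<longrightarrow> f \<in> {a * r | r. r \<in> BB \<sigma> \<tau>}"
  shows "BB \<sigma> \<tau> = AA \<sigma> \<tau>"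
proof
  let ?B = "BB \<sigma> \<tau>"
  interpret B: local_stable_ring "?B" by (rule BB_local_stable)
  show "AA \<sigma> \<tau> \<subseteq> ?B"
  proof
    fix h assume "h \<in> AA \<sigma> \<tau>"
    then obtain g where g: "g \<in> UU \<sigma> \<tau>" "g \<noteq> 0" "g * h \<in> UU \<sigma> \<tau>" by (auto simp: AA_def frac_by_def)
    then have gB: "g \<in> ?B" "g * h \<in> ?B" using BB_sup by blast+
    \<comment> \<open>\<open>g * h\<close> is in the closure of the ideal generated by
      \<open>g\<close>, because \<open>B\<close> is dense in k[[x,y]] and \<open>h\<close> can be
      approximated in it; closedness then yields a quotient in \<open>B\<close>.\<close>
    have "\<exists>i\<in>{g * r | r. r \<in> ?B}. g * h - i \<in> ord_ge n" for n
    proof -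
      obtain r where r: "r \<in> ?B" "r - h \<in> ord_ge n" using B.nbhd_approx by blast
      have "g * h - g * r = g * (- (r - h))" by (simp add: algebra_simps)
      then have "g * h - g * r \<in> ord_ge n" using r(2) ord_ge_uminus ord_ge_mult_left by metis
      then show ?thesis using r(1) by blast
    qed
    then obtain r where "r \<in> ?B" "g * h = g * r" using cl[OF gB(1)] gB(2) by blast
    then show "h \<in> ?B" using g(2) by simp
  qed
qed (rule BB_sub_AA)

text \<open>For \<open>h \<in> A\<close> with denominator \<open>g \<in> B\<close>, the successive remainders \<open>h_i\<close> of the division of
  \<open>h\<close> by \<open>y\<close> all have denominator \<open>g\<close>. If the ideal of the \<open>g h_i\<close> is finitely generated, then
  some \<open>h_N\<close> is a combination of its predecessors, and these are congruent modulo \<open>B\<close> to multiples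
  of \<open>y h_N\<close>.\<close>

lemma noetherian_imp_eq:
  assumes noeth: "\<And>I. ideal_in I (BB \<sigma> \<tau>) \<Longrightarrow> \<exists>G\<subseteq>BB \<sigma> \<tau>. finite G \<and> I = gen_in (BB \<sigma> \<tau>) G"
  shows "BB \<sigma> \<tau> = AA \<sigma> \<tau>"
proof
  let ?U = "UU \<sigma> \<tau>"
  let ?B = "BB \<sigma> \<tau>"
  let ?A = "AA \<sigma> \<tau>"
  interpret A: saturated_ring "?A" by (rule AA_saturated)
  interpret B: local_stable_ring "?B" by (rule BB_local_stable)
  \<comment> \<open>Slices of \<open>A\<close> lie in \<open>B\<close>: after cancelling powers of y
    the slice of a denominator is nonzero, and after cancelling powers of x it has nonzero constant
    term.\<close>
  have slice_B: "fps_const (fps_nth h 0) \<in> ?B" if h: "h \<in> ?A" for h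
  proof -
    obtain g where g: "g \<in> ?U" "g \<noteq> 0" "g * h \<in> ?U"
      using h by (auto simp: AA_def frac_by_def)
    obtain n g' where g': "g = Yv ^ n * g'" "fps_nth g' 0 \<noteq> 0" using fps_Y_decompose[OF g(2)] by blast
    have U: "g' \<in> ?U" "g' * h \<in> ?U"
      using g g' UU_div_Y_power[of n] by (auto simp: mult.assoc)
    obtain m u where u: "fps_nth g' 0 = fps_X ^ m * u" "fps_nth u 0 \<noteq> 0"
      using fps_Y_decompose[OF g'(2)] by blast
    have "Xv ^ m * fps_const u \<in> ?U" using UU_slice[OF U(1)] u(1) by simp
    then have "fps_const u \<in> ?U" by (rule UU_div_X_power)
    moreover have "Xv ^ m * (fps_const u * fps_const (fps_nth h 0)) \<in> ?U"
      using UU_slice[OF U(2)] u(1) by (simp add: mult.assoc)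
    then have "fps_const u * fps_const (fps_nth h 0) \<in> ?U" by (rule UU_div_X_power)
    ultimately show ?thesis
      unfolding BB_def frac_by_def using u(2) by (auto intro!: bexI[of _ "fps_const u"])
  qed
  show "?A \<subseteq> ?B"
  proof
    fix h assume hA: "h \<in> ?A"
    then obtain g where g: "g \<in> ?U" "g \<noteq> 0" "g * h \<in> ?U" by (auto simp: AA_def frac_by_def)
    define H where "H n = (fps_shift 1 ^^ n) h" for n
    have HA: "H n \<in> ?A" for n
      by (induction n) (auto simp: H_def hA intro: A.shift_y[unfolded One_nat_def])
    have Hstep: "H n = fps_const (fps_nth (H n) 0) + Yv * H (Suc n)" for n
      using fps_decomp_shift[of "H n"] by (simp add: H_def)
    have gB: "g \<in> ?B" using g BB_sup by blast
    have gH: "g * H n \<in> ?B" for n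
    proof (induction n)
      case 0
      then show ?case using g BB_sup by (auto simp: H_def)
    next
      case (Suc n)
      have "Yv * (g * H (Suc n)) = g * H n - g * fps_const (fps_nth (H n) 0)"
        by (subst Hstep[of n]) (simp add: algebra_simps)
      then have "Yv * (g * H (Suc n)) \<in> ?B"
        using Suc gB slice_B[OF HA[of n]] by (simp add: B.ring closed_ring_diff closed_ring_mult)
      then have "fps_shift 1 (Yv * (g * H (Suc n))) \<in> ?B" by (rule B.shift_y)
      then show ?case by simp
    qed
    define K where "K n = gen_in ?B ((\<lambda>i. g * H i) ` {..<n})" for n
    have KG: "(\<lambda>i. g * H i) ` {..<n} \<subseteq> ?B" for n using gH by blast
    have KI: "ideal_in (K n) ?B" for n unfolding K_def by (rule gen_in_ideal[OF B.ring KG])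
    have Kmono: "K m \<subseteq> K n" if "m \<le> n" for m n
    proof -
      have "(\<lambda>i. g * H i) ` {..<m} \<subseteq> (\<lambda>i. g * H i) ` {..<n}" using that by auto
      then have "(\<lambda>i. g * H i) ` {..<m} \<subseteq> K n" using gen_in_incl unfolding K_def by blast
      then show ?thesis unfolding K_def[of m] by (rule gen_in_least[OF KI])
    qed
    have "ideal_in (\<Union>n. K n) ?B"
      unfolding ideal_in_def
    proof (intro conjI ballI)
      show "(\<Union>n. K n) \<subseteq> ?B" using ideal_in_sub[OF KI] by blast
      show "0 \<in> (\<Union>n. K n)" using ideal_in_zero[OF KI] by blast
      show "a + b \<in> (\<Union>n. K n)" if ab: "a \<in> (\<Union>n. K n)" "b \<in> (\<Union>n. K n)" for a b
      proof -
        obtain i j where "a \<in> K i" "b \<in> K j" using ab by blast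
        then have "a \<in> K (max i j)" "b \<in> K (max i j)" using Kmono[of i "max i j"] Kmono[of j "max i j"] by auto
        then show ?thesis using ideal_in_add[OF KI] by blast
      qed
      show "r * a \<in> (\<Union>n. K n)" if "r \<in> ?B" "a \<in> (\<Union>n. K n)" for r a
        using that ideal_in_mult[OF KI] by blast
    qed
    from noeth[OF this] obtain G where G: "finite G" "(\<Union>n. K n) = gen_in ?B G" by blast
    have "G \<subseteq> (\<Union>n. K n)" unfolding G(2) by (rule gen_in_incl)
    then obtain F where F: "\<And>x. x \<in> G \<Longrightarrow> x \<in> K (F x)" by (auto simp: subset_iff) metis
    define N where "N = Max (insert 0 (F ` G))"
    have "F x \<le> N" if "x \<in> G" for x using G(1) that by (simp add: N_def)
    then have "G \<subseteq> K N" using F Kmono by blast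
    then have "(\<Union>n. K n) \<subseteq> K N" unfolding G(2) by (rule gen_in_least[OF KI])
    moreover have "g * H N \<in> K (Suc N)" unfolding K_def
      by (rule subsetD[OF gen_in_incl], rule image_eqI[of _ _ N]) simp_all
    ultimately have gHN: "g * H N \<in> K N" by blast
    \<comment> \<open>Since all slices of the \<open>H i\<close> are in \<open>B\<close>,
      \<open>H i\<close> is an element of \<open>B\<close> plus a power of y times
      \<open>H N\<close>; at least one factor y is present because \<open>i < N\<close>.\<close>
    have Hi: "\<exists>b\<in>?B. \<exists>c\<in>?B. H i = b + Yv * c * H N" if "i < N" for i
      using that
    proof (induction "N - Suc i" arbitrary: i)
      case 0
      then have "N = Suc i" by simp
      then have "H i = fps_const (fps_nth (H i) 0) + Yv * 1 * H N" using Hstep[of i] by simp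
      then show ?case using slice_B[OF HA] closed_ring_one[OF B.ring] by blast
    next
      case (Suc m)
      have "m = N - Suc (Suc i)" "Suc i < N" using Suc.hyps(2) by linarith+
      from Suc.hyps(1)[OF this]
      obtain b c where bc: "b \<in> ?B" "c \<in> ?B" "H (Suc i) = b + Yv * c * H N" by blast
      have "H i = (fps_const (fps_nth (H i) 0) + Yv * b) + Yv * (Yv * c) * H N"
        by (subst Hstep, subst bc(3)) (simp add: algebra_simps)
      moreover have "fps_const (fps_nth (H i) 0) + Yv * b \<in> ?B" "Yv * c \<in> ?B"
        using bc slice_B[OF HA[of i]] B.Y_mem
        by (blast intro: closed_ring_add[OF B.ring] closed_ring_mult[OF B.ring])+
      ultimately show ?case by blast
    qed
    have "\<exists>b\<in>?B. \<exists>c\<in>?B. f = g * (b + Yv * c * H N)" if "f \<in> K N" for f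
    proof -
      let ?Q = "{f \<in> ?B. \<exists>b\<in>?B. \<exists>c\<in>?B. f = g * (b + Yv * c * H N)}"
      have "ideal_in ?Q ?B"
        unfolding ideal_in_def
      proof (intro conjI ballI)
        have "0 = g * (0 + Yv * 0 * H N)" by simp
        then show "0 \<in> ?Q" using closed_ring_zero[OF B.ring] by blast
      next
        fix a a' assume a: "a \<in> ?Q" "a' \<in> ?Q"
        then obtain b c b' c' where bc: "b \<in> ?B" "c \<in> ?B" "a = g * (b + Yv * c * H N)"
          "b' \<in> ?B" "c' \<in> ?B" "a' = g * (b' + Yv * c' * H N)" by blast
        then have "a + a' = g * ((b + b') + Yv * (c + c') * H N)" by (simp add: algebra_simps)
        then show "a + a' \<in> ?Q" using a bc closed_ring_add[OF B.ring] by blast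
      next
        fix r a assume a: "r \<in> ?B" "a \<in> ?Q"
        then obtain b c where bc: "b \<in> ?B" "c \<in> ?B" "a = g * (b + Yv * c * H N)" by blast
        then have "r * a = g * ((r * b) + Yv * (r * c) * H N)" by (simp add: algebra_simps)
        then show "r * a \<in> ?Q" using a bc closed_ring_mult[OF B.ring] by blast
      qed blast
      moreover have "(\<lambda>i. g * H i) ` {..<N} \<subseteq> ?Q" using Hi gH by force
      ultimately have "K N \<subseteq> ?Q" unfolding K_def by (rule gen_in_least)
      then show ?thesis using that by blast
    qed
    then obtain b c where bc: "b \<in> ?B" "c \<in> ?B" "g * H N = g * (b + Yv * c * H N)"
      using gHN by blast
    \<comment> \<open>The coefficient \<open>1 - Yv * c\<close> has constant term 1 and is a unit of
      \<open>B\<close>, so the relation can be solved for \<open>H N\<close>.\<close>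
    then have "H N = b + Yv * c * H N" using g(2) by simp
    then have eq: "(1 - Yv * c) * H N = b" by (simp add: algebra_simps)
    have "1 - Yv * c \<in> ?B" using bc B.Y_mem by (intro closed_ring_intros B.ring)
    then obtain v where v: "v \<in> ?B" "(1 - Yv * c) * v = 1" using B.inverse_ex by force
    have "H N = ((1 - Yv * c) * v) * H N" using v(2) by simp
    also have "\<dots> = v * ((1 - Yv * c) * H N)" by (simp only: ac_simps)
    finally have "H N = v * b" unfolding eq .
    then have HNB: "H N \<in> ?B" using closed_ring_mult[OF B.ring v(1) bc(1)] by simp
    have "H i \<in> ?B" if "i \<le> N" for i
      using that
    proof (induction i rule: inc_induct)
      case (step i)
      have "fps_const (fps_nth (H i) 0) + Yv * H (Suc i) \<in> ?B"
        using step slice_B[OF HA[of i]] B.Y_mem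
        by (blast intro: closed_ring_add[OF B.ring] closed_ring_mult[OF B.ring])
      then show ?case using Hstep[of i] by metis
    qed (rule HNB)
    then have "H 0 \<in> ?B" by blast
    then show "h \<in> ?B" by (simp add: H_def)
  qed
qed (rule BB_sub_AA)

section \<open>Algebraic independence and unique factorization of the rings\<close>

definition is_hom :: "('r::comm_ring_1 \<Rightarrow> 't::comm_ring_1) \<Rightarrow> bool" where
  "is_hom h \<longleftrightarrow> h 1 = 1 \<and> (\<forall>a b. h (a + b) = h a + h b) \<and> (\<forall>a b. h (a * b) = h a * h b)"

lemma is_homD:
  assumes "is_hom h"
  shows "h 1 = 1" "h (a + b) = h a + h b" "h (a * b) = h a * h b" "h 0 = 0"
proof -
  show "h 1 = 1" and add: "h (a + b) = h a + h b" and "h (a * b) = h a * h b" for a b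
    using assms by (auto simp: is_hom_def)
  show "h 0 = 0" using add[of 0 0] by simp
qed

text \<open>Coefficients are mapped by \<open>h\<close> first, so that evaluations can be nested:
  the result is again a homomorphism and plays the part of \<open>h\<close> for the next
  variable.\<close>

definition pev :: "('r::comm_ring_1 \<Rightarrow> 't::comm_ring_1) \<Rightarrow> 't \<Rightarrow> 'r poly \<Rightarrow> 't" where
  "pev h a p = poly (map_poly h p) a"

lemma pev_0 [simp]: "pev h a 0 = 0"
  by (simp add: pev_def)

lemma pev_pCons:
  assumes h: "is_hom h"
  shows "pev h a (pCons c p) = h c + a * pev h a p"
  using Polynomial.map_poly_pCons[of h c p] is_homD(4)[OF h] by (simp add: pev_def)

lemma pev_const: "is_hom h \<Longrightarrow> pev h a [:c:] = h c"
  by (simp add: pev_pCons)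

lemma pev_var:
  assumes h: "is_hom h"
  shows "pev h a [:0, 1:] = a"
  using pev_const[OF h, of a 1] by (simp add: pev_pCons[OF h] is_homD[OF h])

lemma pev_add:
  assumes h: "is_hom h"
  shows "pev h a (p + q) = pev h a p + pev h a q"
proof (induction p q rule: poly_induct2)
  case (pCons c p d q)
  then show ?case by (simp add: pev_pCons[OF h] is_homD(2)[OF h] algebra_simps)
qed simp

lemma pev_smult:
  assumes h: "is_hom h"
  shows "pev h a (smult c q) = h c * pev h a q"
  by (induction q) (simp_all add: pev_pCons[OF h] is_homD(3)[OF h] algebra_simps)

lemma pev_hom:
  assumes h: "is_hom h"
  shows "is_hom (pev h a)"
proof -
  have "pev h a (p * q) = pev h a p * pev h a q" for p q
    by (induction p)
      (simp_all add: mult_pCons_left pev_add[OF h] pev_smult[OF h] pev_pCons[OF h] is_homD[OF h] algebra_simps)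
  moreover have "pev h a 1 = 1" using pev_const[OF h, of a 1] by (simp add: is_homD[OF h])
  ultimately show ?thesis using pev_add[OF h] by (simp add: is_hom_def)
qed

lemma pev_mem:
  assumes h: "is_hom h" and R: "closed_ring R" "a \<in> R" "\<And>c. h c \<in> R"
  shows "pev h a p \<in> R"
  by (induction p) (auto simp: pev_pCons[OF h] R intro!: closed_ring_intros)

lemma pev_sum: "is_hom h \<Longrightarrow> pev h a (sum f I) = (\<Sum>i\<in>I. pev h a (f i))"
  by (induction I rule: infinite_finite_induct) (auto simp: pev_add)

lemma pev_monom: "is_hom h \<Longrightarrow> pev h a (monom c n) = h c * a ^ n"
  by (induction n) (auto simp: monom_0 monom_Suc pev_pCons is_homD algebra_simps)

lemma pev_comp:
  assumes h: "is_hom h" and g: "is_hom g"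
  shows "g (pev h a p) = pev (\<lambda>c. g (h c)) (g a) p"
proof -
  have gh: "is_hom (\<lambda>c. g (h c))" using h g by (simp add: is_hom_def)
  show ?thesis by (induction p) (simp_all add: pev_pCons[OF h] pev_pCons[OF gh] is_homD[OF g])
qed

lemma fps_of_poly_hom: "is_hom (fps_of_poly :: 'a::field poly \<Rightarrow> 'a fps)"
  by (simp add: is_hom_def fps_of_poly_add fps_of_poly_mult)

lemma fps_const_hom: "is_hom (fps_const :: 'b::comm_ring_1 \<Rightarrow> 'b fps)"
  by (simp add: is_hom_def)

lemma cc_hom: "is_hom (cc :: 'a::field \<Rightarrow> 'a fps fps)"
  by (simp add: is_hom_def)

text \<open>Algebraic independence over k[x] in place of k(x), so that coefficients are polynomials.
  The same condition, with the variable renamed, serves \<tau> over k[y].\<close>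

definition transc :: "'a::field fps \<Rightarrow> bool" where
  "transc s \<longleftrightarrow> (\<forall>p. pev fps_of_poly s p = 0 \<longrightarrow> p = 0)"

lemma eval_ring_of_type:
  fixes x :: "'a::field"
  shows "ring.eval ring_of_type_algebra [] x = 0"
    and "ring.eval ring_of_type_algebra (c # l) x = c * x ^ length l + ring.eval ring_of_type_algebra l x"
proof -
  interpret cring "ring_of_type_algebra :: 'a ring" by (rule cring_from_type_algebra)
  have pow: "y [^]\<^bsub>ring_of_type_algebra\<^esub> (n::nat) = y ^ n" for y :: 'a and n
    by (induction n) (auto simp: ring_of_type_simps nat_pow_0 nat_pow_Suc mult.commute)
  show "eval [] x = 0" by (simp add: ring_of_type_simps)
  show "eval (c # l) x = c * x ^ length l + eval l x" by (simp add: ring_of_type_simps pow)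
qed

lemma eval_ring_of_type_snoc:
  fixes x :: "'a::field"
  shows "ring.eval ring_of_type_algebra (l @ [c]) x = x * ring.eval ring_of_type_algebra l x + c"
  by (induction l) (simp_all add: eval_ring_of_type algebra_simps)

text \<open>\<open>h\<close> stands for \<open>in_x\<close> or \<open>in_y\<close>. A relation with
  polynomial coefficients is a special relation over the adjoined field, which transcendence
  excludes.\<close>

lemma transcendental_transc:
  fixes s :: "'a::field fps" and h :: "'a fps \<Rightarrow> 'a fps fps fract"
  assumes h: "is_hom h" and inj: "\<And>f. h f = 0 \<Longrightarrow> f = 0" and const: "\<And>c. h (fps_const c) = to_fract (cc c)"
    and tr: "ring.transcendental ring_of_type_algebra (adjoin_field {h fps_X}) (h s)"
  shows "transc s"
  unfolding transc_def
proof (intro allI impI)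
  fix p :: "'a poly poly" assume p0: "pev fps_of_poly s p = 0"
  interpret cring "ring_of_type_algebra :: 'a fps fps fract ring" by (rule cring_from_type_algebra)
  let ?K = "adjoin_field {h fps_X}"
  \<comment> \<open>Univariate polynomials of the algebra library are coefficient lists with the
    leading coefficient first, while \<open>coeffs\<close> begins with the constant one; hence
    \<open>rev\<close>.\<close>
  define L where "L q = rev (map (\<lambda>c. h (fps_of_poly c)) (coeffs q))" for q :: "'a poly poly"
  have mem: "h (fps_of_poly q) \<in> ?K" for q
  proof (induction q)
    case 0
    have "(0 :: 'a fps fps fract) = to_fract (cc 0)" by simp
    then show ?case using adjoin_field_const[of 0 "{h fps_X}"] is_homD(4)[OF h] by simp
  next
    case (pCons c q)
    have "h (fps_of_poly (pCons c q)) = to_fract (cc c) + h (fps_of_poly q) * h fps_X"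
      by (simp add: fps_of_poly_pCons is_homD[OF h] const)
    then show ?case
      using adjoin_field_add[OF adjoin_field_const adjoin_field_mult[OF pCons(2) adjoin_field_incl]] by simp
  qed
  have eval: "eval (L q) (h s) = h (pev fps_of_poly s q)" for q
  proof (induction q)
    case 0
    then show ?case by (simp add: L_def ring_of_type_simps is_homD(4)[OF h])
  next
    case (pCons c q)
    then have "L (pCons c q) = L q @ [h (fps_of_poly c)]" by (auto simp: L_def cCons_def)
    then show ?case using pCons
      by (simp add: eval_ring_of_type_snoc pev_pCons[OF fps_of_poly_hom] is_homD[OF h] algebra_simps)
  qed
  show "p = 0"
  proof (rule ccontr)
    assume p: "p \<noteq> 0"
    then have ne: "coeffs p \<noteq> []" by simp
    have "hd (L p) = h (fps_of_poly (last (coeffs p)))"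
      using ne by (simp add: L_def hd_rev last_map)
    moreover have "fps_of_poly (last (coeffs p)) \<noteq> 0"
      using p by (simp add: last_coeffs_eq_coeff_degree)
    ultimately have "hd (L p) \<noteq> 0" using inj by metis
    then have "L p \<in> carrier (univ_poly ring_of_type_algebra ?K)"
      using mem by (auto simp: univ_poly_def polynomial_def L_def ring_of_type_simps)
    moreover have "[] \<in> carrier (univ_poly ring_of_type_algebra ?K)"
      by (simp add: univ_poly_def polynomial_def)
    moreover have "eval (L p) (h s) = eval [] (h s)"
      using eval[of p] p0 by (simp add: ring_of_type_simps is_homD(4)[OF h])
    ultimately have "L p = []" using tr unfolding transcendental_def inj_on_def by blast
    then show False using ne by (simp add: L_def)
  qed
qed

lemma transc_x:
  assumes "ring.transcendental ring_of_type_algebra (adjoin_field {x_var}) (in_x s)"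
  shows "transc s"
  using assms by (intro transcendental_transc[of in_x]) (auto simp: in_x_def is_hom_def simp flip: fps_const_add fps_const_mult)

lemma transc_y:
  assumes "ring.transcendental ring_of_type_algebra (adjoin_field {y_var}) (in_y s)"
  shows "transc s"
proof (rule transcendental_transc[of in_y])
  show "is_hom in_y"
    using yc_const[of 1] by (simp add: is_hom_def in_y_yc yc_add yc_mult)
  show "f = 0" if "in_y f = 0" for f :: "'a fps"
  proof (rule fps_ext)
    fix n
    have "yc f = 0" using that by (simp add: in_y_yc)
    then have "cf (yc f) n 0 = 0" by simp
    then show "fps_nth f n = fps_nth 0 n" by simp
  qed
qed (use assms in \<open>simp_all add: in_y_yc yc_const\<close>)

lemma prime_elem_prime_el:
  fixes p :: "'b::idom"
  assumes "prime_elem p"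
  shows "prime_el UNIV p"
proof -
  have "\<nexists>v. p * v = 1" using assms unfolding prime_elem_def dvd_def by metis
  then show ?thesis
    using assms unfolding prime_el_def prime_elem_def dvd_in_def unit_in_def dvd_def by simp
qed

lemma ufd_in_UNIV: "ufd_in (UNIV :: 'b::ufd set)"
  unfolding ufd_in_def
proof (intro conjI ballI impI)
  show R: "closed_ring (UNIV :: 'b set)" by (simp add: closed_ring_def)
  fix f :: 'b assume f: "f \<noteq> 0"
  show "prime_prod UNIV f"
  proof (cases "f dvd 1")
    case True
    then show ?thesis by (intro prime_prod.unit) (auto simp: unit_in_def dvd_def)
  next
    case False
    then obtain F where F: "mset_factors F f" using f mset_factors_exist by blast
    have "(\<And>x. x \<in># F \<Longrightarrow> prime_elem x) \<Longrightarrow> prime_prod UNIV (prod_mset F)" for F :: "'b multiset"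
    proof (induction F)
      case empty
      then show ?case using unit_in_one[OF R] by (simp add: prime_prod.unit)
    next
      case (add x F)
      have "prime_elem x" "prime_prod UNIV (prod_mset F)" using add by auto
      then show ?case using prime_prod.step[OF prime_elem_prime_el, of x] by simp
    qed
    then show ?thesis using mset_factorsD[OF F] prime_elem_iff_irreducible by metis
  qed
qed

text \<open>The coefficient of x^i, a series in y. It cuts across the nesting k[[x]][[y]]; it is
  additive and by \<open>xslice_yc_mult\<close> commutes with multiplication by series in y.\<close>

definition xslice :: "nat \<Rightarrow> 'a::field fps fps \<Rightarrow> 'a fps" where
  "xslice i f = Abs_fps (\<lambda>j. cf f j i)"

lemma xslice_add: "xslice i (f + g) = xslice i f + xslice i g"
  by (rule fps_ext) (simp add: xslice_def)

lemma xslice_yc_mult: "xslice i (yc g * f) = g * xslice i f"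
proof (rule fps_ext)
  fix j
  have yc_nth: "fps_nth (yc g) l = fps_const (fps_nth g l)" for l by (simp add: yc_def)
  have "cf (yc g * f) j i = (\<Sum>l=0..j. fps_nth g l * cf f (j - l) i)"
    unfolding fps_mult_nth[of "yc g" f j] fps_sum_nth yc_nth by simp
  then show "fps_nth (xslice i (yc g * f)) j = fps_nth (g * xslice i f) j"
    by (simp add: xslice_def fps_mult_nth)
qed

section \<open>Divisibility by x and y in U\<close>

lemma sw_UU_image: "sw ` UU \<sigma> \<tau> = UU \<tau> \<sigma>"
proof
  show "sw ` UU \<sigma> \<tau> \<subseteq> UU \<tau> \<sigma>" using sw_UU by blast
  show "UU \<tau> \<sigma> \<subseteq> sw ` UU \<sigma> \<tau>" using sw_UU by (metis image_eqI subsetI sw_sw)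
qed

lemma dvd_in_sw: "dvd_in (UU \<tau> \<sigma>) (sw a) (sw b) \<longleftrightarrow> dvd_in (UU \<sigma> \<tau>) a b"
  using dom_emb.im_dvd_in[OF dom_emb_sw, of "UU \<sigma> \<tau>" a b] by (simp add: sw_UU_image)

text \<open>\<open>p\<close> has no factor y, so in \<open>Yv * k = p * c\<close> it is the cofactor
  \<open>c\<close> that vanishes at y = 0 and absorbs the y.\<close>

lemma UU_dvd_Y_cancel:
  assumes p: "fps_nth p 0 \<noteq> 0" and d: "dvd_in (UU \<sigma> \<tau>) p (Yv * k)"
  shows "dvd_in (UU \<sigma> \<tau>) p k"
proof -
  obtain c where c: "c \<in> UU \<sigma> \<tau>" "Yv * k = p * c" using d by (auto simp: dvd_in_def)
  have "fps_nth p 0 * fps_nth c 0 = fps_nth (Yv * k) 0" unfolding c(2) by simp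
  then have "fps_nth c 0 = 0" using p by simp
  then have e: "c = Yv * fps_shift 1 c" by (rule fps2_X_divisible)
  then have "Yv * k = Yv * (p * fps_shift 1 c)" using c(2) by (metis mult.left_commute)
  then have "k = p * fps_shift 1 c" by simp
  then show ?thesis using UU_shift_y[OF c(1)] by (auto simp: dvd_in_def)
qed

lemma Y_prime_el: "prime_el (UU \<sigma> \<tau>) Yv"
  unfolding prime_el_def
proof (intro conjI ballI impI)
  show "\<not> unit_in (UU \<sigma> \<tau>) Yv"
    by (auto simp: unit_in_def dest: arg_cong[where f = "\<lambda>f. fps_nth f 0"])
  fix a b assume a: "a \<in> UU \<sigma> \<tau>" "b \<in> UU \<sigma> \<tau>" and "dvd_in (UU \<sigma> \<tau>) Yv (a * b)"
  then obtain c where "a * b = Yv * c" by (auto simp: dvd_in_def)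
  then have "fps_nth a 0 * fps_nth b 0 = 0" by (metis fps_mult_nth_0 fps_X_nth zero_neq_one mult_zero_left)
  then have "fps_nth a 0 = 0 \<or> fps_nth b 0 = 0" by simp
  then show "dvd_in (UU \<sigma> \<tau>) Yv a \<or> dvd_in (UU \<sigma> \<tau>) Yv b"
    using fps2_X_divisible UU_shift_y a unfolding dvd_in_def by metis
qed (auto simp: UU_Y)

text \<open>x^n alone would clear \<sigma>_n. The symmetric (xy)^n clears the endpieces of \<tau> as
  well and is fixed by \<open>sw\<close>, so one exponent serves all generators of a level.\<close>

lemma endpiece_clear: "(Xv * Yv) ^ n * fps_const (endpiece n \<sigma>) \<in> Ulev \<sigma> \<tau> 0"
  for \<sigma> \<tau> :: "'a::field fps"
proof (induction n)
  case 0
  then show ?case by (auto simp: Ug_def intro!: gincl)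
next
  let ?m = "Xv * Yv :: 'a fps fps"
  case (Suc n)
  have XY: "Xv \<in> Ulev \<sigma> \<tau> 0" "Yv \<in> Ulev \<sigma> \<tau> 0" by (auto simp: Ug_def intro!: gincl)
  have aux: "(x * y * m) * d = y * (m * (x * (c + d))) - (x * y * m) * c" for x y m c d :: "'a fps fps"
    by (simp add: algebra_simps)
  have "fps_const (endpiece n \<sigma>) = Xv * (cc (fps_nth \<sigma> (Suc n)) + fps_const (endpiece (Suc n) \<sigma>))"
    by (subst endpiece_rec) simp
  then have "?m ^ Suc n * fps_const (endpiece (Suc n) \<sigma>) =
    Yv * (?m ^ n * fps_const (endpiece n \<sigma>)) - ?m ^ Suc n * cc (fps_nth \<sigma> (Suc n))"
    by (simp only: power_Suc aux)
  moreover have "Yv * (?m ^ n * fps_const (endpiece n \<sigma>)) - ?m ^ Suc n * cc (fps_nth \<sigma> (Suc n)) \<in> Ulev \<sigma> \<tau> 0"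
    by (intro gdiff gmult closed_ring_power gring_closed XY Suc gconst)
  ultimately show ?case by (simp only:)
qed

lemma UU_clear:
  fixes \<sigma> \<tau> :: "'a::field fps"
  assumes "f \<in> UU \<sigma> \<tau>"
  shows "\<exists>k. (Xv * Yv) ^ k * f \<in> Ulev \<sigma> \<tau> 0"
proof -
  let ?L = "Ulev \<sigma> \<tau> 0"
  note R = gring_closed[of "Ug \<sigma> \<tau> 0"]
  let ?m = "Xv * Yv :: 'a fps fps"
  have XY: "Xv \<in> ?L" "Yv \<in> ?L" by (auto simp: Ug_def intro!: gincl)
  then have m: "?m ^ k \<in> ?L" for k using R by (intro closed_ring_intros)
  have mono: "?m ^ l * f \<in> ?L" if "?m ^ k * f \<in> ?L" "k \<le> l" for k l f
  proof -
    have "?m ^ l * f = ?m ^ (l - k) * (?m ^ k * f)"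
      using that(2) by (simp add: mult.assoc[symmetric] power_add[symmetric])
    then show ?thesis using closed_ring_mult[OF R m that(1)] by metis
  qed
  have X: "?m ^ n * fps_const (endpiece n \<sigma>) \<in> ?L" for n by (rule endpiece_clear)
  have Y: "?m ^ n * yc (endpiece n \<tau>) \<in> ?L" for n
  proof -
    have "sw ?m = ?m" by (simp add: sw_mult yc_X mult.commute)
    then have "?m ^ n * yc (endpiece n \<tau>) = sw (?m ^ n * fps_const (endpiece n \<tau>))"
      by (simp add: sw_mult sw_power)
    then show ?thesis using sw_Ulev[OF endpiece_clear[of n \<tau> \<sigma>]] by simp
  qed
  obtain n where "f \<in> Ulev \<sigma> \<tau> n" using assms UU_iff by blast
  then show ?thesis
  proof induction
    case (gconst c)
    then show ?case by (intro exI[of _ 0]) (simp add: gring.gconst)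
  next
    case (gincl g)
    then consider "g = Xv" | "g = Yv" | "g = fps_const (endpiece n \<sigma>)" | "g = yc (endpiece n \<tau>)"
      by (auto simp: Ug_def)
    then show ?case
    proof cases
      case 1
      then show ?thesis using XY by (intro exI[of _ 0]) simp
    next
      case 2
      then show ?thesis using XY by (intro exI[of _ 0]) simp
    next
      case 3
      then show ?thesis using X by blast
    next
      case 4
      then show ?thesis using Y by blast
    qed
  next
    case (gdiff f g)
    then obtain k l where kl: "?m ^ k * f \<in> ?L" "?m ^ l * g \<in> ?L" by blast
    have "?m ^ (k + l) * f - ?m ^ (k + l) * g \<in> ?L"
      by (intro gring.gdiff mono[OF kl(1)] mono[OF kl(2)]) simp_all
    then show ?case by (metis right_diff_distrib)
  next
    case (gmult f g)
    then obtain k l where kl: "?m ^ k * f \<in> ?L" "?m ^ l * g \<in> ?L" by blast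
    have "?m ^ (k + l) * (f * g) = (?m ^ k * f) * (?m ^ l * g)" unfolding power_add by (simp only: ac_simps)
    then show ?case using gring.gmult[OF kl] by metis
  qed
qed

section \<open>The polynomial ring k[x,y,\<sigma>,\<tau>] and factoriality\<close>

context
  fixes \<sigma> \<tau> :: "'a::field fps"
begin

text \<open>The variables are adjoined in the order x, \<sigma>, y, \<tau>, innermost first. Thus
  \<open>ev2\<close> gives series in x alone, \<open>ev3\<close> polynomials in y over them, and a
  relation for \<open>ev4\<close> is one for \<tau>.\<close>

definition ev1 :: "'a poly \<Rightarrow> 'a fps fps" where "ev1 = pev cc Xv"
definition ev2 :: "'a poly poly \<Rightarrow> 'a fps fps" where "ev2 = pev ev1 (fps_const \<sigma>)"
definition ev3 :: "'a poly poly poly \<Rightarrow> 'a fps fps" where "ev3 = pev ev2 Yv"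
definition ev4 :: "'a poly poly poly poly \<Rightarrow> 'a fps fps" where "ev4 = pev ev3 (yc \<tau>)"

lemma ev_hom: "is_hom ev1" "is_hom ev2" "is_hom ev3" "is_hom ev4"
proof -
  show 1: "is_hom ev1" unfolding ev1_def by (intro pev_hom cc_hom)
  show 2: "is_hom ev2" unfolding ev2_def by (intro pev_hom 1)
  show 3: "is_hom ev3" unfolding ev3_def by (intro pev_hom 2)
  show "is_hom ev4" unfolding ev4_def by (intro pev_hom 3)
qed

lemma ev1_eq: "ev1 p = fps_const (fps_of_poly p)"
  unfolding ev1_def
proof (induction p)
  case (pCons c p)
  then show ?case by (simp add: pev_pCons[OF cc_hom] fps_of_poly_pCons mult.commute)
qed simp

lemma ev2_eq: "ev2 p = fps_const (pev fps_of_poly \<sigma> p)"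
  unfolding ev2_def ev1_eq[abs_def] by (rule pev_comp[OF fps_of_poly_hom fps_const_hom, symmetric])

lemma ev3_nth: "fps_nth (ev3 p) j = fps_nth (ev2 (coeff p j)) 0"
  unfolding ev3_def
proof (induction p arbitrary: j)
  case 0
  then show ?case by (simp add: is_homD[OF ev_hom(2)])
next
  case (pCons c p)
  have e: "pev ev2 Yv (pCons c p) = ev2 c + Yv * pev ev2 Yv p" by (rule pev_pCons[OF ev_hom(2)])
  have "fps_nth (ev2 c) (Suc k) = 0" for k by (simp add: ev2_eq)
  then show ?case by (cases j) (simp_all add: e pCons(2))
qed

text \<open>\<open>ev3 p\<close> is a polynomial in y whose coefficients are series in x. Taking the
  coefficient of x^i in each of them leaves a polynomial in y over k, a legitimate coefficient for a
  relation satisfied by \<tau>.\<close>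

definition ypart :: "nat \<Rightarrow> 'a poly poly poly \<Rightarrow> 'a poly" where
  "ypart i p = map_poly (\<lambda>c. cf (ev2 c) 0 i) p"

lemma coeff_ypart: "coeff (ypart i p) j = cf (ev3 p) j i"
  by (simp add: ypart_def coeff_map_poly is_homD[OF ev_hom(2)] ev3_nth)

lemma xslice_ev3: "xslice i (ev3 p) = fps_of_poly (ypart i p)"
  by (rule fps_ext) (simp add: xslice_def coeff_ypart)

lemma xslice_ev4: "xslice i (ev4 q) = pev fps_of_poly \<tau> (map_poly (ypart i) q)"
  unfolding ev4_def
proof (induction q)
  case 0
  then show ?case by (simp add: xslice_def fps_eq_iff)
next
  case (pCons c q)
  have "ypart i 0 = 0" by (simp add: ypart_def)
  then show ?case using pCons
    by (simp add: pev_pCons[OF ev_hom(3)] pev_pCons[OF fps_of_poly_hom] map_poly_pCons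
        xslice_add xslice_yc_mult xslice_ev3)
qed

context
  assumes st: "fps_nth \<sigma> 0 = 0" "fps_nth \<tau> 0 = 0" and tr: "transc \<sigma>" "transc \<tau>"
begin

lemma ev2_inj: "fps_nth (ev2 p) 0 = 0 \<Longrightarrow> p = 0"
  using tr(1) by (simp add: ev2_eq transc_def)

text \<open>The coefficient of each x^i turns a relation into one for \<tau> over k[y], which is
  trivial. Hence each coefficient of the relation has value 0 under \<open>ev3\<close>, and
  comparing powers of y leaves relations for \<sigma> over k[x].\<close>

lemma ev4_inj: "ev4 q = 0 \<Longrightarrow> q = 0"
proof (rule poly_eqI)
  fix l
  assume q: "ev4 q = 0"
  have y0: "ypart i 0 = 0" for i by (simp add: ypart_def)
  have "map_poly (ypart i) q = 0" for i
    using tr(2) xslice_ev4[of i q] q unfolding transc_def by (simp add: xslice_def fps_eq_iff)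
  then have "ypart i (coeff q l) = 0" for i using coeff_map_poly[of "ypart i" q l, OF y0] by simp
  then have "cf (ev3 (coeff q l)) j i = 0" for i j using coeff_ypart[of i "coeff q l" j] by simp
  then have "fps_nth (ev3 (coeff q l)) j = 0" for j by (intro fps_ext) simp
  then have "fps_nth (ev2 (coeff (coeff q l) j)) 0 = 0" for j using ev3_nth[of "coeff q l" j] by simp
  then have "coeff (coeff q l) j = 0" for j using ev2_inj by blast
  then show "coeff q l = coeff 0 l" by (intro poly_eqI) simp
qed

lemma range_ev4: "range ev4 = Ulev \<sigma> \<tau> 0"
proof
  let ?L = "Ulev \<sigma> \<tau> 0"
  have s0: "fps_const \<sigma> \<in> ?L" "yc \<tau> \<in> ?L" using UU_sigma_tau[OF st] .
  have XY: "Xv \<in> ?L" "Yv \<in> ?L" by (auto simp: Ug_def intro!: gincl)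
  have 1: "ev1 c \<in> ?L" for c
    unfolding ev1_def using gring_closed XY(1) gconst by (rule pev_mem[OF cc_hom])
  have 2: "ev2 c \<in> ?L" for c
    unfolding ev2_def using gring_closed s0(1) 1 by (rule pev_mem[OF ev_hom(1)])
  have 3: "ev3 c \<in> ?L" for c
    unfolding ev3_def using gring_closed XY(2) 2 by (rule pev_mem[OF ev_hom(2)])
  have 4: "ev4 c \<in> ?L" for c
    unfolding ev4_def using gring_closed s0(2) 3 by (rule pev_mem[OF ev_hom(3)])
  show "range ev4 \<subseteq> ?L" using 4 by blast
  have c3: "ev4 [:c:] = ev3 c" for c unfolding ev4_def by (rule pev_const[OF ev_hom(3)])
  have c2: "ev3 [:c:] = ev2 c" for c unfolding ev3_def by (rule pev_const[OF ev_hom(2)])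
  have c1: "ev2 [:c:] = ev1 c" for c unfolding ev2_def by (rule pev_const[OF ev_hom(1)])
  have c0: "ev1 [:c:] = cc c" for c unfolding ev1_def by (rule pev_const[OF cc_hom])
  have "ev4 [:[:[:[:0, 1:]:]:]:] = Xv"
    unfolding c1 c2 c3 unfolding ev1_def by (rule pev_var[OF cc_hom])
  moreover have "ev4 [:[:[:0, 1:]:]:] = fps_const \<sigma>"
    unfolding c2 c3 unfolding ev2_def by (rule pev_var[OF ev_hom(1)])
  moreover have "ev4 [:[:0, 1:]:] = Yv"
    unfolding c3 unfolding ev3_def by (rule pev_var[OF ev_hom(2)])
  moreover have "ev4 [:0, 1:] = yc \<tau>"
    unfolding ev4_def by (rule pev_var[OF ev_hom(3)])
  ultimately have "Ug \<sigma> \<tau> 0 \<subseteq> range ev4"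
    unfolding Ug_def endpiece_0[OF st(1)] endpiece_0[OF st(2)] by (metis empty_subsetI insert_subset rangeI)
  moreover have "cc c \<in> range ev4" for c using c0 c1 c2 c3 by (metis rangeI)
  moreover have "closed_ring (range ev4)"
  proof -
    have "ev4 (a - b) = ev4 a - ev4 b" for a b
      using is_homD(2)[OF ev_hom(4), of "a - b" b] by simp
    then show ?thesis
      unfolding closed_ring_def using is_homD(1,3)[OF ev_hom(4)] by (auto simp: image_iff) metis+
  qed
  ultimately show "?L \<subseteq> range ev4" using gring_subset[of "range ev4"] by blast
qed

text \<open>By Gauss's lemma, applied through the type class, the fourfold polynomial ring is
  factorial; \<open>ev4\<close> identifies it with k[x,y,\<sigma>,\<tau>].\<close>

lemma ufd_Ulev_0: "ufd_in (Ulev \<sigma> \<tau> 0)"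
proof -
  interpret dom_emb ev4
  proof
    show "ev4 1 = 1" "ev4 (a + b) = ev4 a + ev4 b" "ev4 (a * b) = ev4 a * ev4 b" for a b
      using is_homD[OF ev_hom(4)] by auto
    have "ev4 a = ev4 b \<Longrightarrow> ev4 (a - b) = 0" for a b
      using is_homD(2)[OF ev_hom(4), of "a - b" b] by simp
    then show "ev4 a = ev4 b \<longleftrightarrow> a = b" for a b using ev4_inj[of "a - b"] by auto
  qed
  show ?thesis using im_ufd_in[OF ufd_in_UNIV] by (simp add: range_ev4)
qed

lemma ufd_UU: "ufd_in (UU \<sigma> \<tau>)"
proof -
  let ?dvd = "dvd_in (UU \<sigma> \<tau>)"
  let ?L = "Ulev \<sigma> \<tau> 0"
  let ?U = "UU \<sigma> \<tau>"
  define M where "M = {Xv ^ i * Yv ^ j :: 'a fps fps | i j. True}"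
  note U = UU_closed[of \<sigma> \<tau>]
  have Y_red: "?dvd p k" if "fps_nth p 0 \<noteq> 0" "?dvd p (Yv * k)" for p k
    using that by (rule UU_dvd_Y_cancel)
  have X_red: "?dvd p k" if "fps_nth (sw p) 0 \<noteq> 0" "?dvd p (Xv * k)" for p k
  proof -
    have "dvd_in (UU \<tau> \<sigma>) (sw p) (Yv * sw k)" using that(2) dvd_in_sw[where \<sigma> = \<sigma> and \<tau> = \<tau> and a = p and b = "Xv * k"]
      by (simp add: sw_mult yc_X)
    with that(1) have "dvd_in (UU \<tau> \<sigma>) (sw p) (sw k)" by (rule UU_dvd_Y_cancel)
    then show ?thesis using dvd_in_sw[where \<sigma> = \<sigma> and \<tau> = \<tau> and a = p and b = k] by simp
  qed
  have Y_prime: "prime_el ?U Yv" by (rule Y_prime_el)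
  have X_prime: "prime_el ?U Xv" using dom_emb.im_prime_el[OF dom_emb_sw Y_prime_el[of \<tau> \<sigma>]] by (simp add: sw_UU_image)
  have pp_power: "prime_prod ?U (p ^ n)" if "prime_el ?U p" for p n
    by (induction n) (auto intro: prime_prod.step[OF that] prime_prod.unit unit_in_one[OF U])
  show ?thesis
  proof (rule ufd_in_transfer[OF U _ ufd_Ulev_0, of M])
    show "?L \<subseteq> ?U" using UU_iff by blast
    have "Xv \<in> ?L" "Yv \<in> ?L" by (auto simp: Ug_def intro!: gincl)
    then have "Xv ^ i * Yv ^ j \<in> ?L" for i j
      using gring_closed[of "Ug \<sigma> \<tau> 0"] by (intro closed_ring_mult closed_ring_power)
    then show "M \<subseteq> ?L" unfolding M_def by blast
    have "(1 :: 'a fps fps) = Xv ^ 0 * Yv ^ 0" by simp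
    then show "1 \<in> M" unfolding M_def by blast
    show "0 \<notin> M" unfolding M_def by auto
    show "m * m' \<in> M" if mm: "m \<in> M" "m' \<in> M" for m m'
    proof -
      obtain i j i' j' where "m = Xv ^ i * Yv ^ j" "m' = Xv ^ i' * Yv ^ j'" using mm unfolding M_def by blast
      then have "m * m' = Xv ^ (i + i') * Yv ^ (j + j')" unfolding power_add by (simp only: ac_simps)
      then show ?thesis unfolding M_def by blast
    qed
    show "\<exists>m\<in>M. m * e \<in> ?L" if e: "e \<in> ?U" for e
    proof -
      obtain k where "(Xv * Yv) ^ k * e \<in> ?L" using UU_clear[OF e] by blast
      then show ?thesis unfolding M_def power_mult_distrib by blast
    qed
    show "prime_prod ?U m" if m: "m \<in> M" for m
      using m prime_prod_mult[OF U pp_power[OF X_prime] pp_power[OF Y_prime]] unfolding M_def by blast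
    show "\<exists>m\<in>M. \<exists>e'. e = m * e' \<and> e' \<in> ?U \<and> e' \<noteq> 0 \<and>
        (\<forall>m\<in>M. \<forall>k\<in>?U. ?dvd e' (m * k) \<longrightarrow> ?dvd e' k)"
      if e: "e \<in> ?U" "e \<noteq> 0" for e
    proof -
      \<comment> \<open>\<open>e\<close> is freed first from y and then, after the exchange, from x.
        The rest \<open>e'\<close> is nonzero both at y = 0 and at x = 0, so x and y can be
        cancelled from any multiple of \<open>e'\<close> without losing divisibility.\<close>
      obtain j e1 where e1: "e = Yv ^ j * e1" "fps_nth e1 0 \<noteq> 0" using fps_Y_decompose[OF e(2)] by blast
      then have "sw e1 \<noteq> 0" by auto
      then obtain i e2 where e2: "sw e1 = Yv ^ i * e2" "fps_nth e2 0 \<noteq> 0" using fps_Y_decompose by blast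
      define e' where "e' = sw e2"
      have e1': "e1 = Xv ^ i * e'" unfolding e'_def by (metis e2(1) sw_mult sw_power sw_sw sw_Yv)
      have "e' \<in> ?U" using e(1) e1(1) e1' UU_div_X_power UU_div_Y_power by metis
      moreover have "e = (Xv ^ i * Yv ^ j) * e'" unfolding e1 e1' by (simp only: ac_simps)
      moreover have nz: "fps_nth e' 0 \<noteq> 0" "fps_nth (sw e') 0 \<noteq> 0"
        using e1(2) e2(2) unfolding e1' by (auto simp: e'_def)
      moreover have "?dvd e' k" if "?dvd e' (Xv ^ a * Yv ^ b * k)" for a b k
      proof -
        have "?dvd e' (Yv ^ b * k)"
          using that by (induction a) (auto simp: mult.assoc simp del: fps_const_power dest: X_red[OF nz(2)])
        then show ?thesis by (induction b) (auto simp: mult.assoc dest: Y_red[OF nz(1)])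
      qed
      moreover have "e' \<noteq> 0" using nz by auto
      ultimately show ?thesis unfolding M_def by blast
    qed
  qed
qed

lemma ufd_BB: "ufd_in (BB \<sigma> \<tau>)"
proof -
  let ?dvd = "dvd_in (BB \<sigma> \<tau>)"
  let ?B = "BB \<sigma> \<tau>"
  interpret B: local_stable_ring "?B" by (rule BB_local_stable)
  define M where "M = {g \<in> UU \<sigma> \<tau>. cf g 0 0 \<noteq> 0}"
  have unit: "\<exists>v\<in>?B. m * v = 1" if "m \<in> M" for m
    using that B.inverse_ex BB_sup unfolding M_def by blast
  show ?thesis
  proof (rule ufd_in_transfer[OF B.ring BB_sup ufd_UU, of M])
    show "M \<subseteq> UU \<sigma> \<tau>" "0 \<notin> M" unfolding M_def by auto
    show "1 \<in> M" unfolding M_def using closed_ring_one[OF UU_closed] by auto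
    show "m * m' \<in> M" if "m \<in> M" "m' \<in> M" for m m'
      using that closed_ring_mult[OF UU_closed, of m \<sigma> \<tau> m'] unfolding M_def by simp
    show "\<exists>m\<in>M. m * e \<in> UU \<sigma> \<tau>" if "e \<in> ?B" for e
      using that unfolding BB_def frac_by_def M_def by blast
    show "prime_prod ?B m" if "m \<in> M" for m
    proof (rule prime_prod.unit)
      show "unit_in ?B m" using unit[OF that] that BB_sup unfolding unit_in_def M_def by blast
    qed
    \<comment> \<open>Elements of \<open>M\<close> are units of \<open>B\<close>, so nothing has to
      be split off: \<open>1\<close> and \<open>e\<close> itself are the witnesses.\<close>
    show "\<exists>m\<in>M. \<exists>e'. e = m * e' \<and> e' \<in> ?B \<and> e' \<noteq> 0 \<and>
        (\<forall>m\<in>M. \<forall>k\<in>?B. ?dvd e' (m * k) \<longrightarrow> ?dvd e' k)"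
      if e: "e \<in> ?B" "e \<noteq> 0" for e
    proof (intro bexI[of _ 1] exI[of _ e] conjI ballI impI)
      show "1 \<in> M" unfolding M_def using closed_ring_one[OF UU_closed] by auto
      fix m k assume m: "m \<in> M" and "?dvd e (m * k)"
      then obtain c where c: "c \<in> ?B" "m * k = e * c" by (auto simp: dvd_in_def)
      obtain v where v: "v \<in> ?B" "m * v = 1" using unit[OF m] by blast
      have "k = (m * v) * k" using v(2) by simp
      also have "\<dots> = v * (m * k)" by (simp only: ac_simps)
      also have "\<dots> = e * (v * c)" unfolding c(2) by (simp only: ac_simps)
      finally show "?dvd e k" using closed_ring_mult[OF B.ring v(1) c(1)] unfolding dvd_in_def by blast
    qed (use e in auto)
  qed
qed

end

end

section \<open>The dimension of B\<close>

text \<open>Linear independence over k in the quotient by \<open>Q\<close>, for an indexed family: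
  equal members at different indices count as a dependence, as the counting argument
  requires.\<close>

definition indep_mod :: "'a::field fps fps set \<Rightarrow> ('i \<Rightarrow> 'a fps fps) \<Rightarrow> 'i set \<Rightarrow> bool" where
  "indep_mod Q m I \<longleftrightarrow> (\<forall>c. (\<Sum>i\<in>I. cc (c i) * m i) \<in> Q \<longrightarrow> (\<forall>i\<in>I. c i = 0))"

text \<open>Passing from a prime to a strictly smaller one makes any element of the difference
  transcendental over a set that was independent modulo the larger prime.\<close>

lemma indep_mod_step:
  fixes m :: "'i \<Rightarrow> 'a::field fps fps"
  assumes R: "closed_ring R" "\<And>c. cc c \<in> R" and PQ: "prime_in P R" "prime_in Q R" "P \<subseteq> Q"
    and m: "\<And>i. i \<in> I \<Longrightarrow> m i \<in> R" and f: "f \<in> Q" "f \<notin> P"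
    and ind: "indep_mod Q m I"
  shows "indep_mod P (\<lambda>(i, e). m i * f ^ e) (I \<times> {..<N::nat})"
proof -
  have QI: "ideal_in Q R" and PI: "ideal_in P R" using PQ by (auto intro: prime_in_ideal)
  have fR: "f \<in> R" using f ideal_in_sub[OF QI] by blast
  have main: "\<forall>e<N. \<forall>i\<in>I. c i e = 0"
    if "(\<Sum>e<N. (\<Sum>i\<in>I. cc (c i e) * m i) * f ^ e) \<in> P" for c :: "'i \<Rightarrow> nat \<Rightarrow> 'a"
    using that
  proof (induction N arbitrary: c)
    case (Suc N)
    let ?v = "\<lambda>e. \<Sum>i\<in>I. cc (c i e) * m i"
    let ?t = "\<Sum>e<N. ?v (Suc e) * f ^ e"
    have tR: "?t \<in> R"
      by (intro closed_ring_sum[OF R(1)] closed_ring_mult[OF R(1)] closed_ring_power[OF R(1)] fR R(2) m)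
    have "(\<Sum>e<Suc N. ?v e * f ^ e) = ?v 0 + (\<Sum>e<N. ?v (Suc e) * f ^ Suc e)"
      unfolding sum.lessThan_Suc_shift by simp
    also have "(\<Sum>e<N. ?v (Suc e) * f ^ Suc e) = f * ?t"
      unfolding sum_distrib_left by (intro sum.cong refl) (simp only: power_Suc ac_simps)
    finally have s: "?v 0 + f * ?t \<in> P" using Suc.prems by simp
    \<comment> \<open>Modulo \<open>Q\<close> the element \<open>f\<close> vanishes and only the
      part free of \<open>f\<close> remains, whose coefficients are 0 by independence; then one
      factor \<open>f\<close> is cancelled modulo \<open>P\<close>.\<close>
    have "f * ?t \<in> Q" using ideal_in_mult2[OF QI tR f(1)] .
    then have "?v 0 + f * ?t - f * ?t \<in> Q" using s PQ(3) ideal_in_diff[OF R(1) QI] by blast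
    then have "?v 0 \<in> Q" by simp
    then have z: "\<forall>i\<in>I. c i 0 = 0"
      using ind[unfolded indep_mod_def, rule_format, of "\<lambda>i. c i 0"] by blast
    then have "?v 0 = 0" by (intro sum.neutral) simp
    then have "f * ?t \<in> P" using s by simp
    then have "?t \<in> P" using prime_in_mult[OF PQ(1) fR tR] f(2) by blast
    then have "\<forall>e<N. \<forall>i\<in>I. c i (Suc e) = 0" using Suc.IH[of "\<lambda>i e. c i (Suc e)"] by blast
    then show ?case using z by (metis less_Suc_eq_0_disj)
  qed simp
  show ?thesis
    unfolding indep_mod_def
  proof (intro allI impI)
    fix c :: "'i \<times> nat \<Rightarrow> 'a"
    assume s: "(\<Sum>x\<in>I \<times> {..<N}. cc (c x) * (case x of (i, e) \<Rightarrow> m i * f ^ e)) \<in> P"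
    have "(\<Sum>x\<in>I \<times> {..<N}. cc (c x) * (case x of (i, e) \<Rightarrow> m i * f ^ e)) =
      (\<Sum>i\<in>I. \<Sum>e<N. cc (c (i, e)) * (m i * f ^ e))"
      unfolding sum.cartesian_product by (intro sum.cong refl) auto
    also have "\<dots> = (\<Sum>e<N. \<Sum>i\<in>I. cc (c (i, e)) * (m i * f ^ e))" by (rule sum.swap)
    also have "\<dots> = (\<Sum>e<N. (\<Sum>i\<in>I. cc (c (i, e)) * m i) * f ^ e)"
      unfolding sum_distrib_right by (simp only: mult.assoc)
    finally have "\<forall>e<N. \<forall>i\<in>I. c (i, e) = 0" using main[of "\<lambda>i e. c (i, e)"] s by simp
    then show "\<forall>x\<in>I \<times> {..<N}. c x = 0" by auto
  qed
qed

interpretation fps2: vector_space "\<lambda>(c :: 'a::field) (f :: 'a fps fps). cc c * f"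
  by unfold_locales (simp_all add: algebra_simps flip: fps_const_add fps_const_mult)

text \<open>As 0 lies in \<open>Q\<close>, the family is linearly independent over k in k[[x,y]]
  itself, and a spanning set bounds its size.\<close>

lemma indep_mod_card:
  assumes ind: "indep_mod Q m I" and Q: "0 \<in> Q" and I: "finite I"
    and B: "finite B" "m ` I \<subseteq> fps2.span B"
  shows "card I \<le> card B"
proof -
  have inj: "inj_on m I"
  proof (rule inj_onI, rule ccontr)
    fix i j assume ij: "i \<in> I" "j \<in> I" "m i = m j" "i \<noteq> j"
    define c where "c k = (if k = i then 1 else if k = j then - 1 else 0 :: 'a)" for k
    have "(\<Sum>k\<in>I. cc (c k) * m k) = (\<Sum>k\<in>{i, j}. cc (c k) * m k)"
      using ij I by (intro sum.mono_neutral_right) (auto simp: c_def)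
    also have "\<dots> = cc (c i) * m i + cc (c j) * m i" using ij by simp
    also have "\<dots> = cc (c i + c j) * m i" by (simp add: distrib_right flip: fps_const_add)
    also have "\<dots> = 0" using ij by (simp add: c_def)
    finally have "c i = 0" using ind Q ij(1) unfolding indep_mod_def by metis
    then show False by (simp add: c_def)
  qed
  have "\<not> fps2.dependent (m ` I)"
  proof
    assume "fps2.dependent (m ` I)"
    then obtain u where u: "\<exists>v\<in>m ` I. u v \<noteq> 0" "(\<Sum>v\<in>m ` I. cc (u v) * v) = 0"
      using fps2.dependent_finite[OF finite_imageI[OF I]] by blast
    then have "(\<Sum>i\<in>I. cc (u (m i)) * m i) = 0" by (simp add: sum.reindex[OF inj])
    then have "\<forall>i\<in>I. u (m i) = 0" using ind Q unfolding indep_mod_def by metis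
    then show False using u(1) by blast
  qed
  then have "card (m ` I) \<le> card B" using fps2.independent_span_bound[OF B(1) _ B(2)] by blast
  then show ?thesis by (simp add: card_image[OF inj])
qed

section \<open>Counting monomials in x, \<sigma>, y, \<tau>\<close>

definition monom4 :: "'a::field fps \<Rightarrow> 'a fps \<Rightarrow> nat \<times> nat \<times> nat \<times> nat \<Rightarrow> 'a fps fps" where
  "monom4 \<sigma> \<tau> = (\<lambda>(i, j, k, l). Xv ^ i * fps_const \<sigma> ^ j * Yv ^ k * yc \<tau> ^ l)"

definition exps4 :: "nat \<Rightarrow> (nat \<times> nat \<times> nat \<times> nat) set" where
  "exps4 D = {..D} \<times> {..D} \<times> {..D} \<times> {..D}"

text \<open>A filtration of k[x,\<sigma>,y,\<tau>] by the largest exponent, not the total degree, so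
  that the number of exponent vectors is simply \<open>(D + 1) ^ 4\<close>.\<close>

definition bounded_span :: "'a::field fps \<Rightarrow> 'a fps \<Rightarrow> nat \<Rightarrow> 'a fps fps set" where
  "bounded_span \<sigma> \<tau> D = fps2.span (monom4 \<sigma> \<tau> ` exps4 D)"

lemma card_exps4: "card (exps4 D) = (D + 1) ^ 4"
  by (simp add: exps4_def card_cartesian_product power4_eq_xxxx)

lemma finite_exps4: "finite (exps4 D)"
  by (simp add: exps4_def)

lemma bounded_span_mono: "D \<le> E \<Longrightarrow> bounded_span \<sigma> \<tau> D \<subseteq> bounded_span \<sigma> \<tau> E"
  unfolding bounded_span_def by (intro fps2.span_mono image_mono) (auto simp: exps4_def)

lemma monom4_bounded_span: "x \<in> exps4 D \<Longrightarrow> monom4 \<sigma> \<tau> x \<in> bounded_span \<sigma> \<tau> D"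
  unfolding bounded_span_def by (intro fps2.span_base imageI)

text \<open>For monomials the exponents add up; linearity extends this to the spans, in one factor
  at a time.\<close>

lemma bounded_span_mult:
  assumes f: "f \<in> bounded_span \<sigma> \<tau> D" and g: "g \<in> bounded_span \<sigma> \<tau> E"
  shows "f * g \<in> bounded_span \<sigma> \<tau> (D + E)"
proof -
  let ?V = "bounded_span \<sigma> \<tau>"
  have sc: "fps2.subspace {g. f * g \<in> ?V (D + E)}" for f
  proof (rule fps2.subspaceI)
    show "0 \<in> {g. f * g \<in> ?V (D + E)}"
      by (simp add: bounded_span_def fps2.span_zero)
    show "a + b \<in> {g. f * g \<in> ?V (D + E)}"
      if "a \<in> {g. f * g \<in> ?V (D + E)}" "b \<in> {g. f * g \<in> ?V (D + E)}" for a b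
      using that by (simp add: bounded_span_def distrib_left fps2.span_add)
    show "cc c * a \<in> {g. f * g \<in> ?V (D + E)}"
      if "a \<in> {g. f * g \<in> ?V (D + E)}" for c a
    proof -
      have "cc c * (f * a) \<in> ?V (D + E)"
        using that unfolding bounded_span_def by (intro fps2.span_scale) simp
      then show ?thesis by (simp add: mult.left_commute[of f])
    qed
  qed
  have base: "b * b' \<in> ?V (D + E)"
    if b: "b \<in> monom4 \<sigma> \<tau> ` exps4 D" "b' \<in> monom4 \<sigma> \<tau> ` exps4 E" for b b'
  proof -
    obtain i j k l i' j' k' l' where e: "b = monom4 \<sigma> \<tau> (i, j, k, l)" "(i, j, k, l) \<in> exps4 D"
      "b' = monom4 \<sigma> \<tau> (i', j', k', l')" "(i', j', k', l') \<in> exps4 E" using b by auto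
    have "b * b' = monom4 \<sigma> \<tau> (i + i', j + j', k + k', l + l')"
      unfolding e monom4_def prod.case power_add by (simp only: ac_simps)
    moreover have "(i + i', j + j', k + k', l + l') \<in> exps4 (D + E)" using e by (auto simp: exps4_def)
    ultimately show ?thesis using monom4_bounded_span by metis
  qed
  have "b * g \<in> ?V (D + E)" if b: "b \<in> monom4 \<sigma> \<tau> ` exps4 D" for b
  proof -
    have "monom4 \<sigma> \<tau> ` exps4 E \<subseteq> {g. b * g \<in> ?V (D + E)}" using base[OF b] by blast
    from fps2.span_minimal[OF this sc] show ?thesis using g unfolding bounded_span_def by blast
  qed
  then have "monom4 \<sigma> \<tau> ` exps4 D \<subseteq> {f. g * f \<in> ?V (D + E)}"
    by (auto simp: mult.commute)
  from fps2.span_minimal[OF this sc] have "g * f \<in> ?V (D + E)"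
    using f unfolding bounded_span_def by blast
  then show ?thesis by (subst mult.commute)
qed

lemma bounded_span_power: "f \<in> bounded_span \<sigma> \<tau> D \<Longrightarrow> f ^ n \<in> bounded_span \<sigma> \<tau> (n * D)"
proof (induction n)
  case 0
  have "1 = monom4 \<sigma> \<tau> (0, 0, 0, 0)" by (simp add: monom4_def)
  then show ?case using monom4_bounded_span[of "(0, 0, 0, 0)" 0 \<sigma> \<tau>] by (simp add: exps4_def)
next
  case (Suc n)
  then show ?case using bounded_span_mult[of f \<sigma> \<tau> D "f ^ n" "n * D"] by simp
qed

lemma bounded_span_gens:
  "Xv \<in> bounded_span \<sigma> \<tau> 1" "fps_const \<sigma> \<in> bounded_span \<sigma> \<tau> 1"
  "Yv \<in> bounded_span \<sigma> \<tau> 1" "yc \<tau> \<in> bounded_span \<sigma> \<tau> 1"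
proof -
  let ?V = "bounded_span \<sigma> \<tau>"
  have "Xv = monom4 \<sigma> \<tau> (1, 0, 0, 0)" "fps_const \<sigma> = monom4 \<sigma> \<tau> (0, 1, 0, 0)"
    "Yv = monom4 \<sigma> \<tau> (0, 0, 1, 0)" "yc \<tau> = monom4 \<sigma> \<tau> (0, 0, 0, 1)" by (simp_all add: monom4_def)
  moreover have "(1, 0, 0, 0) \<in> exps4 1" "(0, 1, 0, 0) \<in> exps4 1" "(0, 0, 1, 0) \<in> exps4 1" "(0, 0, 0, 1) \<in> exps4 1"
    by (simp_all add: exps4_def)
  ultimately show "Xv \<in> ?V 1" "fps_const \<sigma> \<in> ?V 1"
    "Yv \<in> ?V 1" "yc \<tau> \<in> ?V 1"
    using monom4_bounded_span by metis+
qed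

lemma Ulev_0_bounded:
  assumes st: "fps_nth \<sigma> 0 = 0" "fps_nth \<tau> 0 = 0" and "f \<in> Ulev \<sigma> \<tau> 0"
  shows "\<exists>D. f \<in> bounded_span \<sigma> \<tau> D"
  using assms(3)
proof induction
  case (gconst c)
  have "1 = monom4 \<sigma> \<tau> (0, 0, 0, 0)" by (simp add: monom4_def)
  then have "1 \<in> bounded_span \<sigma> \<tau> 0" using monom4_bounded_span[of "(0, 0, 0, 0)" 0 \<sigma> \<tau>] by (simp add: exps4_def)
  then have "cc c * 1 \<in> bounded_span \<sigma> \<tau> 0" unfolding bounded_span_def by (rule fps2.span_scale)
  then show ?case by auto
next
  case (gincl g)
  then show ?case using bounded_span_gens[where \<sigma> = \<sigma> and \<tau> = \<tau>] endpiece_0[OF st(1)] endpiece_0[OF st(2)]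
    by (auto simp: Ug_def)
next
  case (gdiff f g)
  then obtain D E where "f \<in> bounded_span \<sigma> \<tau> D" "g \<in> bounded_span \<sigma> \<tau> E" by blast
  then have "f \<in> bounded_span \<sigma> \<tau> (max D E)" "g \<in> bounded_span \<sigma> \<tau> (max D E)"
    by (auto intro: subsetD[OF bounded_span_mono, rotated])
  then show ?case unfolding bounded_span_def using fps2.span_diff by blast
next
  case (gmult f g)
  then show ?case using bounded_span_mult by blast
qed

text \<open>There are \<open>N ^ 5\<close> products with exponents below \<open>N\<close>, but their
  degrees grow linearly in \<open>N\<close>, so they lie in a space whose dimension grows at most
  like \<open>N ^ 4\<close>.\<close>

lemma no_five_independent:
  fixes \<sigma> \<tau> :: "'a::field fps"
  assumes st: "fps_nth \<sigma> 0 = 0" "fps_nth \<tau> 0 = 0"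
    and f: "f1 \<in> Ulev \<sigma> \<tau> 0" "f2 \<in> Ulev \<sigma> \<tau> 0" "f3 \<in> Ulev \<sigma> \<tau> 0"
    and Q: "0 \<in> Q"
    and ind: "\<And>N::nat. indep_mod Q
      (\<lambda>((((a, b), c), d), e). Xv ^ a * fps_const \<sigma> ^ b * f1 ^ c * f2 ^ d * f3 ^ e)
      (((({..<N} \<times> {..<N}) \<times> {..<N}) \<times> {..<N}) \<times> {..<N})"
  shows False
proof -
  let ?V = "bounded_span \<sigma> \<tau>"
  obtain D1 D2 D3 where D: "f1 \<in> ?V D1" "f2 \<in> ?V D2" "f3 \<in> ?V D3"
    using Ulev_0_bounded[OF st] f by metis
  \<comment> \<open>A product with all exponents at most \<open>N\<close> has degree at most
    \<open>N * (q - 1)\<close>, where \<open>q - 1 = 1 + 1 + D1 + D2 + D3\<close>. The remaining 1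
    in \<open>q\<close> absorbs the 1 added in \<open>(D + 1) ^ 4\<close>, and \<open>N\<close> is
    chosen to exceed \<open>q ^ 4\<close>, the bound that results.\<close>
  define q where "q = D1 + D2 + D3 + 3"
  define N where "N = q ^ 4 + 1"
  let ?m = "\<lambda>((((a, b), c), d), e). Xv ^ a * fps_const \<sigma> ^ b * f1 ^ c * f2 ^ d * f3 ^ e"
  let ?J = "((({..<N} \<times> {..<N}) \<times> {..<N}) \<times> {..<N}) \<times> {..<N}"
  have "?m ` ?J \<subseteq> fps2.span (monom4 \<sigma> \<tau> ` exps4 (N * (q - 1)))"
  proof
    fix z assume "z \<in> ?m ` ?J"
    then obtain a b c d e where z: "z = Xv ^ a * fps_const \<sigma> ^ b * f1 ^ c * f2 ^ d * f3 ^ e"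
      and lt: "a < N" "b < N" "c < N" "d < N" "e < N" by auto
    have "z \<in> ?V (a * 1 + b * 1 + c * D1 + d * D2 + e * D3)"
      unfolding z by (intro bounded_span_mult bounded_span_power bounded_span_gens D)
    moreover have "a * 1 + b * 1 + c * D1 + d * D2 + e * D3 \<le> N * (q - 1)"
    proof -
      have "c * D1 \<le> N * D1" "d * D2 \<le> N * D2" "e * D3 \<le> N * D3"
        using lt by (intro mult_right_mono; simp)+
      then have "a * 1 + b * 1 + c * D1 + d * D2 + e * D3 \<le> N + N + N * D1 + N * D2 + N * D3"
        using lt by linarith
      also have "\<dots> = N * (q - 1)" unfolding q_def by (simp add: algebra_simps)
      finally show ?thesis .
    qed
    ultimately show "z \<in> fps2.span (monom4 \<sigma> \<tau> ` exps4 (N * (q - 1)))"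
      using bounded_span_mono unfolding bounded_span_def by blast
  qed
  then have "card ?J \<le> card (monom4 \<sigma> \<tau> ` exps4 (N * (q - 1)))"
    using indep_mod_card[OF ind Q] finite_exps4 by (metis (no_types, lifting) finite_SigmaI finite_imageI finite_lessThan)
  also have "\<dots> \<le> card (exps4 (N * (q - 1)))" by (rule card_image_le[OF finite_exps4])
  also have "\<dots> = (N * (q - 1) + 1) ^ 4" by (rule card_exps4)
  also have "\<dots> \<le> (N * q) ^ 4"
  proof (rule power_mono)
    have "N * q = N * (q - 1) + N" unfolding q_def by (simp add: algebra_simps)
    moreover have "1 \<le> N" by (simp add: N_def)
    ultimately show "N * (q - 1) + 1 \<le> N * q" by linarith
  qed simp
  finally have "N ^ 4 * N \<le> N ^ 4 * q ^ 4"
    by (simp add: card_cartesian_product power_mult_distrib power4_eq_xxxx mult.assoc)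
  moreover have "0 < N ^ 4" by (simp add: N_def)
  ultimately have "N \<le> q ^ 4" by simp
  then show False by (simp add: N_def)
qed

section \<open>Chains of primes in B\<close>

lemma sw_BB: "f \<in> BB \<sigma> \<tau> \<Longrightarrow> sw f \<in> BB \<tau> \<sigma>"
proof -
  assume "f \<in> BB \<sigma> \<tau>"
  then obtain g where "g \<in> UU \<sigma> \<tau>" "cf g 0 0 \<noteq> 0" "g * f \<in> UU \<sigma> \<tau>" unfolding BB_def frac_by_def by blast
  then have "sw g \<in> UU \<tau> \<sigma>" "cf (sw g) 0 0 \<noteq> 0" "sw g * sw f \<in> UU \<tau> \<sigma>"
    using sw_UU by (auto simp flip: sw_mult)
  then show "sw f \<in> BB \<tau> \<sigma>" unfolding BB_def frac_by_def by blast
qed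

lemma sw_prime:
  assumes P: "prime_in P (BB \<sigma> \<tau>)"
  shows "prime_in (sw ` P) (BB \<tau> \<sigma>)"
proof -
  have I: "ideal_in P (BB \<sigma> \<tau>)" using P by (rule prime_in_ideal)
  have mem: "f \<in> sw ` P \<longleftrightarrow> sw f \<in> P" for f
    by (metis image_iff sw_sw)
  show ?thesis
    unfolding prime_in_def ideal_in_def
  proof (intro conjI ballI impI)
    show "sw ` P \<subseteq> BB \<tau> \<sigma>" using sw_BB ideal_in_sub[OF I] by blast
    show "0 \<in> sw ` P" unfolding mem using ideal_in_zero[OF I] by simp
    show "1 \<notin> sw ` P" unfolding mem using prime_in_one[OF P] by (simp add: sw_1)
    show "a + b \<in> sw ` P" if "a \<in> sw ` P" "b \<in> sw ` P" for a b
      using that unfolding mem sw_add by (rule ideal_in_add[OF I])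
    show "r * a \<in> sw ` P" if "r \<in> BB \<tau> \<sigma>" "a \<in> sw ` P" for r a
      using sw_BB[OF that(1)] that(2) unfolding mem sw_mult by (rule ideal_in_mult[OF I])
    show "a \<in> sw ` P \<or> b \<in> sw ` P" if "a \<in> BB \<tau> \<sigma>" "b \<in> BB \<tau> \<sigma>" "a * b \<in> sw ` P" for a b
      using sw_BB[OF that(1)] sw_BB[OF that(2)] that(3) unfolding mem sw_mult
      by (rule prime_in_mult[OF P])
  qed
qed

text \<open>\<open>P2\<close> is not maximal, so if it contained y it would be (y); then only 0
  could lie strictly below, which leaves no room for both \<open>P0\<close> and
  \<open>P1\<close>.\<close>

lemma chain_avoids_Y:
  fixes \<sigma> \<tau> :: "'a::field fps"
  assumes P: "prime_in P0 (BB \<sigma> \<tau>)" "prime_in P1 (BB \<sigma> \<tau>)" "prime_in P2 (BB \<sigma> \<tau>)" "prime_in P3 (BB \<sigma> \<tau>)"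
    and sub: "P0 \<subset> P1" "P1 \<subset> P2" "P2 \<subset> P3"
  shows "Yv \<notin> P2"
proof
  interpret B: local_stable_ring "BB \<sigma> \<tau>" by (rule BB_local_stable)
  assume Y: "Yv \<in> P2"
  have "P2 \<noteq> B.mx" using sub(3) B.prime_sub_mx[OF P(4)] by blast
  then have "P2 = {f \<in> BB \<sigma> \<tau>. fps_nth f 0 = 0}" using B.prime_contains_Y[OF P(3) Y] by blast
  then have "P1 = {0}" using B.prime_below_Y[OF P(2)] sub(2) by blast
  then show False using sub(1) ideal_in_zero[OF prime_in_ideal[OF P(1)]] by blast
qed

lemma chain_avoids_X:
  fixes \<sigma> \<tau> :: "'a::field fps"
  assumes P: "prime_in P0 (BB \<sigma> \<tau>)" "prime_in P1 (BB \<sigma> \<tau>)" "prime_in P2 (BB \<sigma> \<tau>)" "prime_in P3 (BB \<sigma> \<tau>)"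
    and sub: "P0 \<subset> P1" "P1 \<subset> P2" "P2 \<subset> P3"
  shows "Xv \<notin> P2"
proof
  assume "Xv \<in> P2"
  then have "Yv \<in> sw ` P2" by (metis imageI sw_const yc_X)
  then show False
    using chain_avoids_Y[OF sw_prime[OF P(1)] sw_prime[OF P(2)] sw_prime[OF P(3)] sw_prime[OF P(4)]] sub dom_emb.image_psubset[OF dom_emb_sw] by metis
qed

text \<open>The denominator and the power of xy needed to reach k[x,y,\<sigma>,\<tau>] lie outside
  \<open>P\<close>, the former as a unit, the latter since x and y are not in \<open>P\<close>; so
  multiplying by them does not move the element into \<open>P\<close>.\<close>

lemma prime_difference_U0:
  fixes \<sigma> \<tau> :: "'a::field fps"
  assumes P: "prime_in P (BB \<sigma> \<tau>)" "prime_in Q (BB \<sigma> \<tau>)" "P \<subset> Q" and XY: "Xv \<notin> Q" "Yv \<notin> Q"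
  obtains f where "f \<in> Ulev \<sigma> \<tau> 0" "f \<in> Q" "f \<notin> P"
proof -
  let ?B = "BB \<sigma> \<tau>"
  interpret B: local_stable_ring "?B" by (rule BB_local_stable)
  note Q = prime_in_ideal[OF P(2)]
  obtain h where h: "h \<in> Q" "h \<notin> P" using P(3) by blast
  then have hB: "h \<in> ?B" using ideal_in_sub[OF Q] by blast
  then obtain g where g: "g \<in> UU \<sigma> \<tau>" "cf g 0 0 \<noteq> 0" "g * h \<in> UU \<sigma> \<tau>"
    unfolding BB_def frac_by_def by blast
  have gB: "g \<in> ?B" using g(1) BB_sup by blast
  obtain k where k: "(Xv * Yv) ^ k * (g * h) \<in> Ulev \<sigma> \<tau> 0" using UU_clear[OF g(3)] by blast
  have m: "Xv * Yv \<in> ?B" by (intro closed_ring_mult B.ring B.X_mem B.Y_mem)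
  then have mk: "(Xv * Yv) ^ k \<in> ?B" by (intro closed_ring_power B.ring)
  have ghB: "g * h \<in> ?B" using closed_ring_mult[OF B.ring gB hB] .
  have "(Xv * Yv) ^ k * (g * h) \<in> Q" using ideal_in_mult[OF Q mk] ideal_in_mult[OF Q gB h(1)] by blast
  moreover have "(Xv * Yv) ^ k * (g * h) \<notin> P"
  proof
    assume "(Xv * Yv) ^ k * (g * h) \<in> P"
    then consider "(Xv * Yv) ^ k \<in> P" | "g \<in> P" | "h \<in> P"
      using prime_in_mult[OF P(1) mk ghB] prime_in_mult[OF P(1) gB hB] by blast
    then show False
    proof cases
      case 1
      then have "Xv * Yv \<in> P" using prime_in_power[OF B.ring P(1) m] by blast
      then show ?thesis using prime_in_mult[OF P(1) B.X_mem B.Y_mem] XY P(3) by blast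
    next
      case 2
      then show ?thesis using B.prime_sub_mx[OF P(1)] g(2) by blast
    next
      case 3
      then show ?thesis using h by blast
    qed
  qed
  ultimately show thesis using that k by blast
qed

context
  fixes \<sigma> \<tau> :: "'a::field fps"
  assumes st: "fps_nth \<sigma> 0 = 0" "fps_nth \<tau> 0 = 0" and tr: "transc \<sigma>" "transc \<tau>"
begin

text \<open>Every nonzero element of \<open>k[x,\<sigma>]\<close> is a power of \<open>x\<close> times a unit of \<open>B\<close>.\<close>

lemma indep_mod_x_sigma:
  assumes Q: "prime_in Q (BB \<sigma> \<tau>)" and X: "Xv \<notin> Q"
  shows "indep_mod Q (\<lambda>(a, b). Xv ^ a * fps_const \<sigma> ^ b) ({..<N} \<times> {..<N})"
  unfolding indep_mod_def
proof (intro allI impI)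
  let ?B = "BB \<sigma> \<tau>"
  interpret B: local_stable_ring "?B" by (rule BB_local_stable)
  fix c :: "nat \<times> nat \<Rightarrow> 'a"
  assume s: "(\<Sum>x\<in>{..<N} \<times> {..<N}. cc (c x) * (case x of (a, b) \<Rightarrow> Xv ^ a * fps_const \<sigma> ^ b)) \<in> Q"
  \<comment> \<open>The double sum is read as a polynomial in \<sigma> with coefficients in k[x],
    the form in which \<open>transc\<close> applies.\<close>
  define p where "p = (\<Sum>b<N. monom (\<Sum>a<N. monom (c (a, b)) a) b)"
  define u where "u = pev fps_of_poly \<sigma> p"
  have "u = (\<Sum>b<N. \<Sum>a<N. fps_const (c (a, b)) * fps_X ^ a * \<sigma> ^ b)"
    unfolding u_def p_def pev_sum[OF fps_of_poly_hom] pev_monom[OF fps_of_poly_hom]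
    by (simp add: fps_of_poly_sum fps_of_poly_monom sum_distrib_right)
  also have "\<dots> = (\<Sum>a<N. \<Sum>b<N. fps_const (c (a, b)) * fps_X ^ a * \<sigma> ^ b)" by (rule sum.swap)
  also have "\<dots> = (\<Sum>x\<in>{..<N} \<times> {..<N}. fps_const (c x) * (case x of (a, b) \<Rightarrow> fps_X ^ a * \<sigma> ^ b))"
    unfolding sum.cartesian_product by (intro sum.cong refl) (auto simp: mult.assoc)
  finally have u: "u = (\<Sum>x\<in>{..<N} \<times> {..<N}. fps_const (c x) * (case x of (a, b) \<Rightarrow> fps_X ^ a * \<sigma> ^ b))" .
  have const_sum: "fps_const (sum g I) = (\<Sum>i\<in>I. fps_const (g i))" for g :: "nat \<times> nat \<Rightarrow> 'a fps" and I
    by (induction I rule: infinite_finite_induct) (auto simp flip: fps_const_add)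
  have "fps_const u = (\<Sum>x\<in>{..<N} \<times> {..<N}. cc (c x) * (case x of (a, b) \<Rightarrow> Xv ^ a * fps_const \<sigma> ^ b))"
    unfolding u const_sum by (intro sum.cong refl) (auto simp: fps_const_power)
  then have uQ: "fps_const u \<in> Q" using s by simp
  have uB: "fps_const u \<in> ?B" using uQ ideal_in_sub[OF prime_in_ideal[OF Q]] by blast
  have "u = 0"
  proof (rule ccontr)
    assume "u \<noteq> 0"
    then obtain n w where w: "u = fps_X ^ n * w" "fps_nth w 0 \<noteq> 0" using fps_Y_decompose by blast
    have wB: "fps_const w \<in> ?B" using B.const_div_X_power uB w(1) by blast
    have "cf (fps_const w) 0 0 \<noteq> 0" using w(2) by simp
    then have "fps_const w \<notin> Q" using B.prime_sub_mx[OF Q] by blast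
    moreover have "Xv ^ n * fps_const w \<in> Q" using uQ w(1) by simp
    moreover have "Xv ^ n \<in> ?B" by (intro closed_ring_power B.ring B.X_mem)
    ultimately have "Xv ^ n \<in> Q" using prime_in_mult[OF Q _ wB] by blast
    then show False using prime_in_power[OF B.ring Q B.X_mem] X by blast
  qed
  then have p: "p = 0" using tr(1) unfolding u_def transc_def by blast
  have "c (a, b) = 0" if "a < N" "b < N" for a b
  proof -
    have "coeff (coeff p b) a = c (a, b)"
      using that by (simp add: p_def coeff_sum)
    then show ?thesis using p by simp
  qed
  then show "\<forall>x\<in>{..<N} \<times> {..<N}. c x = 0" by auto
qed

text \<open>The five elements are x and \<sigma>, independent modulo \<open>P3\<close>, and one
  element from each of the three steps down to \<open>P0\<close>.\<close>

lemma no_chain_4: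
  assumes P: "prime_in P0 (BB \<sigma> \<tau>)" "prime_in P1 (BB \<sigma> \<tau>)" "prime_in P2 (BB \<sigma> \<tau>)" "prime_in P3 (BB \<sigma> \<tau>)"
      "prime_in P4 (BB \<sigma> \<tau>)"
    and sub: "P0 \<subset> P1" "P1 \<subset> P2" "P2 \<subset> P3" "P3 \<subset> P4"
  shows False
proof -
  let ?L = "Ulev \<sigma> \<tau> 0"
  let ?B = "BB \<sigma> \<tau>"
  interpret B: local_stable_ring "?B" by (rule BB_local_stable)
  \<comment> \<open>\<open>P4\<close> keeps \<open>P3\<close> from being maximal, so x and y avoid
    \<open>P3\<close> and with it all smaller primes.\<close>
  have Y: "Yv \<notin> P3" using chain_avoids_Y[OF P(2-5) sub(2-4)] .
  have X: "Xv \<notin> P3" using chain_avoids_X[OF P(2-5) sub(2-4)] .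
  have XY: "Xv \<notin> P2" "Yv \<notin> P2" "Xv \<notin> P1" "Yv \<notin> P1" using X Y sub by blast+
  obtain f1 where f1: "f1 \<in> ?L" "f1 \<in> P3" "f1 \<notin> P2"
    using prime_difference_U0[OF P(3,4) sub(3) X Y] .
  obtain f2 where f2: "f2 \<in> ?L" "f2 \<in> P2" "f2 \<notin> P1"
    using prime_difference_U0[OF P(2,3) sub(2) XY(1,2)] .
  obtain f3 where f3: "f3 \<in> ?L" "f3 \<in> P1" "f3 \<notin> P0"
    using prime_difference_U0[OF P(1,2) sub(1) XY(3,4)] .
  have U0: "?L \<subseteq> ?B" using BB_sup UU_iff by blast
  have mem: "fps_const \<sigma> \<in> ?B" "f1 \<in> ?B" "f2 \<in> ?B"
    using U0 UU_sigma_tau(1)[OF st] f1 f2 by blast+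
  note R = B.ring B.const
  have i0: "indep_mod P3 (\<lambda>(a, b). Xv ^ a * fps_const \<sigma> ^ b) ({..<N} \<times> {..<N})" for N
    by (rule indep_mod_x_sigma[OF P(4) X])
  have m0: "(case x of (a, b) \<Rightarrow> Xv ^ a * fps_const \<sigma> ^ b) \<in> ?B" for x :: "nat \<times> nat"
    by (cases x) (simp only: prod.case, intro closed_ring_mult closed_ring_power B.ring B.X_mem mem)
  have i1: "indep_mod P2 (\<lambda>(x, c). (case x of (a, b) \<Rightarrow> Xv ^ a * fps_const \<sigma> ^ b) * f1 ^ c)
      (({..<N} \<times> {..<N}) \<times> {..<N})" for N
    by (rule indep_mod_step[OF R P(3,4) _ m0 f1(2,3) i0]) (use sub in blast)
  have m1: "(case y of (x, c) \<Rightarrow> (case x of (a, b) \<Rightarrow> Xv ^ a * fps_const \<sigma> ^ b) * f1 ^ c) \<in> ?B"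
    for y :: "(nat \<times> nat) \<times> nat"
    by (cases y) (simp only: prod.case, intro closed_ring_mult closed_ring_power B.ring m0 mem)
  have i2: "indep_mod P1 (\<lambda>(y, d). (case y of (x, c) \<Rightarrow> (case x of (a, b) \<Rightarrow> Xv ^ a * fps_const \<sigma> ^ b) * f1 ^ c) * f2 ^ d)
      ((({..<N} \<times> {..<N}) \<times> {..<N}) \<times> {..<N})" for N
    by (rule indep_mod_step[OF R P(2,3) _ m1 f2(2,3) i1]) (use sub in blast)
  have m2: "(case z of (y, d) \<Rightarrow> (case y of (x, c) \<Rightarrow> (case x of (a, b) \<Rightarrow> Xv ^ a * fps_const \<sigma> ^ b) * f1 ^ c) * f2 ^ d) \<in> ?B"
    for z :: "((nat \<times> nat) \<times> nat) \<times> nat"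
    by (cases z) (simp only: prod.case, intro closed_ring_mult closed_ring_power B.ring m1 mem)
  have i3: "indep_mod P0 (\<lambda>(z, e). (case z of (y, d) \<Rightarrow> (case y of (x, c) \<Rightarrow> (case x of (a, b) \<Rightarrow> Xv ^ a * fps_const \<sigma> ^ b) * f1 ^ c) * f2 ^ d) * f3 ^ e)
      (((({..<N} \<times> {..<N}) \<times> {..<N}) \<times> {..<N}) \<times> {..<N})" for N
    by (rule indep_mod_step[OF R P(1,2) _ m2 f3(2,3) i2]) (use sub in blast)
  have eq: "(\<lambda>(z, e). (case z of (y, d) \<Rightarrow> (case y of (x, c) \<Rightarrow> (case x of (a, b) \<Rightarrow> Xv ^ a * fps_const \<sigma> ^ b) * f1 ^ c) * f2 ^ d) * f3 ^ e)
    = (\<lambda>((((a :: nat, b :: nat), c :: nat), d :: nat), e :: nat). Xv ^ a * fps_const \<sigma> ^ b * f1 ^ c * f2 ^ d * f3 ^ e)"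
    by (rule ext) (simp only: split_beta)
  show False
    using no_five_independent[OF st f1(1) f2(1) f3(1) ideal_in_zero[OF prime_in_ideal[OF P(1)]] i3[unfolded eq]] .
qed

lemma krull_dim_BB: "krull_dim (emb_fract.im (BB \<sigma> \<tau>)) = 2 \<or> krull_dim (emb_fract.im (BB \<sigma> \<tau>)) = 3"
proof -
  let ?B = "BB \<sigma> \<tau>"
  interpret B: local_stable_ring "?B" by (rule BB_local_stable)
  have "n \<le> 3" if P: "\<forall>i\<le>n. prime_in (P i) ?B" "\<forall>i<n. P i \<subset> P (Suc i)" for n P
  proof (rule ccontr)
    assume "\<not> n \<le> 3"
    then have n: "3 < n" by simp
    have "prime_in (P 0) ?B" "prime_in (P (Suc 0)) ?B" "prime_in (P (Suc (Suc 0))) ?B"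
      "prime_in (P (Suc (Suc (Suc 0)))) ?B" "prime_in (P (Suc (Suc (Suc (Suc 0))))) ?B"
      using n by (intro P(1)[rule_format]; simp)+
    moreover have "P 0 \<subset> P (Suc 0)" "P (Suc 0) \<subset> P (Suc (Suc 0))" "P (Suc (Suc 0)) \<subset> P (Suc (Suc (Suc 0)))"
      "P (Suc (Suc (Suc 0))) \<subset> P (Suc (Suc (Suc (Suc 0))))"
      using n by (intro P(2)[rule_format]; simp)+
    ultimately show False by (rule no_chain_4)
  qed
  then have "krull_dim B.imR \<le> 3"
    unfolding emb_fract.im_krull_dim[OF B.ring] by (intro Sup_least) (auto simp: numeral_eq_enat)
  moreover have "2 \<le> krull_dim B.imR"
    unfolding emb_fract.im_krull_dim[OF B.ring] using B.chain_2
    by (intro Sup_upper) (auto simp: numeral_eq_enat)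
  ultimately show ?thesis
    by (cases "krull_dim B.imR") (auto simp: numeral_eq_enat)
qed

end

theorem theorem4p2:
  fixes \<sigma> \<tau> :: "'a::field fps"
  assumes "fps_nth \<sigma> 0 = 0" and "fps_nth \<tau> 0 = 0"
    and "ring.transcendental ring_of_type_algebra (adjoin_field {x_var}) (in_x \<sigma>)"
    and "ring.transcendental ring_of_type_algebra (adjoin_field {y_var}) (in_y \<tau>)"
  shows
    "two_dim_regular_local_domain (ring_A \<sigma> \<tau>)
     \<and> birationally_dominates (ring_A \<sigma> \<tau>) (ring_B \<sigma> \<tau>)
     \<and> max_ideal (subring_of (ring_A \<sigma> \<tau>)) =
         genideal (subring_of (ring_A \<sigma> \<tau>)) {x_var, y_var}
     \<and> canonically_completes_to (subring_of (ring_A \<sigma> \<tau>))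
         (max_ideal (subring_of (ring_A \<sigma> \<tau>))) (subring_of power_series_xy)
     \<and> factorial_domain (subring_of (ring_U \<sigma> \<tau>)) \<and> factorial_domain (subring_of (ring_B \<sigma> \<tau>))
     \<and> local_ring (subring_of (ring_B \<sigma> \<tau>)) \<and> krull_domain (ring_B \<sigma> \<tau>)
     \<and> max_ideal (subring_of (ring_B \<sigma> \<tau>)) = ideal_n \<sigma> \<tau>
     \<and> (krull_dim (subring_of (ring_B \<sigma> \<tau>)) = 2 \<or> krull_dim (subring_of (ring_B \<sigma> \<tau>)) = 3)
     \<and> Hausdorff_space (adic_topology (subring_of (ring_B \<sigma> \<tau>)) (ideal_n \<sigma> \<tau>))
     \<and> canonically_completes_to (subring_of (ring_B \<sigma> \<tau>)) (ideal_n \<sigma> \<tau>)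
       (subring_of power_series_xy)
     \<and> (ring_B \<sigma> \<tau> = ring_A \<sigma> \<tau> \<longleftrightarrow> two_dim_regular_local_domain (ring_B \<sigma> \<tau>))
     \<and> (ring_B \<sigma> \<tau> = ring_A \<sigma> \<tau> \<longleftrightarrow> noetherian_ring (subring_of (ring_B \<sigma> \<tau>)))
     \<and> (ring_B \<sigma> \<tau> = ring_A \<sigma> \<tau> \<longleftrightarrow>
       (\<forall>G. finite G \<and> G \<subseteq> ring_B \<sigma> \<tau> \<longrightarrow>
          closedin (adic_topology (subring_of (ring_B \<sigma> \<tau>)) (ideal_n \<sigma> \<tau>))
            (genideal (subring_of (ring_B \<sigma> \<tau>)) G)))
     \<and> (ring_B \<sigma> \<tau> = ring_A \<sigma> \<tau> \<longleftrightarrow>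
       (\<forall>I. principalideal I (subring_of (ring_B \<sigma> \<tau>)) \<longrightarrow>
          closedin (adic_topology (subring_of (ring_B \<sigma> \<tau>)) (ideal_n \<sigma> \<tau>)) I))"
proof -
  let ?B = "subring_of (ring_B \<sigma> \<tau>)"
  let ?A = "subring_of (ring_A \<sigma> \<tau>)"
  let ?T = "adic_topology ?B (ideal_n \<sigma> \<tau>)"
  let ?closed = "\<lambda>f I. (\<forall>n. \<exists>i\<in>I. f - i \<in> ord_ge n) \<longrightarrow> f \<in> I"
  have st: "fps_nth \<sigma> 0 = 0" "fps_nth \<tau> 0 = 0" by fact+
  have tr: "transc \<sigma>" "transc \<tau>" using assms(3,4) transc_x transc_y by blast+
  interpret A: saturated_ring "AA \<sigma> \<tau>" by (rule AA_saturated)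
  interpret B: local_stable_ring "BB \<sigma> \<tau>" by (rule BB_local_stable)
  have mxB: "to_fract ` B.mx = ideal_n \<sigma> \<tau>"
    unfolding ideal_n_def ring_B_eq
    using emb_fract.im_genideal_gen_in[OF B.ring, of "{Xv, Yv}"] B.X_mem B.Y_mem B.gen_XY by (simp add: var_eq)
  have closed_iff: "closedin (adic_topology B.imR (ideal_n \<sigma> \<tau>)) (to_fract ` I) \<longleftrightarrow>
      (\<forall>f\<in>BB \<sigma> \<tau>. ?closed f I)" if "I \<subseteq> BB \<sigma> \<tau>" for I
    using B.closedin_top_iff[OF that] unfolding mxB .
  have eq_iff: "ring_B \<sigma> \<tau> = ring_A \<sigma> \<tau> \<longleftrightarrow> BB \<sigma> \<tau> = AA \<sigma> \<tau>"
    unfolding ring_B_eq ring_A_eq[OF st] by simp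
  have ideal_closed: "closedin (adic_topology B.imR (ideal_n \<sigma> \<tau>)) J"
    if eq: "BB \<sigma> \<tau> = AA \<sigma> \<tau>" and J: "ideal J B.imR" for J
  proof -
    obtain I where I: "ideal_in I (BB \<sigma> \<tau>)" "J = to_fract ` I" using J emb_fract.im_ideal[OF B.ring] by blast
    have "closedin A.adic_top (to_fract ` I)" using A.ideal_closed I(1) eq by simp
    then show ?thesis unfolding I(2) mxB[symmetric] eq .
  qed
  \<comment> \<open>First circle: B = A gives regularity, regularity includes the Noetherian
    property, and that forces B = A.\<close>
  have regular: "ring_B \<sigma> \<tau> = ring_A \<sigma> \<tau> \<Longrightarrow> two_dim_regular_local_domain (ring_B \<sigma> \<tau>)"
    using A.regular ring_A_eq[OF st] by simp
  have regular_noeth: "two_dim_regular_local_domain (ring_B \<sigma> \<tau>) \<Longrightarrow> noetherian_ring ?B"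
    by (simp add: two_dim_regular_local_domain_def regular_local_ring_def)
  have noeth: "noetherian_ring ?B \<Longrightarrow> ring_B \<sigma> \<tau> = ring_A \<sigma> \<tau>"
    unfolding eq_iff unfolding ring_B_eq emb_fract.im_noetherian[OF B.ring]
    by (rule noetherian_imp_eq) blast
  \<comment> \<open>Second circle: for B = A every ideal is closed, the finitely generated ideals
    include the principal ones, and closed principal ideals force B = A.\<close>
  have fg_closed: "closedin ?T (genideal ?B G)"
    if "ring_B \<sigma> \<tau> = ring_A \<sigma> \<tau>" "G \<subseteq> ring_B \<sigma> \<tau>" for G
  proof -
    have eq: "BB \<sigma> \<tau> = AA \<sigma> \<tau>" using that(1) eq_iff by blast
    have "G \<subseteq> carrier B.imR" using that(2) by (simp add: ring_B_eq)
    then have "ideal (genideal B.imR G) B.imR" by (rule ring.genideal_ideal[OF emb_fract.im_ring[OF B.ring]])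
    then show ?thesis unfolding ring_B_eq by (rule ideal_closed[OF eq])
  qed
  have fg_principal: "closedin ?T I"
    if fg: "\<And>G. finite G \<and> G \<subseteq> ring_B \<sigma> \<tau> \<Longrightarrow> closedin ?T (genideal ?B G)" and I: "principalideal I ?B" for I
  proof -
    obtain i where i: "i \<in> ring_B \<sigma> \<tau>" "I = genideal ?B {i}"
      using principalideal.generate[OF I] by auto
    then show ?thesis using fg[of "{i}"] by simp
  qed
  have principal_eq: "ring_B \<sigma> \<tau> = ring_A \<sigma> \<tau>"
    if cl: "\<And>I. principalideal I ?B \<Longrightarrow>
      closedin ?T I"
    unfolding eq_iff
  proof (rule principal_closed_imp_eq)
    fix a assume a: "a \<in> BB \<sigma> \<tau>"
    have gen: "gen_in (BB \<sigma> \<tau>) {a} = {a * r | r. r \<in> BB \<sigma> \<tau>}" by (rule gen_in_single[OF B.ring a])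
    have "principalideal (to_fract ` {a * r | r. r \<in> BB \<sigma> \<tau>}) B.imR"
      unfolding emb_fract.im_principalideal[OF B.ring] gen[symmetric] using a by blast
    from cl[unfolded ring_B_eq, OF this]
    have "closedin (adic_topology B.imR (ideal_n \<sigma> \<tau>)) (to_fract ` {a * r | r. r \<in> BB \<sigma> \<tau>})" .
    moreover have "{a * r | r. r \<in> BB \<sigma> \<tau>} \<subseteq> BB \<sigma> \<tau>" using a closed_ring_mult[OF B.ring] by blast
    ultimately show "\<forall>f\<in>BB \<sigma> \<tau>. (\<forall>n. \<exists>i\<in>{a * r | r. r \<in> BB \<sigma> \<tau>}. f - i \<in> ord_ge n) \<longrightarrow> f \<in> {a * r | r. r \<in> BB \<sigma> \<tau>}"
      using closed_iff by blast
  qed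
  show ?thesis
  proof (intro conjI)
    show "two_dim_regular_local_domain (ring_A \<sigma> \<tau>)"
      unfolding ring_A_eq[OF st] by (rule A.regular)
    show "birationally_dominates (ring_A \<sigma> \<tau>) (ring_B \<sigma> \<tau>)"
      by (rule birational[OF st])
    show "max_ideal ?A = genideal ?A {x_var, y_var}"
      unfolding ring_A_eq[OF st] A.im_local(2) A.im_gen_XY ..
    show "canonically_completes_to ?A (max_ideal ?A)
        (subring_of power_series_xy)"
      unfolding ring_A_eq[OF st] A.im_local(2) by (rule A.canonically_completes)
    show "factorial_domain (subring_of (ring_U \<sigma> \<tau>))"
      unfolding ring_U_eq by (rule ufd_in_factorial_domain[OF emb_fract.im_ufd_in[OF ufd_UU[OF st tr]]])
    show "factorial_domain ?B"
      unfolding ring_B_eq by (rule ufd_in_factorial_domain[OF emb_fract.im_ufd_in[OF ufd_BB[OF st tr]]])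
    show "local_ring ?B" unfolding ring_B_eq by (rule B.im_local(1))
    show "krull_domain (ring_B \<sigma> \<tau>)"
      unfolding ring_B_eq by (rule ufd_in_krull_domain[OF emb_fract.im_ufd_in[OF ufd_BB[OF st tr]]])
    show "max_ideal ?B = ideal_n \<sigma> \<tau>"
      unfolding mxB[symmetric] unfolding ring_B_eq by (rule B.im_local(2))
    show "krull_dim ?B = 2 \<or> krull_dim ?B = 3"
      unfolding ring_B_eq by (rule krull_dim_BB[OF st tr])
    show "Hausdorff_space ?T"
      unfolding mxB[symmetric] unfolding ring_B_eq by (rule B.Hausdorff_top)
    show "canonically_completes_to ?B (ideal_n \<sigma> \<tau>) (subring_of power_series_xy)"
      unfolding mxB[symmetric] unfolding ring_B_eq by (rule B.canonically_completes)
    show "ring_B \<sigma> \<tau> = ring_A \<sigma> \<tau> \<longleftrightarrow> two_dim_regular_local_domain (ring_B \<sigma> \<tau>)"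
      using regular regular_noeth noeth by blast
    show "ring_B \<sigma> \<tau> = ring_A \<sigma> \<tau> \<longleftrightarrow> noetherian_ring ?B"
      using regular regular_noeth noeth by blast
    show "ring_B \<sigma> \<tau> = ring_A \<sigma> \<tau> \<longleftrightarrow>
       (\<forall>G. finite G \<and> G \<subseteq> ring_B \<sigma> \<tau> \<longrightarrow>
          closedin ?T (genideal ?B G))"
      using fg_closed fg_principal principal_eq by blast
    show "ring_B \<sigma> \<tau> = ring_A \<sigma> \<tau> \<longleftrightarrow>
       (\<forall>I. principalideal I ?B \<longrightarrow>
          closedin ?T I)"
      using fg_closed fg_principal principal_eq by blast
  qed
qed

end
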